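(* Let $(M^3,T,d)$ be a closed connected three-dimensional piecewise flat metrized manifold which is Ricci flat, i.e. $K_{ij}=0$ for all edges $\{i,j\}\in E(T)$. Suppose that at least one of the following holds: (1) $\ell_{ij}^*>0$ for all edges $\{i,j\}\in E(T)$; (2) $d$ is in the image of the sphere packing conformal structure $\mathcal{C}^P(M,T)$. Then $(M,T,d)$ is rigid with respect to any conformal variations: if $f:(-\varepsilon,\varepsilon)\to V(T)^*$ is a conformal variation of $(M,T,d)$ with extension $\mathcal{C}$ such that $(M,T,\mathcal{C}[f(t)])$ remains critical for the Einstein-Hilbert-Regge functional under conformal variations, i.e. its scalar curvatures satisfy $K_i=0$ for all $i\in V(T)$ and all $t\in(-\varepsilon,\varepsilon)$, then for all $t$ in some neighborhood of $0$ the variation only scales the edge lengths uniformly, i.e. there are numbers $s(t)>0$ such that the lengths of $\mathcal{C}[f(t)]$ satisfy $\ell_{ij}(t)=s(t)\,\ell_{ij}(0)$ for every edge $\{i,j\}\in E(T)$.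
   Context: A triangulated manifold $(M,T)$ is a topological manifold with a triangulation $T$ (here finite, and simplices are determined by their vertices and written $\{i,j,\dots,k\}$). $V(T)$, $E(T)$, $E_+(T)$ are the sets of vertices, edges, and directed edges (each edge $\{i,j\}$ gives two directed edges $(i,j)$ and $(j,i)$); $X^*$ is the vector space of functions $X\to\mathbb{R}$. $(M,T,\ell)$, with $\ell\in E(T)^*$, is piecewise flat if every simplex can be realized as a nondegenerate Euclidean simplex with edge lengths given by $\ell$. A (piecewise flat) metric is $d\in E_+(T)^*$ such that with $\ell_{ij}=d_{ij}+d_{ji}$, $(M,T,\ell)$ is piecewise flat, and for every triangle $\{i,j,k\}$: $d_{ij}^2+d_{jk}^2+d_{ki}^2=d_{ji}^2+d_{ik}^2+d_{kj}^2$. (The $d_{ij}$ may be negative.) Then $(M,T,d)$ is a piecewise flat metrized manifold; $\mathfrak{met}(M,T)$ is the set of all metrics $d$. A conformal structure on an open set $U\subset V(T)^*$ is a smooth map $\mathcal{C}:U\to\mathfrak{met}(M,T)\subset E_+(T)^*$ such that, writing $d=\mathcal{C}[f]$ and $\ell_{ij}=d_{ij}+d_{ji}$, for each $(i,j)\in E_+(T)$ and $k\in V(T)$: $\partial\ell_{ij}/\partial f_i=d_{ij}$, and $\partial d_{ij}/\partial f_k=0$ if $k\ne i$ and $k\neq j$. A conformal variation of $(M,T,d)$ is a smooth curve $f:(-\varepsilon,\varepsilon)\to V(T)^*$ for which there is a conformal structure $\mathcal{C}:U\to\mathfrak{met}(M,T)$ with $f((-\varepsilon,\varepsilon))\subset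 U$ and $\mathcal{C}[f(0)]=d$; such $\mathcal{C}$ is called an extension of the variation. The sphere packing conformal structure $\mathcal{C}^P(M,T)$ is the map given by $d_{ij}=e^{f_i}$ for every directed edge $(i,j)$, restricted to those $f\in V(T)^*$ for which the resulting $d$ is a metric (all tetrahedra nondegenerate). $\gamma_{i,jk}$ is the angle at vertex $i$ in triangle $\{i,j,k\}$; $\beta_{ij,k\ell}$ is the dihedral angle at edge $\{i,j\}$ in tetrahedron $\{i,j,k,\ell\}$. Define $$h_{ij,k}=\frac{d_{ik}-d_{ij}\cos\gamma_{i,jk}}{\sin\gamma_{i,jk}},\qquad h_{ijk,\ell}=\frac{h_{ij,\ell}-h_{ij,k}\cos\beta_{ij,k\ell}}{\sin\beta_{ij,k\ell}},\qquad A_{ij,k\ell}=\tfrac12\left(h_{ij,k}h_{ijk,\ell}+h_{ij,\ell}h_{ij\ell,k}\right).$$ The dual length is $\ell_{ij}^*=\sum A_{ij,k\ell}$, the sum over all tetrahedra $\{i,j,k,\ell\}$ containing $\{i,j\}$, each counted once. The edge curvature is $K_{ij}=\left(2\pi-\sum\beta_{ij,k\ell}\right)\ell_{ij}$ and the scalar curvature at vertex $i$ is $K_i=\sum_{j}\left(2\pi-\sum\beta_{ij,k\ell}\right)d_{ij}$, where the outer sum is over edges $\{i,j\}$ containing $i$ and the inner sums are over all tetrahedra $\{i,j,k,\ell\}$ containing $\{i,j\}$. The Einstein-Hilbert-Regge functional is $\mathcal{EHR}(M,T,\ell)=\sum_{\{i,j\}\in E(T)}K_{ij}$. *)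

theory Defs
  imports "HOL-Analysis.Analysis"
begin

section \<open>Triangulated manifolds\<close>

definition topological_manifold :: "nat \<Rightarrow> 'm topology \<Rightarrow> bool" where
  "topological_manifold n M \<longleftrightarrow>
     Hausdorff_space M \<and> second_countable M \<and>
     (\<forall>x \<in> topspace M. \<exists>W. openin M W \<and> x \<in> W \<and>
        subtopology M W homeomorphic_space Euclidean_space n)"

definition closed_manifold :: "nat \<Rightarrow> 'm topology \<Rightarrow> bool" where
  "closed_manifold n M \<longleftrightarrow> topological_manifold n M \<and> compact_space M"

text \<open>A triangulation is an abstract simplicial complex \<open>T\<close>, simplices being identified with their
  (nonempty) vertex sets. The vertex set \<open>V(T)\<close> is the whole of the finite type \<open>'v\<close>, so that
  \<open>V(T)\<^sup>*\<close> is the type \<open>real^'v\<close>.\<close>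

definition abstract_complex :: "'v::finite set set \<Rightarrow> bool" where
  "abstract_complex T \<longleftrightarrow>
     {} \<notin> T \<and> (\<forall>v. {v} \<in> T) \<and> (\<forall>\<sigma>\<in>T. \<forall>\<tau>. \<tau> \<subseteq> \<sigma> \<and> \<tau> \<noteq> {} \<longrightarrow> \<tau> \<in> T)"

definition geometric_realization :: "'v::finite set set \<Rightarrow> (real^'v) set" where
  "geometric_realization T =
     {x. (\<forall>v. 0 \<le> x $ v) \<and> (\<Sum>v\<in>UNIV. x $ v) = 1 \<and> {v. x $ v \<noteq> 0} \<in> T}"

definition triangulates :: "'v::finite set set \<Rightarrow> 'm topology \<Rightarrow> bool" where
  "triangulates T M \<longleftrightarrow>
     abstract_complex T \<and> M homeomorphic_space top_of_set (geometric_realization T)"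

definition edges :: "'v set set \<Rightarrow> 'v set set" where
  "edges T = {e \<in> T. card e = 2}"

definition directed_edges :: "'v set set \<Rightarrow> ('v \<times> 'v) set" where
  "directed_edges T = {(i, j). {i, j} \<in> edges T}"

text \<open>Elements of \<open>E\<^sub>+(T)\<^sup>*\<close> are functions of type \<open>'v \<Rightarrow> 'v \<Rightarrow> real\<close>; only their values on directed
  edges are meaningful.\<close>

definition eq_on_directed_edges ::
  "'v set set \<Rightarrow> ('v \<Rightarrow> 'v \<Rightarrow> real) \<Rightarrow> ('v \<Rightarrow> 'v \<Rightarrow> real) \<Rightarrow> bool" where
  "eq_on_directed_edges T d d' \<longleftrightarrow> (\<forall>(i, j) \<in> directed_edges T. d i j = d' i j)"


section \<open>Piecewise flat metrics\<close>

definition edge_len :: "('v \<Rightarrow> 'v \<Rightarrow> real) \<Rightarrow> 'v \<Rightarrow> 'v \<Rightarrow> real" where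
  "edge_len d i j = d i j + d j i"

text \<open>A nondegenerate Euclidean simplex with vertex set \<open>\<sigma>\<close> and edge lengths \<open>L\<close>. The ambient space
  \<open>real^'v\<close> has dimension at least \<open>card \<sigma>\<close>, so its choice is no restriction.\<close>

definition realizes ::
  "('v \<Rightarrow> 'v \<Rightarrow> real) \<Rightarrow> 'v::finite set \<Rightarrow> ('v \<Rightarrow> real^'v) \<Rightarrow> bool" where
  "realizes L \<sigma> p \<longleftrightarrow>
     inj_on p \<sigma> \<and> \<not> affine_dependent (p ` \<sigma>) \<and>
     (\<forall>i\<in>\<sigma>. \<forall>j\<in>\<sigma>. i \<noteq> j \<longrightarrow> dist (p i) (p j) = L i j)"

definition piecewise_flat :: "'v::finite set set \<Rightarrow> ('v \<Rightarrow> 'v \<Rightarrow> real) \<Rightarrow> bool" where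
  "piecewise_flat T L \<longleftrightarrow> (\<forall>\<sigma>\<in>T. \<exists>p. realizes L \<sigma> p)"

definition pf_metric :: "'v::finite set set \<Rightarrow> ('v \<Rightarrow> 'v \<Rightarrow> real) \<Rightarrow> bool" where
  "pf_metric T d \<longleftrightarrow>
     piecewise_flat T (edge_len d) \<and>
     (\<forall>i j k. {i, j, k} \<in> T \<and> card {i, j, k} = 3 \<longrightarrow>
        (d i j)\<^sup>2 + (d j k)\<^sup>2 + (d k i)\<^sup>2 = (d j i)\<^sup>2 + (d i k)\<^sup>2 + (d k j)\<^sup>2)"


section \<open>Angles, dual lengths and curvatures\<close>

text \<open>Angles are read off from a chosen Euclidean realization of the simplex. They do not depend on
  the choice, since any two realizations are congruent.\<close>

definition realization :: "('v \<Rightarrow> 'v \<Rightarrow> real) \<Rightarrow> 'v::finite set \<Rightarrow> 'v \<Rightarrow> real^'v" where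
  "realization L \<sigma> = (SOME p. realizes L \<sigma> p)"

definition vangle :: "'a::real_inner \<Rightarrow> 'a \<Rightarrow> real" where
  "vangle u w = arccos (u \<bullet> w / (norm u * norm w))"

definition orth_part :: "'a::real_inner \<Rightarrow> 'a \<Rightarrow> 'a" where
  "orth_part u w = w - (w \<bullet> u / (u \<bullet> u)) *\<^sub>R u"

text \<open>\<open>tri_angle L i j k\<close> is \<open>\<gamma>\<^bsub>i,jk\<^esub>\<close> and \<open>dihedral_angle L i j k l\<close> is \<open>\<beta>\<^bsub>ij,kl\<^esub>\<close>.\<close>

definition tri_angle :: "('v \<Rightarrow> 'v \<Rightarrow> real) \<Rightarrow> 'v::finite \<Rightarrow> 'v \<Rightarrow> 'v \<Rightarrow> real" where
  "tri_angle L i j k =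
     (let p = realization L {i, j, k} in vangle (p j - p i) (p k - p i))"

definition dihedral_angle ::
  "('v \<Rightarrow> 'v \<Rightarrow> real) \<Rightarrow> 'v::finite \<Rightarrow> 'v \<Rightarrow> 'v \<Rightarrow> 'v \<Rightarrow> real" where
  "dihedral_angle L i j k l =
     (let p = realization L {i, j, k, l}; u = p j - p i
      in vangle (orth_part u (p k - p i)) (orth_part u (p l - p i)))"

text \<open>\<open>height2 d i j k\<close> is \<open>h\<^bsub>ij,k\<^esub>\<close> and \<open>height3 d i j k l\<close> is \<open>h\<^bsub>ijk,l\<^esub>\<close>.\<close>

definition height2 :: "('v \<Rightarrow> 'v \<Rightarrow> real) \<Rightarrow> 'v::finite \<Rightarrow> 'v \<Rightarrow> 'v \<Rightarrow> real" where
  "height2 d i j k =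
     (d i k - d i j * cos (tri_angle (edge_len d) i j k)) / sin (tri_angle (edge_len d) i j k)"

definition height3 :: "('v \<Rightarrow> 'v \<Rightarrow> real) \<Rightarrow> 'v::finite \<Rightarrow> 'v \<Rightarrow> 'v \<Rightarrow> 'v \<Rightarrow> real" where
  "height3 d i j k l =
     (height2 d i j l - height2 d i j k * cos (dihedral_angle (edge_len d) i j k l))
       / sin (dihedral_angle (edge_len d) i j k l)"

definition dual_area :: "('v \<Rightarrow> 'v \<Rightarrow> real) \<Rightarrow> 'v::finite \<Rightarrow> 'v \<Rightarrow> 'v \<Rightarrow> 'v \<Rightarrow> real" where
  "dual_area d i j k l =
     (height2 d i j k * height3 d i j k l + height2 d i j l * height3 d i j l k) / 2"

lemma dihedral_angle_commute: "dihedral_angle L i j k l = dihedral_angle L i j l k"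
  by (simp add: dihedral_angle_def vangle_def Let_def insert_commute inner_commute mult.commute)

lemma dual_area_commute: "dual_area d i j k l = dual_area d i j l k"
  by (simp add: dual_area_def)

text \<open>The sum of \<open>F k l\<close> over the tetrahedra \<open>{i,j,k,l}\<close> containing \<open>{i,j}\<close>, each counted once. Every
  such tetrahedron arises from the two pairs \<open>(k,l)\<close> and \<open>(l,k)\<close>, whence the factor \<open>1/2\<close>; this is
  only used for \<open>F\<close> symmetric in \<open>k\<close> and \<open>l\<close>.\<close>

definition tetrahedra_sum ::
  "'v::finite set set \<Rightarrow> 'v \<Rightarrow> 'v \<Rightarrow> ('v \<Rightarrow> 'v \<Rightarrow> real) \<Rightarrow> real" where
  "tetrahedra_sum T i j F =
     (\<Sum>(k, l) \<in> {(k, l). {i, j, k, l} \<in> T \<and> card {i, j, k, l} = 4}. F k l) / 2"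

definition dual_length :: "'v::finite set set \<Rightarrow> ('v \<Rightarrow> 'v \<Rightarrow> real) \<Rightarrow> 'v \<Rightarrow> 'v \<Rightarrow> real" where
  "dual_length T d i j = tetrahedra_sum T i j (dual_area d i j)"

definition cone_defect :: "'v::finite set set \<Rightarrow> ('v \<Rightarrow> 'v \<Rightarrow> real) \<Rightarrow> 'v \<Rightarrow> 'v \<Rightarrow> real" where
  "cone_defect T L i j = 2 * pi - tetrahedra_sum T i j (dihedral_angle L i j)"

definition edge_curvature :: "'v::finite set set \<Rightarrow> ('v \<Rightarrow> 'v \<Rightarrow> real) \<Rightarrow> 'v \<Rightarrow> 'v \<Rightarrow> real" where
  "edge_curvature T d i j = cone_defect T (edge_len d) i j * edge_len d i j"

definition scalar_curvature :: "'v::finite set set \<Rightarrow> ('v \<Rightarrow> 'v \<Rightarrow> real) \<Rightarrow> 'v \<Rightarrow> real" where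
  "scalar_curvature T d i =
     (\<Sum>j \<in> {j. (i, j) \<in> directed_edges T}. cone_defect T (edge_len d) i j * d i j)"


section \<open>Smooth maps\<close>

text \<open>\<open>C\<^sup>n\<close> maps on an open subset of a finite-dimensional space.\<close>

primrec Ck_on :: "nat \<Rightarrow> 'a::euclidean_space set \<Rightarrow> ('a \<Rightarrow> 'b::real_normed_vector) \<Rightarrow> bool" where
  "Ck_on 0 S g \<longleftrightarrow> continuous_on S g"
| "Ck_on (Suc n) S g \<longleftrightarrow>
     (\<forall>x\<in>S. g differentiable (at x)) \<and>
     (\<forall>v. Ck_on n S (\<lambda>x. frechet_derivative g (at x) v))"

definition smooth_on :: "'a::euclidean_space set \<Rightarrow> ('a \<Rightarrow> 'b::real_normed_vector) \<Rightarrow> bool" where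
  "smooth_on S g \<longleftrightarrow> (\<forall>n. Ck_on n S g)"

definition has_partial :: "(real^'v \<Rightarrow> real) \<Rightarrow> 'v::finite \<Rightarrow> real^'v \<Rightarrow> real \<Rightarrow> bool" where
  "has_partial g k x D \<longleftrightarrow>
     ((\<lambda>t. g (x + t *\<^sub>R axis k 1)) has_real_derivative D) (at 0)"


section \<open>Conformal structures and variations\<close>

definition conformal_structure ::
  "'v::finite set set \<Rightarrow> (real^'v) set \<Rightarrow> (real^'v \<Rightarrow> 'v \<Rightarrow> 'v \<Rightarrow> real) \<Rightarrow> bool" where
  "conformal_structure T U C \<longleftrightarrow>
     open U \<and>
     (\<forall>x\<in>U. pf_metric T (C x)) \<and>
     (\<forall>(i, j) \<in> directed_edges T. smooth_on U (\<lambda>x. C x i j)) \<and>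
     (\<forall>x\<in>U. \<forall>(i, j) \<in> directed_edges T.
        has_partial (\<lambda>y. edge_len (C y) i j) i x (C x i j) \<and>
        (\<forall>k. k \<noteq> i \<and> k \<noteq> j \<longrightarrow> has_partial (\<lambda>y. C y i j) k x 0))"

text \<open>\<open>f\<close>, defined on \<open>(-\<epsilon>,\<epsilon>)\<close>, is a conformal variation of \<open>(M,T,d)\<close> with extension \<open>C\<close> on \<open>U\<close>.\<close>

definition conformal_variation ::
  "'v::finite set set \<Rightarrow> ('v \<Rightarrow> 'v \<Rightarrow> real) \<Rightarrow> real \<Rightarrow> (real \<Rightarrow> real^'v) \<Rightarrow>
   (real^'v) set \<Rightarrow> (real^'v \<Rightarrow> 'v \<Rightarrow> 'v \<Rightarrow> real) \<Rightarrow> bool" where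
  "conformal_variation T d \<epsilon> f U C \<longleftrightarrow>
     0 < \<epsilon> \<and> smooth_on {-\<epsilon><..<\<epsilon>} f \<and>
     conformal_structure T U C \<and> f ` {-\<epsilon><..<\<epsilon>} \<subseteq> U \<and>
     eq_on_directed_edges T (C (f 0)) d"

definition sphere_packing :: "real^'v \<Rightarrow> 'v::finite \<Rightarrow> 'v \<Rightarrow> real" where
  "sphere_packing x i j = exp (x $ i)"

definition sphere_packing_domain :: "'v::finite set set \<Rightarrow> (real^'v) set" where
  "sphere_packing_domain T = {x. pf_metric T (sphere_packing x)}"

definition in_sphere_packing_image :: "'v::finite set set \<Rightarrow> ('v \<Rightarrow> 'v \<Rightarrow> real) \<Rightarrow> bool" where
  "in_sphere_packing_image T d \<longleftrightarrow>
     (\<exists>x \<in> sphere_packing_domain T. eq_on_directed_edges T d (sphere_packing x))"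

end

theory Submission
  imports Defs
begin

text \<open>Moving along a conformal structure with velocity \<open>w\<close> changes the lengths of a tetrahedron, to first
order, as if every vertex moved radially away from its \<^emph>\<open>center\<close> \<open>c\<close> with rate \<open>w\<close>; here \<open>c\<close> is the point
whose orthogonal projections to the edges cut these into the pieces \<open>d\<^sub>i\<^sub>j\<close> and \<open>d\<^sub>j\<^sub>i\<close> (the condition on
triangles in the definition of a metric says that such a point exists). The velocity of a vertex has
component \<open>- w\<close> times the height of \<open>c\<close> in the direction of the inner normal of a face through that vertex, so the
variation of a dihedral angle is a sum of one term for each of its two faces
(\<open>dihedral_variation\<close>). Summing length variation times angle variation over the edges of a
tetrahedron and collecting the terms of each face gives (\<open>energy_identity\<close>)

  \<open>- (\<Sum> \<delta>\<ell>\<^sub>i\<^sub>j \<delta>\<beta>\<^sub>i\<^sub>j) = (\<Sum> 2 A\<^sub>i\<^sub>j / \<ell>\<^sub>i\<^sub>j (w\<^sub>i - w\<^sub>j)\<^sup>2)\<close>.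

At a Ricci flat metric all cone defects vanish. The derivative of \<open>K\<^sub>i\<close> then only involves the
variations of the cone defects, and the sum of \<open>w\<^sub>i \<delta>K\<^sub>i\<close> is this quadratic form, summed over all
tetrahedra (\<open>curvature_jacobian_flat\<close>): the Jacobian of the curvature map is a weighted graph
Laplacian with weights \<open>2 \<ell>\<^sup>* / \<ell>\<close>. Its quadratic form is positive on nonconstant \<open>w\<close>. With positive dual
lengths this is clear, because the 1-skeleton is connected. For sphere packings, single weights may
be negative, but the form is positive already on each tetrahedron (\<open>packing_form_pos\<close>). To see this,
use the curvatures \<open>\<kappa>\<close> of the four spheres: the dihedral angle at an edge is \<open>\<phi>\<^sub>k + \<phi>\<^sub>l\<close>, where the angle
\<open>\<phi>\<^sub>l\<close> belongs to the face opposite to \<open>l\<close> and \<open>tan \<phi>\<^sub>l = (\<Sum>\<kappa> - 2 \<kappa>\<^sub>l) / \<surd>D\<close> with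
\<open>D = (\<Sum>\<kappa>)\<^sup>2 - 2 (\<Sum>\<kappa>\<^sup>2)\<close>. A vector in the kernel of the form keeps all \<open>\<phi>\<^sub>l\<close> fixed, hence scales \<open>\<kappa>\<close>;
so the form is nondegenerate modulo constants as long as \<open>D > 0\<close>, and it stays positive along a path
from a tetrahedron for which all its weights are positive.

Adding a constant to \<open>f\<close> scales all lengths (\<open>edge_len_uniform_scaling\<close>), so the line through \<open>f 0\<close>
in the direction \<open>(1, \<dots>, 1)\<close> consists of Ricci flat metrics and lies in the zero set of the curvature
map. As the Jacobian is positive definite on sums-to-zero vectors near \<open>f 0\<close>, two zeros near \<open>f 0\<close>
whose difference sums to zero coincide (\<open>locally_injective_of_pos_def_jacobian\<close>). Hence the zero set
near \<open>f 0\<close> is this line, and \<open>f t\<close> stays on it.\<close>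

section \<open>Gram determinants of Euclidean tetrahedra\<close>

text \<open>If \<open>L\<close> are the lengths of a tetrahedron with vertices \<open>p\<close>, this is the inner product of
\<open>p j - p i\<close> and \<open>p k - p i\<close>, by the law of cosines. The next three definitions are the corresponding
\<open>2 \<times> 2\<close> Gram determinant (the squared double area of a triangle), the mixed \<open>2 \<times> 2\<close> minor whose quotient by
\<open>(L i j)\<^sup>2\<close> is the inner product of the components of \<open>p k - p i\<close> and \<open>p l - p i\<close> orthogonal to the edge,
and the \<open>3 \<times> 3\<close> Gram determinant (36 times the squared volume).\<close>

definition corner_dot :: "('v \<Rightarrow> 'v \<Rightarrow> real) \<Rightarrow> 'v \<Rightarrow> 'v \<Rightarrow> 'v \<Rightarrow> real" where
  "corner_dot L i j k = ((L i j)\<^sup>2 + (L i k)\<^sup>2 - (L j k)\<^sup>2) / 2"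

definition gram2 :: "('v \<Rightarrow> 'v \<Rightarrow> real) \<Rightarrow> 'v \<Rightarrow> 'v \<Rightarrow> 'v \<Rightarrow> real" where
  "gram2 L i j k = (L i j)\<^sup>2 * (L i k)\<^sup>2 - (corner_dot L i j k)\<^sup>2"

definition mixed_gram :: "('v \<Rightarrow> 'v \<Rightarrow> real) \<Rightarrow> 'v \<Rightarrow> 'v \<Rightarrow> 'v \<Rightarrow> 'v \<Rightarrow> real" where
  "mixed_gram L i j k l =
     (L i j)\<^sup>2 * corner_dot L i k l - corner_dot L i j k * corner_dot L i j l"

definition gram3 :: "('v \<Rightarrow> 'v \<Rightarrow> real) \<Rightarrow> 'v \<Rightarrow> 'v \<Rightarrow> 'v \<Rightarrow> 'v \<Rightarrow> real" where
  "gram3 L i j k l =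
     (L i j)\<^sup>2 * (L i k)\<^sup>2 * (L i l)\<^sup>2
     + 2 * corner_dot L i j k * corner_dot L i k l * corner_dot L i j l
     - (L i j)\<^sup>2 * (corner_dot L i k l)\<^sup>2 - (L i k)\<^sup>2 * (corner_dot L i j l)\<^sup>2
     - (L i l)\<^sup>2 * (corner_dot L i j k)\<^sup>2"

text \<open>Jacobi's identity for the minors of the Gram matrix; it becomes \<open>cos\<^sup>2 + sin\<^sup>2 = 1\<close> for the dihedral
angle.\<close>

lemma gram2_mult_gram2:
  "gram2 L i j k * gram2 L i j l = (mixed_gram L i j k l)\<^sup>2 + (L i j)\<^sup>2 * gram3 L i j k l"
  unfolding gram2_def mixed_gram_def gram3_def by (simp add: algebra_simps power2_eq_square)

lemma realizes_realization: "\<exists>p. realizes L \<sigma> p \<Longrightarrow> realizes L \<sigma> (realization L \<sigma>)"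
  unfolding realization_def by (erule someI_ex)

lemma gram_matrix_realizes:
  assumes "realizes L \<sigma> p" "i \<in> \<sigma>" "j \<in> \<sigma>" "k \<in> \<sigma>" "i \<noteq> j" "i \<noteq> k" "j \<noteq> k"
  shows "(p j - p i) \<bullet> (p j - p i) = (L i j)\<^sup>2"
    and "(p j - p i) \<bullet> (p k - p i) = corner_dot L i j k"
    and "norm (p j - p i) = L i j"
    and "L i j > 0"
proof -
  have d: "dist (p i) (p j) = L i j" "dist (p i) (p k) = L i k" "dist (p j) (p k) = L j k"
    using assms by (auto simp: realizes_def)
  have "p i \<noteq> p j" using assms by (auto simp: realizes_def dest: inj_onD)
  then show "L i j > 0" using d(1) by (metis dist_pos_lt)
  show n: "norm (p j - p i) = L i j" using d(1) by (simp add: dist_norm norm_minus_commute)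
  have n2: "norm (p k - p i) = L i k" using d(2) by (simp add: dist_norm norm_minus_commute)
  have n3: "norm ((p j - p i) - (p k - p i)) = L j k" using d(3) by (simp add: dist_norm)
  show "(p j - p i) \<bullet> (p j - p i) = (L i j)\<^sup>2" using n by (simp add: dot_square_norm)
  have "(p j - p i) \<bullet> (p k - p i) = ((norm (p j - p i))\<^sup>2 + (norm (p k - p i))\<^sup>2
      - (norm ((p j - p i) - (p k - p i)))\<^sup>2) / 2"
    by (rule dot_norm_neg)
  then show "(p j - p i) \<bullet> (p k - p i) = corner_dot L i j k"
    unfolding n n2 n3 corner_dot_def .
qed

lemma not_in_plane_of_affine_independent:
  assumes "realizes L \<sigma> p" "{i, j, k, l} \<subseteq> \<sigma>" "l \<notin> {i, j, k}"
  shows "p l - p i \<noteq> \<alpha> *\<^sub>R (p j - p i) + \<beta> *\<^sub>R (p k - p i)"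
proof
  assume eq: "p l - p i = \<alpha> *\<^sub>R (p j - p i) + \<beta> *\<^sub>R (p k - p i)"
  have "p l = (1 - \<alpha> - \<beta>) *\<^sub>R p i + \<alpha> *\<^sub>R p j + \<beta> *\<^sub>R p k"
    using eq by (simp add: algebra_simps)
  moreover have "(1 - \<alpha> - \<beta>) + \<alpha> + \<beta> = 1" by simp
  ultimately have "p l \<in> affine hull {p i, p j, p k}"
    unfolding affine_hull_3 by blast
  moreover have "{p i, p j, p k} \<subseteq> p ` \<sigma> - {p l}"
    using assms by (auto simp: realizes_def dest: inj_onD)
  ultimately have "p l \<in> affine hull (p ` \<sigma> - {p l})"
    using hull_mono by blast
  then have "affine_dependent (p ` \<sigma>)"
    unfolding affine_dependent_def using assms by auto
  then show False using assms by (simp add: realizes_def)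
qed

text \<open>Up to a positive factor, the determinant is the squared norm of a combination of the edge vectors
that vanishes only for a degenerate triangle; similarly for the tetrahedron below.\<close>

lemma gram2_pos:
  assumes "\<exists>p. realizes L \<sigma> p" "i \<in> \<sigma>" "j \<in> \<sigma>" "k \<in> \<sigma>" "i \<noteq> j" "i \<noteq> k" "j \<noteq> k"
  shows "gram2 L i j k > 0"
proof -
  obtain p where p: "realizes L \<sigma> p" using assms(1) by blast
  define a b where "a = p j - p i" and "b = p k - p i"
  have g: "a \<bullet> a = (L i j)\<^sup>2" "a \<bullet> b = corner_dot L i j k" "b \<bullet> b = (L i k)\<^sup>2" "L i j > 0"
    using gram_matrix_realizes[OF p, of i j k] gram_matrix_realizes[OF p, of i k j] assms
    by (auto simp: a_def b_def)
  define z where "z = (a \<bullet> a) *\<^sub>R b - (a \<bullet> b) *\<^sub>R a"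
  have "z \<noteq> 0"
  proof
    assume "z = 0"
    then have "(a \<bullet> a) *\<^sub>R b = (a \<bullet> b) *\<^sub>R a" by (simp add: z_def)
    then have "(1 / (a \<bullet> a)) *\<^sub>R ((a \<bullet> a) *\<^sub>R b) = (1 / (a \<bullet> a)) *\<^sub>R ((a \<bullet> b) *\<^sub>R a)"
      by simp
    then have "b = ((a \<bullet> b) / (a \<bullet> a)) *\<^sub>R a" using g(1,4) by simp
    then have "p k - p i = ((a \<bullet> b) / (a \<bullet> a)) *\<^sub>R (p j - p i) + 0 *\<^sub>R (p j - p i)"
      by (simp add: a_def b_def)
    then show False
      using not_in_plane_of_affine_independent[OF p, of i j j k "(a \<bullet> b) / (a \<bullet> a)" 0] assms by auto
  qed
  then have "z \<bullet> z > 0" by simp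
  moreover have "z \<bullet> z = (a \<bullet> a) * gram2 L i j k"
    unfolding gram2_def g(1)[symmetric] g(2)[symmetric] g(3)[symmetric] z_def
    by (simp add: inner_simps inner_commute power2_eq_square algebra_simps)
  ultimately show ?thesis using g
    by (metis inner_ge_zero zero_less_mult_pos zero_less_power)
qed

lemma gram3_pos:
  assumes "\<exists>p. realizes L \<sigma> p" "{i, j, k, l} \<subseteq> \<sigma>" "distinct [i, j, k, l]"
  shows "gram3 L i j k l > 0"
proof -
  obtain p where p: "realizes L \<sigma> p" using assms(1) by blast
  define a b c where "a = p j - p i" and "b = p k - p i" and "c = p l - p i"
  have g: "a \<bullet> a = (L i j)\<^sup>2" "a \<bullet> b = corner_dot L i j k" "b \<bullet> b = (L i k)\<^sup>2"
    "a \<bullet> c = corner_dot L i j l" "b \<bullet> c = corner_dot L i k l" "c \<bullet> c = (L i l)\<^sup>2"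
    using gram_matrix_realizes[OF p, of i j k] gram_matrix_realizes[OF p, of i k l]
      gram_matrix_realizes[OF p, of i l j] gram_matrix_realizes[OF p, of i j l] assms
    by (auto simp: a_def b_def c_def)
  define D where "D = gram2 L i j k"
  have D: "D > 0" unfolding D_def using gram2_pos[OF assms(1), of i j k] assms by auto
  define \<alpha> \<beta> where "\<alpha> = (a \<bullet> c) * (b \<bullet> b) - (b \<bullet> c) * (a \<bullet> b)"
    and "\<beta> = (b \<bullet> c) * (a \<bullet> a) - (a \<bullet> c) * (a \<bullet> b)"
  \<comment> \<open>the altitude vector from the face \<open>i j k\<close> to \<open>l\<close>, cleared of denominators by
    Cramer's rule\<close>
  define z where "z = D *\<^sub>R c - \<alpha> *\<^sub>R a - \<beta> *\<^sub>R b"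
  have "z \<noteq> 0"
  proof
    assume "z = 0"
    then have "D *\<^sub>R c = \<alpha> *\<^sub>R a + \<beta> *\<^sub>R b" by (simp add: z_def algebra_simps)
    then have "(1 / D) *\<^sub>R (D *\<^sub>R c) = (1 / D) *\<^sub>R (\<alpha> *\<^sub>R a + \<beta> *\<^sub>R b)" by simp
    then have "c = (\<alpha> / D) *\<^sub>R a + (\<beta> / D) *\<^sub>R b" using D
      by (simp add: scaleR_add_right)
    then show False
      using not_in_plane_of_affine_independent[OF p, of i j k l] assms
      by (auto simp: a_def b_def c_def)
  qed
  then have "z \<bullet> z > 0" by simp
  moreover have "z \<bullet> z = D * gram3 L i j k l"
    unfolding gram3_def z_def \<alpha>_def \<beta>_def D_def gram2_def
      g(1)[symmetric] g(2)[symmetric] g(3)[symmetric] g(4)[symmetric] g(5)[symmetric] g(6)[symmetric]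
    by (simp add: inner_simps inner_commute power2_eq_square algebra_simps)
  ultimately show ?thesis using D by (metis zero_less_mult_pos)
qed

lemma tri_angle_realizable:
  assumes "\<exists>p. realizes L {i, j, k} p" "i \<noteq> j" "i \<noteq> k" "j \<noteq> k"
  shows "cos (tri_angle L i j k) = corner_dot L i j k / (L i j * L i k)"
    and "sin (tri_angle L i j k) = sqrt (gram2 L i j k) / (L i j * L i k)"
proof -
  let ?p = "realization L {i, j, k}"
  have p: "realizes L {i, j, k} ?p" by (rule realizes_realization[OF assms(1)])
  have g: "(?p j - ?p i) \<bullet> (?p k - ?p i) = corner_dot L i j k" "norm (?p j - ?p i) = L i j"
    "norm (?p k - ?p i) = L i k" "L i j > 0" "L i k > 0"
    using gram_matrix_realizes[OF p, of i j k] gram_matrix_realizes[OF p, of i k j] assms by auto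
  have t: "tri_angle L i j k = arccos (corner_dot L i j k / (L i j * L i k))"
    unfolding tri_angle_def vangle_def Let_def g ..
  have D: "gram2 L i j k > 0" using gram2_pos[OF assms(1)] assms by auto
  have e: "1 - (corner_dot L i j k / (L i j * L i k))\<^sup>2 = gram2 L i j k / (L i j * L i k)\<^sup>2"
    using g by (simp add: gram2_def field_simps)
  have "(corner_dot L i j k / (L i j * L i k))\<^sup>2 \<le> 1"
    using D g e by (smt (verit) divide_nonneg_nonneg zero_le_power2)
  then have b: "\<bar>corner_dot L i j k / (L i j * L i k)\<bar> \<le> 1" by (simp add: abs_square_le_1)
  show "cos (tri_angle L i j k) = corner_dot L i j k / (L i j * L i k)"
    unfolding t by (rule cos_arccos_abs[OF b])
  have "sin (tri_angle L i j k) = sqrt (gram2 L i j k / (L i j * L i k)\<^sup>2)"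
    unfolding t using b by (subst sin_arccos_abs) (auto simp: e)
  then show "sin (tri_angle L i j k) = sqrt (gram2 L i j k) / (L i j * L i k)"
    using g by (simp add: real_sqrt_divide)
qed

lemma dihedral_angle_realizable:
  assumes "\<exists>p. realizes L {i, j, k, l} p" "distinct [i, j, k, l]"
  defines "c \<equiv> mixed_gram L i j k l / (sqrt (gram2 L i j k) * sqrt (gram2 L i j l))"
  shows "dihedral_angle L i j k l = arccos c" and "-1 < c" and "c < 1"
    and "cos (dihedral_angle L i j k l) = c"
    and "sin (dihedral_angle L i j k l) =
           L i j * sqrt (gram3 L i j k l) / (sqrt (gram2 L i j k) * sqrt (gram2 L i j l))"
proof -
  let ?p = "realization L {i, j, k, l}"
  have p: "realizes L {i, j, k, l} ?p" by (rule realizes_realization[OF assms(1)])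
  define a b d where "a = ?p j - ?p i" and "b = ?p k - ?p i" and "d = ?p l - ?p i"
  have g: "a \<bullet> a = (L i j)\<^sup>2" "a \<bullet> b = corner_dot L i j k" "b \<bullet> b = (L i k)\<^sup>2"
    "a \<bullet> d = corner_dot L i j l" "b \<bullet> d = corner_dot L i k l" "d \<bullet> d = (L i l)\<^sup>2" "L i j > 0"
    using gram_matrix_realizes[OF p, of i j k] gram_matrix_realizes[OF p, of i k l]
      gram_matrix_realizes[OF p, of i l j] gram_matrix_realizes[OF p, of i j l] assms(2)
    by (auto simp: a_def b_def d_def)
  have o: "orth_part a b \<bullet> orth_part a d = mixed_gram L i j k l / (L i j)\<^sup>2"
     "orth_part a b \<bullet> orth_part a b = gram2 L i j k / (L i j)\<^sup>2"
     "orth_part a d \<bullet> orth_part a d = gram2 L i j l / (L i j)\<^sup>2"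
    unfolding orth_part_def mixed_gram_def gram2_def g(1)[symmetric] g(2)[symmetric] g(3)[symmetric]
      g(4)[symmetric] g(5)[symmetric] g(6)[symmetric] using g(1,7)
    by (simp_all add: inner_simps inner_commute power2_eq_square field_simps)
  have D: "gram2 L i j k > 0" "gram2 L i j l > 0" "gram3 L i j k l > 0"
    using gram2_pos[OF assms(1), of i j k] gram2_pos[OF assms(1), of i j l]
      gram3_pos[OF assms(1), of i j k l] assms(2) by auto
  have n: "norm (orth_part a b) = sqrt (gram2 L i j k) / L i j"
    "norm (orth_part a d) = sqrt (gram2 L i j l) / L i j"
    unfolding norm_eq_sqrt_inner o using g(7) by (simp_all add: real_sqrt_divide)
  show t: "dihedral_angle L i j k l = arccos c"
    unfolding dihedral_angle_def Let_def vangle_def c_def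
    unfolding a_def[symmetric] b_def[symmetric] d_def[symmetric] n o using g(7)
    by (simp add: power2_eq_square)
  have e: "1 - c\<^sup>2 = (L i j)\<^sup>2 * gram3 L i j k l / (gram2 L i j k * gram2 L i j l)"
  proof -
    have "c\<^sup>2 = (mixed_gram L i j k l)\<^sup>2 / (gram2 L i j k * gram2 L i j l)"
      using D by (simp add: c_def power_divide power_mult_distrib)
    moreover have "gram2 L i j k * gram2 L i j l \<noteq> 0" using D by simp
    ultimately show ?thesis using gram2_mult_gram2[of L i j k l]
      by (simp add: field_simps)
  qed
  have "1 - c\<^sup>2 > 0" unfolding e using D g(7) by simp
  then have b: "\<bar>c\<bar> < 1" by (simp add: abs_square_less_1)
  then show "-1 < c" "c < 1" by auto
  show "cos (dihedral_angle L i j k l) = c" unfolding t using b by (intro cos_arccos_abs) auto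
  have "sin (dihedral_angle L i j k l) = sqrt (1 - c\<^sup>2)"
    unfolding t using b by (intro sin_arccos_abs) auto
  then show "sin (dihedral_angle L i j k l) =
           L i j * sqrt (gram3 L i j k l) / (sqrt (gram2 L i j k) * sqrt (gram2 L i j l))"
    unfolding e using g(7) by (simp add: real_sqrt_divide real_sqrt_mult)
qed

section \<open>The center of a metrized simplex\<close>

text \<open>The inner product of \<open>c - p i\<close> and \<open>p j - p i\<close>, where \<open>c\<close> is the center. Working with this instead of \<open>d\<close>
makes the condition on triangles linear and keeps all formulas below polynomial.\<close>

definition center_dot :: "('v \<Rightarrow> 'v \<Rightarrow> real) \<Rightarrow> 'v \<Rightarrow> 'v \<Rightarrow> real" where
  "center_dot d i j = edge_len d i j * d i j"

text \<open>The Gram determinant with its last column, the one of \<open>l\<close>, replaced by the inner products of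
\<open>c - p i\<close> with the edge vectors. By Cramer's rule its quotient by \<open>gram3\<close> is the barycentric coordinate
of the center at \<open>l\<close>, so that it depends symmetrically on \<open>i\<close>, \<open>j\<close> and \<open>k\<close>.\<close>

definition center_minor :: "('v \<Rightarrow> 'v \<Rightarrow> real) \<Rightarrow> 'v \<Rightarrow> 'v \<Rightarrow> 'v \<Rightarrow> 'v \<Rightarrow> real" where
  "center_minor d i j k l =
     center_dot d i l * gram2 (edge_len d) i j k - center_dot d i k * mixed_gram (edge_len d) i j k l
     - center_dot d i j * mixed_gram (edge_len d) i k j l"

text \<open>For repeated vertices the condition on triangles is trivial.\<close>

definition metric_simplex :: "('v \<Rightarrow> 'v \<Rightarrow> real) \<Rightarrow> 'v::finite set \<Rightarrow> bool" where
  "metric_simplex d \<sigma> \<longleftrightarrow> (\<exists>p. realizes (edge_len d) \<sigma> p) \<and>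
     (\<forall>i\<in>\<sigma>. \<forall>j\<in>\<sigma>. \<forall>k\<in>\<sigma>. (d i j)\<^sup>2 + (d j k)\<^sup>2 + (d k i)\<^sup>2 = (d j i)\<^sup>2 + (d i k)\<^sup>2 + (d k j)\<^sup>2)"

lemma realizes_subset: "realizes L \<sigma> p \<Longrightarrow> \<tau> \<subseteq> \<sigma> \<Longrightarrow> realizes L \<tau> p"
  unfolding realizes_def
  by (meson affine_dependent_subset image_mono inj_on_subset subset_eq)

lemma metric_simplex_subset: "metric_simplex d \<sigma> \<Longrightarrow> \<tau> \<subseteq> \<sigma> \<Longrightarrow> metric_simplex d \<tau>"
  unfolding metric_simplex_def by (meson realizes_subset subset_eq)

lemma edge_len_commute: "edge_len d j i = edge_len d i j"
  by (simp add: edge_len_def)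

lemma corner_dot_edge_len_commute: "corner_dot (edge_len d) i k j = corner_dot (edge_len d) i j k"
  by (simp add: corner_dot_def edge_len_commute)

lemma center_dot_reverse: "center_dot d j i = (edge_len d i j)\<^sup>2 - center_dot d i j"
  by (simp add: center_dot_def edge_len_def power2_eq_square algebra_simps)

text \<open>For the center, \<open>(c - p j) \<bullet> (p k - p j)\<close> expands into inner products based at \<open>i\<close>. For \<open>center_dot\<close> this is
the place where the condition on triangles is used.\<close>

lemma center_dot_change_base:
  assumes "metric_simplex d \<sigma>" "i \<in> \<sigma>" "j \<in> \<sigma>" "k \<in> \<sigma>"
  shows "center_dot d j k = (edge_len d i j)\<^sup>2 - corner_dot (edge_len d) i j k - center_dot d i j + center_dot d i k"
proof -
  have "(d i j)\<^sup>2 + (d j k)\<^sup>2 + (d k i)\<^sup>2 = (d j i)\<^sup>2 + (d i k)\<^sup>2 + (d k j)\<^sup>2"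
    using assms by (auto simp: metric_simplex_def)
  then show ?thesis
    unfolding center_dot_def corner_dot_def edge_len_def by (simp add: power2_eq_square field_simps)
qed

lemma corner_dot_change_base:
  "corner_dot (edge_len d) j i k = (edge_len d i j)\<^sup>2 - corner_dot (edge_len d) i j k"
  by (simp add: corner_dot_def edge_len_commute[of d j i] field_simps)

lemma law_of_cosines:
  "(edge_len d j k)\<^sup>2 = (edge_len d i j)\<^sup>2 + (edge_len d i k)\<^sup>2 - 2 * corner_dot (edge_len d) i j k"
  by (simp add: corner_dot_def field_simps)

lemma gram2_rotate: "gram2 (edge_len d) j k i = gram2 (edge_len d) i j k"
  unfolding gram2_def corner_dot_def
  by (simp add: edge_len_commute[of d k j] edge_len_commute[of d j i] edge_len_commute[of d k i]
      power2_eq_square field_simps)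

lemma gram2_swap: "gram2 (edge_len d) j i k = gram2 (edge_len d) i j k"
  unfolding gram2_def corner_dot_def
  by (simp add: edge_len_commute[of d j i] power2_eq_square field_simps)

lemma corner_dot_base3:
  "corner_dot (edge_len d) j k l = (edge_len d i j)\<^sup>2 - corner_dot (edge_len d) i j k
     - corner_dot (edge_len d) i j l + corner_dot (edge_len d) i k l"
  by (simp add: corner_dot_def field_simps edge_len_commute)

lemma gram3_swap12: "gram3 (edge_len d) j i k l = gram3 (edge_len d) i j k l"
proof -
  note r = corner_dot_change_base[of d j i k] corner_dot_change_base[of d j i l]
    corner_dot_base3[of d j k l i] law_of_cosines[of d j k i] law_of_cosines[of d j l i]
    edge_len_commute[of d j i]
  show ?thesis unfolding gram3_def r
    by (simp add: power2_eq_square algebra_simps)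
qed

lemma gram3_swap23: "gram3 (edge_len d) i k j l = gram3 (edge_len d) i j k l"
  unfolding gram3_def corner_dot_edge_len_commute[of d i k j] by (simp add: algebra_simps)

lemma gram3_swap34: "gram3 (edge_len d) i j l k = gram3 (edge_len d) i j k l"
  unfolding gram3_def corner_dot_edge_len_commute[of d i l k] by (simp add: algebra_simps)

lemma center_minor_swap12:
  assumes "metric_simplex d \<sigma>" "i \<in> \<sigma>" "j \<in> \<sigma>" "k \<in> \<sigma>" "l \<in> \<sigma>"
  shows "center_minor d j i k l = center_minor d i j k l"
proof -
  note r = corner_dot_change_base[of d j i k] corner_dot_change_base[of d j i l]
    corner_dot_edge_len_commute[of d j k i] corner_dot_edge_len_commute[of d i k j]
    corner_dot_base3[of d j k l i] law_of_cosines[of d j k i] law_of_cosines[of d j l i]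
    edge_len_commute[of d j i] center_dot_reverse[of d j i]
  have k: "center_dot d j k = (edge_len d i j)\<^sup>2 - corner_dot (edge_len d) i j k - center_dot d i j + center_dot d i k"
    and l: "center_dot d j l = (edge_len d i j)\<^sup>2 - corner_dot (edge_len d) i j l - center_dot d i j + center_dot d i l"
    using assms by (blast intro: center_dot_change_base)+
  show ?thesis unfolding center_minor_def gram2_def mixed_gram_def r k l
    by (simp add: power2_eq_square algebra_simps)
qed

lemma center_minor_swap23: "center_minor d i k j l = center_minor d i j k l"
  unfolding center_minor_def gram2_def mixed_gram_def corner_dot_edge_len_commute[of d i k j]
  by (simp add: power2_eq_square algebra_simps)

section \<open>Variation of dihedral angles\<close>

text \<open>The polynomial core of the formula for the angle variation: \<open>aa, bb, cc, ab, ac, bc\<close> is the Gram matrix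
of the edge vectors at \<open>i\<close>, \<open>ua, ub, uc\<close> are their inner products with \<open>c - p i\<close>, and the primed
quantities are the variations of the Gram matrix when the vertices move radially from \<open>c\<close> with
rates \<open>w\<close>. The left side is the numerator in \<open>angle_quotient_derivative\<close>, for the dihedral angle; on the
right, the two faces are separated.\<close>

lemma dihedral_variation_algebra:
  fixes aa bb cc ab ac bc ua ub uc wi wj wk wl :: real
  defines "D1 \<equiv> aa * bb - ab\<^sup>2" and "D2 \<equiv> aa * cc - ac\<^sup>2" and "N \<equiv> aa * bc - ab * ac"
  defines "aa' \<equiv> 2 * (ua * wi + (aa - ua) * wj)"
    and "bb' \<equiv> 2 * (ub * wi + (bb - ub) * wk)"
    and "cc' \<equiv> 2 * (uc * wi + (cc - uc) * wl)"
    and "ab' \<equiv> (ua + ub) * wi + (ab - ub) * wj + (ab - ua) * wk"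
    and "ac' \<equiv> (ua + uc) * wi + (ac - uc) * wj + (ac - ua) * wl"
    and "bc' \<equiv> (ub + uc) * wi + (bc - uc) * wk + (bc - ub) * wl"
  assumes D: "D1 \<noteq> 0" "D2 \<noteq> 0"
  shows "N / 2 * ((aa' * bb + aa * bb' - 2 * ab * ab') / D1 + (aa' * cc + aa * cc' - 2 * ac * ac') / D2)
         - (aa' * bc + aa * bc' - ab' * ac - ab * ac')
     = (uc * D1 - ub * N - ua * (bb * ac - ab * bc)) / D1
         * ((aa - ab) * (wk - wi) + ab * (wk - wj))
     + (ub * D2 - uc * N - ua * (cc * ab - ac * bc)) / D2
         * ((aa - ac) * (wl - wi) + ac * (wl - wj))"
proof -
  have "N * ((aa' * bb + aa * bb' - 2 * ab * ab') * D2 + (aa' * cc + aa * cc' - 2 * ac * ac') * D1)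
         - 2 * ((aa' * bc + aa * bc' - ab' * ac - ab * ac') * D1 * D2)
     = 2 * ((uc * D1 - ub * N - ua * (bb * ac - ab * bc)) * D2
         * ((aa - ab) * (wk - wi) + ab * (wk - wj))
     + (ub * D2 - uc * N - ua * (cc * ab - ac * bc)) * D1
         * ((aa - ac) * (wl - wi) + ac * (wl - wj)))"
    unfolding D1_def D2_def N_def aa'_def bb'_def cc'_def ab'_def ac'_def bc'_def
    by (simp add: algebra_simps power2_eq_square)
  moreover have "N / 2 * (x / D1 + y / D2) - z = (N * (x * D2 + y * D1) - 2 * (z * D1 * D2)) / (2 * (D1 * D2))"
    and "x / D1 * y + z / D2 * v = 2 * (x * D2 * y + z * D1 * v) / (2 * (D1 * D2))" for x y z v
    using D by (simp_all add: field_simps)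
  ultimately show ?thesis by (simp only:)
qed

lemma sum_fractions_zeroI:
  fixes a b c :: real
  assumes "a \<noteq> 0" "b \<noteq> 0" "c \<noteq> 0" "x * b * c + y * a * c + z * a * b = 0"
  shows "x / a + y / b + z / c = 0"
proof -
  have "x / a + y / b + z / c = (x * b * c + y * a * c + z * a * b) / (a * b * c)"
    using assms(1-3) by (simp add: field_simps)
  then show ?thesis using assms(4) by simp
qed

text \<open>The two-dimensional identity behind \<open>face_energy\<close>: the bracketed factors are, up to a common factor,
the terms \<open>cot \<gamma>\<^sub>j (w\<^sub>k - w\<^sub>i) + cot \<gamma>\<^sub>i (w\<^sub>k - w\<^sub>j)\<close> of the three edges of the triangle, each multiplied by the
relative length variation of that edge; on the right, up to the same factor, the coefficients of the
squares are the heights of the center over the edges divided by their lengths. Here \<open>cc\<close> is the squared length of the third edge and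
\<open>uc\<close> the value of \<open>center_dot\<close> along it.\<close>

lemma face_variation_algebra:
  fixes aa bb ab ua ub wi wj wk :: real
  defines "cc \<equiv> aa + bb - 2 * ab" and "uc \<equiv> aa - ab - ua + ub"
  assumes nz: "aa \<noteq> 0" "bb \<noteq> 0" "cc \<noteq> 0"
  shows "(ua * wi + (aa - ua) * wj) / aa * ((aa - ab) * (wk - wi) + ab * (wk - wj))
       + (uc * wj + (cc - uc) * wk) / cc * ((bb - ab) * (wi - wj) + (aa - ab) * (wi - wk))
       + ((bb - ub) * wk + ub * wi) / bb * (ab * (wj - wk) + (bb - ab) * (wj - wi))
     = - ((ub * aa - ua * ab) / aa * (wi - wj)\<^sup>2
       + ((aa - ua) * cc - uc * (aa - ab)) / cc * (wj - wk)\<^sup>2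
       + ((cc - uc) * bb - (bb - ub) * (bb - ab)) / bb * (wk - wi)\<^sup>2)"
proof -
  have "((ua * wi + (aa - ua) * wj) * ((aa - ab) * (wk - wi) + ab * (wk - wj))
         + (ub * aa - ua * ab) * (wi - wj)\<^sup>2) / aa
     + ((uc * wj + (cc - uc) * wk) * ((bb - ab) * (wi - wj) + (aa - ab) * (wi - wk))
         + ((aa - ua) * cc - uc * (aa - ab)) * (wj - wk)\<^sup>2) / cc
     + (((bb - ub) * wk + ub * wi) * (ab * (wj - wk) + (bb - ab) * (wj - wi))
         + ((cc - uc) * bb - (bb - ub) * (bb - ab)) * (wk - wi)\<^sup>2) / bb = 0"
    by (rule sum_fractions_zeroI[OF nz(1,3,2)])
      (simp add: cc_def uc_def algebra_simps power2_eq_square)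
  moreover have "(x * b + y * c) / a = x / a * b + y / a * c" for x y a b c :: real
    by (simp add: add_divide_distrib)
  ultimately show ?thesis by (simp only:)
qed

lemma height2_formula:
  assumes "metric_simplex d \<sigma>" "i \<in> \<sigma>" "j \<in> \<sigma>" "k \<in> \<sigma>" "distinct [i, j, k]"
  shows "height2 d i j k =
    (center_dot d i k * (edge_len d i j)\<^sup>2 - center_dot d i j * corner_dot (edge_len d) i j k)
      / (edge_len d i j * sqrt (gram2 (edge_len d) i j k))"
proof -
  have ex: "\<exists>p. realizes (edge_len d) {i, j, k} p"
    using metric_simplex_subset[OF assms(1), of "{i, j, k}"] assms by (auto simp: metric_simplex_def)
  then obtain p where p: "realizes (edge_len d) {i, j, k} p" by blast
  note t = tri_angle_realizable[OF ex]
  have pos: "edge_len d i j > 0" "edge_len d i k > 0"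
    using gram_matrix_realizes[OF p, of i j k] gram_matrix_realizes[OF p, of i k j] assms by auto
  have g: "gram2 (edge_len d) i j k > 0" using gram2_pos[OF ex] assms by auto
  have ne: "i \<noteq> j" "i \<noteq> k" "j \<noteq> k" using assms by auto
  show ?thesis
    unfolding height2_def t[OF ne] center_dot_def using pos g
    by (simp add: field_simps power2_eq_square)
qed

text \<open>The height of the center over a face is its barycentric coordinate times the altitude, which is the
quotient of the volume and the area.\<close>

lemma height3_formula:
  assumes "metric_simplex d \<sigma>" "i \<in> \<sigma>" "j \<in> \<sigma>" "k \<in> \<sigma>" "l \<in> \<sigma>" "distinct [i, j, k, l]"
  shows "height3 d i j k l =
    center_minor d i j k l / (sqrt (gram3 (edge_len d) i j k l) * sqrt (gram2 (edge_len d) i j k))"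
proof -
  let ?L = "edge_len d"
  have ex: "\<exists>p. realizes ?L {i, j, k, l} p"
    using metric_simplex_subset[OF assms(1), of "{i, j, k, l}"] assms by (auto simp: metric_simplex_def)
  then obtain p where p: "realizes ?L {i, j, k, l} p" by blast
  note t = dihedral_angle_realizable[OF ex assms(6)]
  have pos: "?L i j > 0"
    using gram_matrix_realizes[OF p, of i j k] assms by auto
  define A B G where "A = sqrt (gram2 ?L i j k)" and "B = sqrt (gram2 ?L i j l)"
    and "G = sqrt (gram3 ?L i j k l)"
  have AB: "A > 0" "B > 0" "G > 0" "A\<^sup>2 = gram2 ?L i j k"
    using gram2_pos[OF ex, of i j k] gram2_pos[OF ex, of i j l]
      gram3_pos[OF ex, of i j k l] assms by (auto simp: A_def B_def G_def)
  have h: "height2 d i j k = (center_dot d i k * (?L i j)\<^sup>2 - center_dot d i j * corner_dot ?L i j k) / (?L i j * A)"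
    "height2 d i j l = (center_dot d i l * (?L i j)\<^sup>2 - center_dot d i j * corner_dot ?L i j l) / (?L i j * B)"
    using height2_formula[OF assms(1), of i j k] height2_formula[OF assms(1), of i j l] assms
    by (auto simp: A_def B_def)
  have "height3 d i j k l = ((center_dot d i l * (?L i j)\<^sup>2 - center_dot d i j * corner_dot ?L i j l) * A\<^sup>2
      - (center_dot d i k * (?L i j)\<^sup>2 - center_dot d i j * corner_dot ?L i j k) * mixed_gram ?L i j k l)
      / ((?L i j)\<^sup>2 * (G * A))"
    unfolding height3_def t(4,5) h A_def[symmetric] B_def[symmetric] G_def[symmetric]
    using pos AB(1-3) by (simp add: field_simps power2_eq_square)
  also have "(center_dot d i l * (?L i j)\<^sup>2 - center_dot d i j * corner_dot ?L i j l) * A\<^sup>2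
      - (center_dot d i k * (?L i j)\<^sup>2 - center_dot d i j * corner_dot ?L i j k) * mixed_gram ?L i j k l
      = (?L i j)\<^sup>2 * center_minor d i j k l"
    unfolding AB(4) center_minor_def gram2_def mixed_gram_def corner_dot_edge_len_commute[of d i k j]
    by (simp add: algebra_simps power2_eq_square)
  finally show ?thesis
    using pos unfolding A_def G_def by simp
qed

text \<open>\<open>h\<^bsub>ijk,l\<^esub> / \<ell>\<^sub>i\<^sub>j (cot \<gamma>\<^sub>j (w\<^sub>k - w\<^sub>i) + cot \<gamma>\<^sub>i (w\<^sub>k - w\<^sub>j))\<close>, the rate at which the face \<open>i j k\<close> turns about the
edge \<open>i j\<close>: the normal velocity of \<open>k\<close>, relative to that of the edge at the foot of the altitude from
\<open>k\<close>, divided by this altitude.\<close>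

definition face_turn ::
  "('v::finite \<Rightarrow> 'v \<Rightarrow> real) \<Rightarrow> ('v \<Rightarrow> real) \<Rightarrow> 'v \<Rightarrow> 'v \<Rightarrow> 'v \<Rightarrow> 'v \<Rightarrow> real" where
  "face_turn d w i j k l =
     height3 d i j k l / (edge_len d i j * sqrt (gram2 (edge_len d) i j k))
     * (corner_dot (edge_len d) j i k * (w k - w i) + corner_dot (edge_len d) i j k * (w k - w j))"

text \<open>With \<open>P Q = N\<^sup>2 + s\<^sup>2\<close>, the number \<open>s / sqrt (P Q)\<close> is the sine of the angle; all square roots cancel except the
one in \<open>s\<close>.\<close>

lemma angle_quotient_derivative:
  assumes N: "(N has_real_derivative N') (at t)"
    and P: "(P has_real_derivative P') (at t)" and Q: "(Q has_real_derivative Q') (at t)"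
    and pos: "P t > 0" "Q t > 0" "s > 0" and pq: "P t * Q t = (N t)\<^sup>2 + s\<^sup>2"
  shows "((\<lambda>x. arccos (N x / (sqrt (P x) * sqrt (Q x)))) has_real_derivative
           (N t / 2 * (P' / P t + Q' / Q t) - N') / s) (at t)"
proof -
  define c where "c = N t / (sqrt (P t) * sqrt (Q t))"
  have c2: "1 - c\<^sup>2 = s\<^sup>2 / (P t * Q t)"
    unfolding c_def using pos pq by (simp add: power_divide power_mult_distrib field_simps)
  moreover have "s\<^sup>2 / (P t * Q t) > 0" using pos by simp
  ultimately have "c\<^sup>2 < 1" by simp
  then have c: "-1 < c" "c < 1" by (auto simp: abs_square_less_1)
  have sq: "sqrt (1 - c\<^sup>2) = s / (sqrt (P t) * sqrt (Q t))"
    unfolding c2 using pos by (simp add: real_sqrt_divide real_sqrt_mult)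
  have dP: "((\<lambda>x. sqrt (P x)) has_real_derivative P' / (2 * sqrt (P t))) (at t)"
    using P pos by (auto intro!: derivative_eq_intros simp: field_simps)
  have dQ: "((\<lambda>x. sqrt (Q x)) has_real_derivative Q' / (2 * sqrt (Q t))) (at t)"
    using Q pos by (auto intro!: derivative_eq_intros simp: field_simps)
  have "((\<lambda>x. N x / (sqrt (P x) * sqrt (Q x))) has_real_derivative
      (N' * (sqrt (P t) * sqrt (Q t)) - N t * (P' / (2 * sqrt (P t)) * sqrt (Q t)
          + Q' / (2 * sqrt (Q t)) * sqrt (P t)))
       / ((sqrt (P t) * sqrt (Q t)) * (sqrt (P t) * sqrt (Q t)))) (at t)"
    using pos by (intro DERIV_divide N DERIV_mult dP dQ) auto
  from DERIV_chain2[where f = arccos, OF DERIV_arccos this] c[unfolded c_def]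
  have "((\<lambda>x. arccos (N x / (sqrt (P x) * sqrt (Q x)))) has_real_derivative
     inverse (- sqrt (1 - c\<^sup>2)) * ((N' * (sqrt (P t) * sqrt (Q t)) - N t * (P' / (2 * sqrt (P t)) * sqrt (Q t)
          + Q' / (2 * sqrt (Q t)) * sqrt (P t)))
       / ((sqrt (P t) * sqrt (Q t)) * (sqrt (P t) * sqrt (Q t))))) (at t)"
    by (simp add: c_def)
  moreover define p q where "p = sqrt (P t)" and "q = sqrt (Q t)"
  have pq': "p > 0" "q > 0" "P t = p * p" "Q t = q * q" using pos by (auto simp: p_def q_def)
  have "inverse (- sqrt (1 - c\<^sup>2)) * ((N' * (sqrt (P t) * sqrt (Q t)) - N t * (P' / (2 * sqrt (P t)) * sqrt (Q t)
          + Q' / (2 * sqrt (Q t)) * sqrt (P t)))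
       / ((sqrt (P t) * sqrt (Q t)) * (sqrt (P t) * sqrt (Q t))))
    = (N t / 2 * (P' / P t + Q' / Q t) - N') / s"
    unfolding sq p_def[symmetric] q_def[symmetric] unfolding pq'(3,4) using pq'(1,2) pos(3)
    by (simp add: field_simps)
  ultimately show ?thesis by simp
qed

definition dihedral_cos :: "('v \<Rightarrow> 'v \<Rightarrow> real) \<Rightarrow> 'v \<Rightarrow> 'v \<Rightarrow> 'v \<Rightarrow> 'v \<Rightarrow> real" where
  "dihedral_cos L i j k l = mixed_gram L i j k l / (sqrt (gram2 L i j k) * sqrt (gram2 L i j l))"

text \<open>Only the first-order behaviour of the lengths enters, and it is that of vertices moving radially from the
center. So the inner products of the edge vectors vary as in \<open>dihedral_variation_algebra\<close>.\<close>

lemma dihedral_variation: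
  assumes "metric_simplex d {i, j, k, l}" "distinct [i, j, k, l]"
    and L0: "\<And>x y. x \<in> {i, j, k, l} \<Longrightarrow> y \<in> {i, j, k, l} \<Longrightarrow> x \<noteq> y \<Longrightarrow> L 0 x y = edge_len d x y"
    and L': "\<And>x y. x \<in> {i, j, k, l} \<Longrightarrow> y \<in> {i, j, k, l} \<Longrightarrow> x \<noteq> y \<Longrightarrow>
       ((\<lambda>t. L t x y) has_real_derivative (d x y * w x + d y x * w y)) (at 0)"
  shows "((\<lambda>t. arccos (dihedral_cos (L t) i j k l)) has_real_derivative
           face_turn d w i j k l + face_turn d w i j l k) (at 0)"
proof -
  let ?L = "edge_len d"
  have ex: "\<exists>p. realizes ?L {i, j, k, l} p" using assms by (auto simp: metric_simplex_def)
  then obtain p where p: "realizes ?L {i, j, k, l} p" by blast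
  define aa bb cc ab ac bc where "aa = (?L i j)\<^sup>2" and "bb = (?L i k)\<^sup>2" and "cc = (?L i l)\<^sup>2"
    and "ab = corner_dot ?L i j k" and "ac = corner_dot ?L i j l" and "bc = corner_dot ?L i k l"
  define ua ub uc where "ua = center_dot d i j" and "ub = center_dot d i k" and "uc = center_dot d i l"
  have sq: "((\<lambda>t. (L t x y)\<^sup>2) has_real_derivative 2 * (center_dot d x y * w x + center_dot d y x * w y)) (at 0)"
    if "x \<in> {i, j, k, l}" "y \<in> {i, j, k, l}" "x \<noteq> y" for x y
    using DERIV_power[OF L'[OF that], of 2] L0[OF that]
    by (simp add: center_dot_def edge_len_commute[of d y x] algebra_simps)
  note pc = center_dot_change_base[OF assms(1)]
  have dot: "((\<lambda>t. corner_dot (L t) x y z) has_real_derivative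
      (center_dot d x y + center_dot d x z) * w x + (corner_dot ?L x y z - center_dot d x z) * w y
      + (corner_dot ?L x y z - center_dot d x y) * w z) (at 0)"
    if xyz: "x \<in> {i, j, k, l}" "y \<in> {i, j, k, l}" "z \<in> {i, j, k, l}" "distinct [x, y, z]" for x y z
  proof -
    have "((\<lambda>t. corner_dot (L t) x y z) has_real_derivative
       (2 * (center_dot d x y * w x + center_dot d y x * w y) + 2 * (center_dot d x z * w x + center_dot d z x * w z)
         - 2 * (center_dot d y z * w y + center_dot d z y * w z)) / 2) (at 0)"
      unfolding corner_dot_def using xyz
      by (intro DERIV_cdivide DERIV_diff DERIV_add sq) auto
    moreover have "(2 * (center_dot d x y * w x + center_dot d y x * w y) + 2 * (center_dot d x z * w x + center_dot d z x * w z)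
         - 2 * (center_dot d y z * w y + center_dot d z y * w z)) / 2
      = (center_dot d x y + center_dot d x z) * w x + (corner_dot ?L x y z - center_dot d x z) * w y
      + (corner_dot ?L x y z - center_dot d x y) * w z"
      unfolding pc[OF xyz(1,2,3)] pc[OF xyz(1,3,2)] corner_dot_edge_len_commute[of d x z y]
        center_dot_reverse[of d y x] center_dot_reverse[of d z x]
      by (simp add: field_simps)
    ultimately show ?thesis by (rule DERIV_cong)
  qed
  define aa' bb' cc' ab' ac' bc' where "aa' = 2 * (ua * w i + (aa - ua) * w j)"
    and "bb' = 2 * (ub * w i + (bb - ub) * w k)" and "cc' = 2 * (uc * w i + (cc - uc) * w l)"
    and "ab' = (ua + ub) * w i + (ab - ub) * w j + (ab - ua) * w k"
    and "ac' = (ua + uc) * w i + (ac - uc) * w j + (ac - ua) * w l"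
    and "bc' = (ub + uc) * w i + (bc - uc) * w k + (bc - ub) * w l"
  note defs = aa_def bb_def cc_def ab_def ac_def bc_def ua_def ub_def uc_def
    aa'_def bb'_def cc'_def ab'_def ac'_def bc'_def
  have e: "((\<lambda>t. (L t i j)\<^sup>2) has_real_derivative aa') (at 0)"
    "((\<lambda>t. (L t i k)\<^sup>2) has_real_derivative bb') (at 0)"
    "((\<lambda>t. (L t i l)\<^sup>2) has_real_derivative cc') (at 0)"
    "((\<lambda>t. corner_dot (L t) i j k) has_real_derivative ab') (at 0)"
    "((\<lambda>t. corner_dot (L t) i j l) has_real_derivative ac') (at 0)"
    "((\<lambda>t. corner_dot (L t) i k l) has_real_derivative bc') (at 0)"
    using sq[of i j] sq[of i k] sq[of i l] dot[of i j k] dot[of i j l] dot[of i k l] assms(2)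
    unfolding defs by (simp_all add: center_dot_reverse[of d _ i])
  have v: "(L 0 i j)\<^sup>2 = aa" "(L 0 i k)\<^sup>2 = bb" "(L 0 i l)\<^sup>2 = cc" "corner_dot (L 0) i j k = ab"
    "corner_dot (L 0) i j l = ac" "corner_dot (L 0) i k l = bc"
    using L0 assms(2) unfolding defs by (auto simp: corner_dot_def)
  define N D1 D2 where "N = aa * bc - ab * ac" and "D1 = aa * bb - ab\<^sup>2" and "D2 = aa * cc - ac\<^sup>2"
  have V: "N = mixed_gram ?L i j k l" "D1 = gram2 ?L i j k" "D2 = gram2 ?L i j l"
    unfolding N_def D1_def D2_def mixed_gram_def gram2_def defs by simp_all
  have V0: "mixed_gram (L 0) i j k l = N" "gram2 (L 0) i j k = D1" "gram2 (L 0) i j l = D2"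
    unfolding N_def D1_def D2_def mixed_gram_def gram2_def v by simp_all
  have dN: "((\<lambda>t. mixed_gram (L t) i j k l) has_real_derivative
      aa' * bc + aa * bc' - ab' * ac - ab * ac') (at 0)"
    unfolding mixed_gram_def
    using DERIV_diff[OF DERIV_mult[OF e(1,6)] DERIV_mult[OF e(4,5)]] unfolding v
    by (simp add: algebra_simps)
  have dD1: "((\<lambda>t. gram2 (L t) i j k) has_real_derivative
      aa' * bb + aa * bb' - 2 * ab * ab') (at 0)"
    unfolding gram2_def
    using DERIV_diff[OF DERIV_mult[OF e(1,2)] DERIV_power[OF e(4), of 2]] unfolding v
    by (simp add: algebra_simps)
  have dD2: "((\<lambda>t. gram2 (L t) i j l) has_real_derivative
      aa' * cc + aa * cc' - 2 * ac * ac') (at 0)"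
    unfolding gram2_def
    using DERIV_diff[OF DERIV_mult[OF e(1,3)] DERIV_power[OF e(5), of 2]] unfolding v
    by (simp add: algebra_simps)
  define G where "G = sqrt (gram3 ?L i j k l)"
  have G: "G > 0" "G\<^sup>2 = gram3 ?L i j k l"
    using gram3_pos[OF ex, of i j k l] assms(2) by (auto simp: G_def)
  have D: "D1 > 0" "D2 > 0" unfolding V
    using gram2_pos[OF ex, of i j k] gram2_pos[OF ex, of i j l] assms(2)
    by auto
  have Lpos: "?L i j > 0" using gram_matrix_realizes[OF p, of i j k] assms(2) by auto
  have "D1 * D2 = N\<^sup>2 + (?L i j * G)\<^sup>2"
    unfolding V power_mult_distrib G by (rule gram2_mult_gram2)
  then have "((\<lambda>t. arccos (dihedral_cos (L t) i j k l)) has_real_derivative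
      (N / 2 * ((aa' * bb + aa * bb' - 2 * ab * ab') / D1 + (aa' * cc + aa * cc' - 2 * ac * ac') / D2)
         - (aa' * bc + aa * bc' - ab' * ac - ab * ac')) / (?L i j * G)) (at 0)"
    unfolding dihedral_cos_def
    using angle_quotient_derivative[OF dN dD1 dD2, of "?L i j * G"] V0 D Lpos G(1) by simp
  also have "N / 2 * ((aa' * bb + aa * bb' - 2 * ab * ab') / D1 + (aa' * cc + aa * cc' - 2 * ac * ac') / D2)
         - (aa' * bc + aa * bc' - ab' * ac - ab * ac')
    = (uc * D1 - ub * N - ua * (bb * ac - ab * bc)) / D1
         * ((aa - ab) * (w k - w i) + ab * (w k - w j))
     + (ub * D2 - uc * N - ua * (cc * ab - ac * bc)) / D2
         * ((aa - ac) * (w l - w i) + ac * (w l - w j))"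
    unfolding D1_def D2_def N_def aa'_def bb'_def cc'_def ab'_def ac'_def bc'_def
    using D unfolding D1_def D2_def by (intro dihedral_variation_algebra) auto
  also have "uc * D1 - ub * N - ua * (bb * ac - ab * bc) = center_minor d i j k l"
    unfolding center_minor_def V mixed_gram_def[of _ i k] defs
      corner_dot_edge_len_commute[of d i k j] by simp
  also have "ub * D2 - uc * N - ua * (cc * ab - ac * bc) = center_minor d i j l k"
    unfolding center_minor_def V mixed_gram_def[of _ i l] mixed_gram_def[of _ i j l k]
      mixed_gram_def[of _ i j k l] defs corner_dot_edge_len_commute[of d i l j]
      corner_dot_edge_len_commute[of d i l k] by (simp add: algebra_simps)
  also have "(center_minor d i j k l / D1 * ((aa - ab) * (w k - w i) + ab * (w k - w j))
      + center_minor d i j l k / D2 * ((aa - ac) * (w l - w i) + ac * (w l - w j))) / (?L i j * G)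
     = face_turn d w i j k l + face_turn d w i j l k"
  proof -
    have h: "height3 d i j k l = center_minor d i j k l / (G * sqrt D1)"
      "height3 d i j l k = center_minor d i j l k / (G * sqrt D2)"
      using height3_formula[OF assms(1), of i j k l] height3_formula[OF assms(1), of i j l k] assms(2)
      unfolding V G_def gram3_swap34[of d i j l k] by auto
    define P Q where "P = sqrt D1" and "Q = sqrt D2"
    have s: "D1 = P * P" "D2 = Q * Q" "P > 0" "Q > 0" using D by (auto simp: P_def Q_def)
    have c: "aa - ab = corner_dot ?L j i k" "aa - ac = corner_dot ?L j i l"
      unfolding defs corner_dot_change_base[of d j i] by simp_all
    show ?thesis
      unfolding face_turn_def h c V(2,3)[symmetric] ab_def[symmetric] ac_def[symmetric]
        P_def[symmetric] Q_def[symmetric] unfolding s(1,2)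
      using s(3,4) G(1) Lpos by (simp add: divide_simps)
  qed
  finally show ?thesis .
qed

section \<open>The energy identity\<close>

text \<open>Tetrahedra with an ordering of their vertices. Summing over these replaces the case distinctions
over edges and faces of a tetrahedron by reindexing with permutations.\<close>

definition tet_tuples :: "'v set set \<Rightarrow> ('v \<times> 'v \<times> 'v \<times> 'v) set" where
  "tet_tuples T = {(i, j, k, l). {i, j, k, l} \<in> T \<and> card {i, j, k, l} = 4}"

lemma card4_iff: "card {i, j, k, l} = 4 \<longleftrightarrow> distinct [i, j, k, l]"
proof
  assume "card {i, j, k, l} = 4"
  then have "card (set [i, j, k, l]) = length [i, j, k, l]" by simp
  then show "distinct [i, j, k, l]" by (rule card_distinct)
qed (auto simp: card_insert_if)

lemma tet_tuples_permute:
  "(i, j, k, l) \<in> tet_tuples T \<Longrightarrow> {i', j', k', l'} = {i, j, k, l} \<Longrightarrow> (i', j', k', l') \<in> tet_tuples T"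
  by (simp add: tet_tuples_def)

lemma sum_tet_tuples_rotate:
  fixes F :: "'v::finite \<Rightarrow> 'v \<Rightarrow> 'v \<Rightarrow> 'v \<Rightarrow> real"
  shows "(\<Sum>(i, j, k, l)\<in>tet_tuples T. F j k i l) = (\<Sum>(i, j, k, l)\<in>tet_tuples T. F i j k l)"
  by (rule sum.reindex_bij_witness[where j = "\<lambda>(i, j, k, l). (j, k, i, l)"
        and i = "\<lambda>(i, j, k, l). (k, i, j, l)"])
    (clarsimp | (erule tet_tuples_permute, blast))+

lemma sum_tet_tuples_cycle:
  fixes F :: "'v::finite \<Rightarrow> 'v \<Rightarrow> 'v \<Rightarrow> 'v \<Rightarrow> real"
  shows "(\<Sum>(i, j, k, l)\<in>tet_tuples T. F j k l i) = (\<Sum>(i, j, k, l)\<in>tet_tuples T. F i j k l)"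
  by (rule sum.reindex_bij_witness[where j = "\<lambda>(i, j, k, l). (j, k, l, i)"
        and i = "\<lambda>(i, j, k, l). (l, i, j, k)"])
    (clarsimp | (erule tet_tuples_permute, blast))+

lemma sum_tet_tuples_swap12:
  fixes F :: "'v::finite \<Rightarrow> 'v \<Rightarrow> 'v \<Rightarrow> 'v \<Rightarrow> real"
  shows "(\<Sum>(i, j, k, l)\<in>tet_tuples T. F j i k l) = (\<Sum>(i, j, k, l)\<in>tet_tuples T. F i j k l)"
  by (rule sum.reindex_bij_witness[where j = "\<lambda>(i, j, k, l). (j, i, k, l)"
        and i = "\<lambda>(i, j, k, l). (j, i, k, l)"])
    (clarsimp | (erule tet_tuples_permute, blast))+

lemma sum_tet_tuples_swap34:
  fixes F :: "'v::finite \<Rightarrow> 'v \<Rightarrow> 'v \<Rightarrow> 'v \<Rightarrow> real"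
  shows "(\<Sum>(i, j, k, l)\<in>tet_tuples T. F i j l k) = (\<Sum>(i, j, k, l)\<in>tet_tuples T. F i j k l)"
  by (rule sum.reindex_bij_witness[where j = "\<lambda>(i, j, k, l). (i, j, l, k)"
        and i = "\<lambda>(i, j, k, l). (i, j, l, k)"])
    (clarsimp | (erule tet_tuples_permute, blast))+

lemma sum_tet_tuples_by_edge:
  fixes F :: "'v::finite \<Rightarrow> 'v \<Rightarrow> 'v \<Rightarrow> 'v \<Rightarrow> real"
  assumes "abstract_complex T"
  shows "(\<Sum>(i, j)\<in>directed_edges T.
            \<Sum>(k, l)\<in>{(k, l). {i, j, k, l} \<in> T \<and> card {i, j, k, l} = 4}. F i j k l)
       = (\<Sum>(i, j, k, l)\<in>tet_tuples T. F i j k l)"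
proof -
  have e: "(i, j) \<in> directed_edges T" if "{i, j, k, l} \<in> T" "distinct [i, j, k, l]" for i j k l
  proof -
    have "{i, j} \<subseteq> {i, j, k, l}" "{i, j} \<noteq> {}" by auto
    then have "{i, j} \<in> T" using assms that(1) unfolding abstract_complex_def by (metis (no_types))
    then show ?thesis using that by (auto simp: directed_edges_def edges_def)
  qed
  let ?K = "\<lambda>p. {q. {fst p, snd p, fst q, snd q} \<in> T \<and> card {fst p, snd p, fst q, snd q} = 4}"
  have "(\<Sum>p\<in>directed_edges T. \<Sum>q\<in>?K p. F (fst p) (snd p) (fst q) (snd q))
      = (\<Sum>(p, q)\<in>Sigma (directed_edges T) ?K. F (fst p) (snd p) (fst q) (snd q))"
    by (rule sum.Sigma) simp_all
  also have "\<dots> = (\<Sum>(i, j, k, l)\<in>tet_tuples T. F i j k l)"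
    by (rule sum.reindex_bij_witness[where j = "\<lambda>((i, j), (k, l)). (i, j, k, l)"
          and i = "\<lambda>(i, j, k, l). ((i, j), (k, l))"])
      (auto simp: tet_tuples_def card4_iff intro: e)
  finally show ?thesis by (simp add: case_prod_unfold)
qed

lemma height3_swap12:
  assumes "metric_simplex d {i, j, k, l}" "distinct [i, j, k, l]"
  shows "height3 d j i k l = height3 d i j k l"
  using height3_formula[OF assms(1), of i j k l] height3_formula[OF assms(1), of j i k l]
    center_minor_swap12[OF assms(1), of i j k l] gram3_swap12[of d j i k l] gram2_swap[of d j i k] assms(2)
  by auto

lemma height3_swap23:
  assumes "metric_simplex d {i, j, k, l}" "distinct [i, j, k, l]"
  shows "height3 d i k j l = height3 d i j k l"
proof -
  have "gram2 (edge_len d) i k j = gram2 (edge_len d) i j k"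
    using gram2_swap[of d i k j] gram2_rotate[of d k i j] gram2_rotate[of d j k i] by simp
  then show ?thesis
    using height3_formula[OF assms(1), of i j k l] height3_formula[OF assms(1), of i k j l]
      center_minor_swap23[of d i k j l] gram3_swap23[of d i k j l] assms(2)
    by auto
qed

lemma height3_rotate:
  assumes "metric_simplex d {i, j, k, l}" "distinct [i, j, k, l]"
  shows "height3 d j k i l = height3 d i j k l"
proof -
  have "{j, i, k, l} = {i, j, k, l}" "distinct [j, i, k, l]" using assms(2) by auto
  then show ?thesis
    using height3_swap23[of d j i k l] height3_swap12[OF assms] assms(1) by simp
qed

lemma face_turn_swap:
  assumes "metric_simplex d {i, j, k, l}" "distinct [i, j, k, l]"
  shows "face_turn d w j i k l = face_turn d w i j k l"
  unfolding face_turn_def height3_swap12[OF assms] edge_len_commute[of d j i] gram2_swap[of d j i k]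
  by (simp add: algebra_simps)

text \<open>The contribution of the face \<open>i j k\<close> of one tetrahedron to \<open>2 \<ell>\<^sup>*\<^sub>i\<^sub>j / \<ell>\<^sub>i\<^sub>j\<close>.\<close>

definition dual_weight :: "('v::finite \<Rightarrow> 'v \<Rightarrow> real) \<Rightarrow> 'v \<Rightarrow> 'v \<Rightarrow> 'v \<Rightarrow> 'v \<Rightarrow> real" where
  "dual_weight d i j k l = height2 d i j k * height3 d i j k l / edge_len d i j"

text \<open>The height over the face and its area are common factors of the three terms, so this is the identity
\<open>face_variation_algebra\<close> for the triangle.\<close>

lemma face_energy:
  assumes m: "metric_simplex d {i, j, k, l}" and dist: "distinct [i, j, k, l]"
  shows "(d i j * w i + d j i * w j) * face_turn d w i j k l
       + (d j k * w j + d k j * w k) * face_turn d w j k i l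
       + (d k i * w k + d i k * w i) * face_turn d w k i j l
     = - (dual_weight d i j k l * (w i - w j)\<^sup>2 + dual_weight d j k i l * (w j - w k)\<^sup>2 + dual_weight d k i j l * (w k - w i)\<^sup>2)"
proof -
  let ?L = "edge_len d"
  have ex: "\<exists>p. realizes ?L {i, j, k, l} p" using m by (auto simp: metric_simplex_def)
  then obtain p where p: "realizes ?L {i, j, k, l} p" by blast
  have pos: "?L i j > 0" "?L i k > 0" "?L j k > 0"
    using gram_matrix_realizes[OF p, of i j k] gram_matrix_realizes[OF p, of i k j]
      gram_matrix_realizes[OF p, of j k i] dist by auto
  have dist': "distinct [j, k, i]" "distinct [k, i, j]" using dist by auto
  define H S where "H = height3 d i j k l" and "S = sqrt (gram2 ?L i j k)"
  have S: "S > 0" using gram2_pos[OF ex, of i j k] dist by (auto simp: S_def)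
  define aa bb ab ua ub where "aa = (?L i j)\<^sup>2" and "bb = (?L i k)\<^sup>2" and "ab = corner_dot ?L i j k"
    and "ua = center_dot d i j" and "ub = center_dot d i k"
  define cc uc where "cc = aa + bb - 2 * ab" and "uc = aa - ab - ua + ub"
  have h3: "height3 d j k i l = H" "height3 d k i j l = H"
    using height3_rotate[OF m dist] height3_rotate[of d j k i l] m dist
    by (auto simp: H_def insert_commute)
  have g: "gram2 ?L j k i = gram2 ?L i j k" "gram2 ?L k i j = gram2 ?L i j k"
    using gram2_rotate[of d k i j] gram2_rotate[of d j k i] by simp_all
  have dots: "corner_dot ?L j i k = aa - ab" "corner_dot ?L j k i = aa - ab"
    "corner_dot ?L k i j = bb - ab" "corner_dot ?L k j i = bb - ab" "corner_dot ?L i k j = ab"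
    unfolding aa_def bb_def ab_def
    by (simp_all add: corner_dot_def edge_len_commute[of d k j] edge_len_commute[of d j i]
        edge_len_commute[of d k i] field_simps)
  have len: "(?L j k)\<^sup>2 = cc" "(?L k i)\<^sup>2 = bb"
    unfolding cc_def aa_def bb_def ab_def by (simp_all add: law_of_cosines[of d j k i] edge_len_commute)
  have pj: "center_dot d j k = uc" "center_dot d k j = cc - uc" "center_dot d j i = aa - ua" "center_dot d k i = bb - ub"
    using center_dot_change_base[OF m, of i j k] center_dot_reverse[of d k j] center_dot_reverse[of d j i] center_dot_reverse[of d k i]
      len by (simp_all add: uc_def aa_def bb_def ab_def ua_def ub_def)
  have h2: "height2 d i j k = (ub * aa - ua * ab) / (?L i j * S)"
    "height2 d j k i = ((aa - ua) * cc - uc * (aa - ab)) / (?L j k * S)"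
    "height2 d k i j = ((cc - uc) * bb - (bb - ub) * (bb - ab)) / (?L k i * S)"
    using height2_formula[OF m, of i j k] height2_formula[OF m, of j k i] height2_formula[OF m, of k i j] dist dist'
    by (simp_all add: g S_def[symmetric] dots len pj)
       (simp_all add: aa_def ua_def ub_def ab_def)
  have st: "d x y * w x + d y x * w y = (center_dot d x y * w x + center_dot d y x * w y) / ?L x y"
    if "?L x y > 0" for x y
    using that by (simp add: center_dot_def edge_len_commute[of d y x] field_simps)
  have posn: "?L k i > 0" using pos by (simp add: edge_len_commute)
  have q: "x / l * (h / (l * S) * y) = h / S * (x / l\<^sup>2 * y)" for x y l h :: real
    by (simp add: power2_eq_square mult_ac)
  have q2: "x / (l * S) * h / l = h / S * (x / l\<^sup>2)" for x l h :: real
    by (simp add: power2_eq_square mult_ac)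
  have nz: "aa \<noteq> 0" "bb \<noteq> 0" "cc \<noteq> 0"
    using pos len(1) by (auto simp: aa_def bb_def)
  have "(d i j * w i + d j i * w j) * face_turn d w i j k l
       + (d j k * w j + d k j * w k) * face_turn d w j k i l
       + (d k i * w k + d i k * w i) * face_turn d w k i j l
     = H / S * ((ua * w i + (aa - ua) * w j) / aa * ((aa - ab) * (w k - w i) + ab * (w k - w j))
       + (uc * w j + (cc - uc) * w k) / cc * ((bb - ab) * (w i - w j) + (aa - ab) * (w i - w k))
       + ((bb - ub) * w k + ub * w i) / bb * (ab * (w j - w k) + (bb - ab) * (w j - w i)))"
    unfolding face_turn_def st[OF pos(1)] st[OF pos(3)] st[OF posn] h3 g H_def[symmetric] S_def[symmetric]
      dots len pj q ab_def[symmetric] ua_def[symmetric] ub_def[symmetric] aa_def[symmetric]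
    by (simp add: algebra_simps)
  also have "\<dots> = H / S * - ((ub * aa - ua * ab) / aa * (w i - w j)\<^sup>2
       + ((aa - ua) * cc - uc * (aa - ab)) / cc * (w j - w k)\<^sup>2
       + ((cc - uc) * bb - (bb - ub) * (bb - ab)) / bb * (w k - w i)\<^sup>2)"
    using nz unfolding cc_def uc_def by (subst face_variation_algebra) auto
  also have "\<dots> = - (dual_weight d i j k l * (w i - w j)\<^sup>2 + dual_weight d j k i l * (w j - w k)\<^sup>2 + dual_weight d k i j l * (w k - w i)\<^sup>2)"
    unfolding dual_weight_def h2 h3 H_def[symmetric] q2 len aa_def[symmetric]
    by (simp only: distrib_left mult_minus_right mult.assoc)
  finally show ?thesis .
qed

text \<open>Each angle variation is a sum over two faces. Swapping the roles of \<open>k\<close> and \<open>l\<close> identifies the two face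
sums, swapping \<open>i\<close> and \<open>j\<close> turns \<open>w\<^sub>i d\<^sub>i\<^sub>j\<close> into half of the length variation, and rotating \<open>i, j, k\<close> collects the
three edges of a face, to which \<open>face_energy\<close> applies.\<close>

lemma energy_identity:
  fixes d :: "'v::finite \<Rightarrow> 'v \<Rightarrow> real"
  assumes m: "\<And>\<sigma>. \<sigma> \<in> T \<Longrightarrow> metric_simplex d \<sigma>"
  shows "(\<Sum>(i, j, k, l)\<in>tet_tuples T. w i * d i j * (face_turn d w i j k l + face_turn d w i j l k))
       = - (\<Sum>(i, j, k, l)\<in>tet_tuples T. dual_weight d i j k l * (w i - w j)\<^sup>2)"
proof -
  let ?O = "tet_tuples T"
  let ?S = "\<lambda>F. (\<Sum>(i, j, k, l)\<in>?O. F i j k l) :: real"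
  define G where "G = face_turn d w"
  have add: "?S (\<lambda>i j k l. F i j k l + F' i j k l) = ?S F + ?S F'" for F F'
    by (simp add: case_prod_unfold sum.distrib)
  have O: "metric_simplex d {i, j, k, l}" "distinct [i, j, k, l]" if "(i, j, k, l) \<in> ?O" for i j k l
    using that m by (auto simp: tet_tuples_def card4_iff)
  have "?S (\<lambda>i j k l. w i * d i j * (G i j k l + G i j l k))
      = ?S (\<lambda>i j k l. w i * d i j * G i j k l) + ?S (\<lambda>i j k l. w i * d i j * G i j l k)"
    by (simp add: distrib_left add)
  moreover have "?S (\<lambda>i j k l. w i * d i j * G i j l k) = ?S (\<lambda>i j k l. w i * d i j * G i j k l)"
    by (rule sum_tet_tuples_swap34[of "\<lambda>i j k l. w i * d i j * G i j k l"])
  moreover have "?S (\<lambda>i j k l. w j * d j i * G j i k l) = ?S (\<lambda>i j k l. w i * d i j * G i j k l)"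
    by (rule sum_tet_tuples_swap12)
  moreover have "?S (\<lambda>i j k l. w j * d j i * G j i k l) = ?S (\<lambda>i j k l. w j * d j i * G i j k l)"
    using face_turn_swap[OF O] by (intro sum.cong refl) (auto simp: G_def)
  ultimately have "?S (\<lambda>i j k l. w i * d i j * (G i j k l + G i j l k))
      = ?S (\<lambda>i j k l. w i * d i j * G i j k l) + ?S (\<lambda>i j k l. w j * d j i * G i j k l)"
    by linarith
  then have 1: "?S (\<lambda>i j k l. w i * d i j * (G i j k l + G i j l k))
      = ?S (\<lambda>i j k l. (d i j * w i + d j i * w j) * G i j k l)"
    by (simp add: add[symmetric] algebra_simps)
  define A where "A = (\<lambda>i j k l. (d i j * w i + d j i * w j) * G i j k l)"
  define B where "B = (\<lambda>i j k l. dual_weight d i j k l * (w i - w j)\<^sup>2)"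
  have rot: "3 * ?S F = ?S (\<lambda>i j k l. F i j k l + F j k i l + F k i j l)" for F
    using sum_tet_tuples_rotate[of F T] sum_tet_tuples_rotate[of "\<lambda>i j k l. F j k i l" T]
    by (simp add: add)
  have "3 * ?S A = ?S (\<lambda>i j k l. A i j k l + A j k i l + A k i j l)" by (rule rot)
  also have "\<dots> = ?S (\<lambda>i j k l. - (B i j k l + B j k i l + B k i j l))"
    unfolding A_def B_def G_def using face_energy[OF O] by (intro sum.cong refl) auto
  also have "\<dots> = - ?S (\<lambda>i j k l. B i j k l + B j k i l + B k i j l)"
    by (simp add: case_prod_unfold del: minus_add_distrib flip: sum_negf)
  also have "\<dots> = - (3 * ?S B)" by (simp only: rot)
  finally show ?thesis using 1 unfolding A_def B_def G_def by simp
qed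

lemma dual_weight_sum_eq_dual_length:
  assumes "abstract_complex T"
  shows "(\<Sum>(i, j, k, l)\<in>tet_tuples T. dual_weight d i j k l * (w i - w j)\<^sup>2)
       = (\<Sum>(i, j)\<in>directed_edges T. 2 * dual_length T d i j / edge_len d i j * (w i - w j)\<^sup>2)"
proof -
  let ?O = "\<lambda>i j. {(k, l). {i, j, k, l} \<in> T \<and> card {i, j, k, l} = 4}"
  have "(\<Sum>(k, l)\<in>?O i j. dual_weight d i j k l) = 2 * dual_length T d i j / edge_len d i j" for i j
  proof -
    have "(\<Sum>(k, l)\<in>?O i j. dual_weight d i j l k) = (\<Sum>(k, l)\<in>?O i j. dual_weight d i j k l)"
      by (rule sum.reindex_bij_witness[where j = "\<lambda>(k, l). (l, k)" and i = "\<lambda>(k, l). (l, k)"])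
        (auto simp: insert_commute)
    then have "2 * (\<Sum>(k, l)\<in>?O i j. dual_weight d i j k l) = (\<Sum>(k, l)\<in>?O i j. dual_weight d i j k l + dual_weight d i j l k)"
      by (simp add: case_prod_unfold sum.distrib)
    also have "\<dots> = (\<Sum>(k, l)\<in>?O i j. 2 * dual_area d i j k l / edge_len d i j)"
      by (rule sum.cong) (auto simp: dual_weight_def dual_area_def add_divide_distrib)
    also have "\<dots> = 4 * dual_length T d i j / edge_len d i j"
      unfolding dual_length_def tetrahedra_sum_def
      by (simp add: case_prod_unfold sum_divide_distrib sum_distrib_left)
    finally show ?thesis by simp
  qed
  then have "(\<Sum>(k, l)\<in>?O i j. dual_weight d i j k l * (w i - w j)\<^sup>2)
      = 2 * dual_length T d i j / edge_len d i j * (w i - w j)\<^sup>2" for i j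
    by (simp add: case_prod_unfold flip: sum_distrib_right)
  then show ?thesis
    using sum_tet_tuples_by_edge[OF assms, of "\<lambda>i j k l. dual_weight d i j k l * (w i - w j)\<^sup>2"]
    by simp
qed

section \<open>Positivity of quadratic forms along a path\<close>

lemma psd_zero_imp_kernel:
  fixes B :: "'a::real_vector \<Rightarrow> 'a \<Rightarrow> real"
  assumes "bilinear B" and sym: "\<And>x y. B x y = B y x"
    and psd: "\<And>x. B x x \<ge> 0" and z: "B w w = 0"
  shows "B w v = 0"
proof (rule ccontr)
  assume nz: "B w v \<noteq> 0"
  \<comment> \<open>the summand \<open>1\<close> keeps the denominator positive when \<open>B v v = 0\<close>\<close>
  define s where "s = - B w v / (B v v + 1)"
  have v: "B v v + 1 > 0" using psd[of v] by linarith
  have "B (w + s *\<^sub>R v) (w + s *\<^sub>R v) = s * (2 * B w v + s * B v v)"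
    using assms(1) sym[of v w] z
    by (simp add: bilinear_ladd bilinear_radd bilinear_lmul bilinear_rmul algebra_simps)
  also have "2 * B w v + s * B v v = B w v * (B v v + 2) / (B v v + 1)"
    using v unfolding s_def by (simp add: field_simps)
  also have "s * \<dots> = - ((B w v)\<^sup>2 * (B v v + 2) / (B v v + 1)\<^sup>2)"
    unfolding s_def by (simp add: power2_eq_square)
  also have "\<dots> < 0" using nz v by simp
  finally show False using psd[of "w + s *\<^sub>R v"] by simp
qed

text \<open>A continuous path of nondegenerate symmetric forms cannot leave the positive definite ones: at the
first parameter where a unit vector with nonpositive value exists, the form is still positive
semidefinite, so that this vector lies in its kernel.\<close>

lemma pos_def_along_path:
  fixes B :: "real \<Rightarrow> 'a::euclidean_space \<Rightarrow> 'a \<Rightarrow> real"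
  assumes ab: "a \<le> b"
    and bil: "\<And>t. a \<le> t \<Longrightarrow> t \<le> b \<Longrightarrow> bilinear (B t)"
    and sym: "\<And>t x y. B t x y = B t y x"
    and cont: "continuous_on ({a..b} \<times> UNIV) (\<lambda>(t, w). B t w w)"
    and nondeg: "\<And>t w. a \<le> t \<Longrightarrow> t \<le> b \<Longrightarrow> (\<And>v. B t w v = 0) \<Longrightarrow> w = 0"
    and start: "\<And>w. w \<noteq> 0 \<Longrightarrow> B a w w > 0"
    and "w \<noteq> 0"
  shows "B b w w > 0"
proof (rule ccontr)
  assume "\<not> B b w w > 0"
  define f where "f = (\<lambda>(t, w). B t w w)"
  define X where "X = {a..b} \<times> sphere (0::'a) 1"
  have contX: "continuous_on X f"
    unfolding f_def using cont by (rule continuous_on_subset) (auto simp: X_def)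
  have homog: "B t v v = (norm v)\<^sup>2 * B t (sgn v) (sgn v)" if "a \<le> t" "t \<le> b" for t v
  proof -
    have "B t v v = B t (norm v *\<^sub>R sgn v) (norm v *\<^sub>R sgn v)" by (cases "v = 0") (simp_all add: sgn_div_norm)
    also have "\<dots> = (norm v)\<^sup>2 * B t (sgn v) (sgn v)"
      unfolding bilinear_lmul[OF bil[OF that]] bilinear_rmul[OF bil[OF that]]
      by (simp add: power2_eq_square)
    finally show ?thesis .
  qed
  define K where "K = {x \<in> X. f x \<le> 0}"
  have "compact X" unfolding X_def by (intro compact_Times) auto
  moreover have "closed K" unfolding K_def
    using contX \<open>compact X\<close> by (intro continuous_on_closed_Collect_le continuous_intros) (auto intro: compact_imp_closed)
  ultimately have "compact (X \<inter> K)" by (rule compact_Int_closed)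
  moreover have "X \<inter> K = K" by (auto simp: K_def)
  ultimately have "compact K" by simp
  have "B b (sgn w) (sgn w) \<le> 0"
    using homog[of b w] ab \<open>\<not> B b w w > 0\<close> \<open>w \<noteq> 0\<close> by (simp add: not_less mult_le_0_iff)
  then have "(b, sgn w) \<in> K"
    using ab \<open>w \<noteq> 0\<close> by (simp add: K_def X_def f_def norm_sgn)
  then have "fst ` K \<noteq> {}" by blast
  moreover have "compact (fst ` K)"
    using \<open>compact K\<close> by (intro compact_continuous_image continuous_intros)
  ultimately obtain t where t: "t \<in> fst ` K" and tmin: "\<And>s. s \<in> fst ` K \<Longrightarrow> t \<le> s"
    using compact_attains_inf by metis
  from t obtain u where u: "a \<le> t" "t \<le> b" "norm u = 1" "B t u u \<le> 0"
    by (auto simp: K_def X_def f_def)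
  have "u \<noteq> 0" using u by auto
  have "t \<noteq> a" using start[OF \<open>u \<noteq> 0\<close>] u(4) by auto
  then have "a < t" using u by simp
  have psd1: "B t v v \<ge> 0" if v: "norm v = 1" for v
  proof (rule tendsto_lowerbound)
    have "continuous_on {a..b} (\<lambda>s. f (s, v))"
      by (rule continuous_on_compose2[OF contX]) (auto intro!: continuous_intros simp: X_def v)
    then have "((\<lambda>s. f (s, v)) \<longlongrightarrow> f (t, v)) (at t within {a..b})"
      using u by (simp add: continuous_on)
    then have "((\<lambda>s. f (s, v)) \<longlongrightarrow> f (t, v)) (at t within {a..t})"
      by (rule tendsto_within_subset) (use u in auto)
    then show "((\<lambda>s. B s v v) \<longlongrightarrow> B t v v) (at_left t)"
      using \<open>a < t\<close> by (simp add: f_def at_within_Icc_at_left)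
    show "\<forall>\<^sub>F s in at_left t. 0 \<le> B s v v"
    proof (rule eventually_at_leftI)
      show "a < t" by fact
      fix s assume s: "s \<in> {a<..<t}"
      show "0 \<le> B s v v"
      proof (rule ccontr)
        assume "\<not> 0 \<le> B s v v"
        then have "(s, v) \<in> K" using s u v by (auto simp: K_def X_def f_def)
        then have "t \<le> s" using tmin by force
        then show False using s by simp
      qed
    qed
  qed simp
  have psd: "B t v v \<ge> 0" for v
  proof (cases "v = 0")
    case True
    then show ?thesis using bilinear_lzero[OF bil[OF u(1,2)]] by simp
  next
    case False
    then show ?thesis using homog[OF u(1,2), of v] psd1[of "sgn v"] by (simp add: norm_sgn)
  qed
  then have "B t u u = 0" using u(4) by (simp add: order_antisym)
  then have "B t u v = 0" for v
    using psd_zero_imp_kernel[OF bil[OF u(1,2)] sym psd] by blast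
  then show False using nondeg[OF u(1,2), of u] \<open>u \<noteq> 0\<close> by blast
qed

section \<open>The form of a tetrahedron of mutually tangent spheres\<close>

text \<open>In this section \<open>a, b, c, d\<close> are the curvatures (inverse radii) of four mutually tangent spheres and
\<open>x, y, z, u\<close> the rates \<open>w\<close> at their centers. The inradius of the face \<open>a b c\<close> is
\<open>1 / sqrt (sig3 a b c)\<close>.\<close>

definition sig3 :: "real \<Rightarrow> real \<Rightarrow> real \<Rightarrow> real" where
  "sig3 a b c = a * b + b * c + c * a"

text \<open>Up to a factor common to all edges, \<open>2 A / \<ell>\<close> for the edge joining the spheres \<open>a\<close> and \<open>b\<close>, with one summand for
each of the two faces. The number \<open>a + b + c - d\<close> is a positive multiple of the height of the center
over the face opposite to \<open>d\<close>.\<close>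

definition edge_weight :: "real \<Rightarrow> real \<Rightarrow> real \<Rightarrow> real \<Rightarrow> real" where
  "edge_weight a b c d = a * b / (a + b) *
     ((a + b + c - d) / sig3 a b c + (a + b + d - c) / sig3 a b d)"

text \<open>The expression of Descartes' circle theorem. It equals \<open>4 / R\<^sup>2\<close> for the radius \<open>R\<close> of the sphere orthogonal
to the four given ones, which touches all edges, and it is positive iff the tetrahedron is nondegenerate
(\<open>gram3_sphere_packing\<close>).\<close>

definition descartes :: "real \<Rightarrow> real \<Rightarrow> real \<Rightarrow> real \<Rightarrow> real" where
  "descartes a b c d = (a + b + c + d)\<^sup>2 - 2 * (a\<^sup>2 + b\<^sup>2 + c\<^sup>2 + d\<^sup>2)"

definition packing_form :: "real \<Rightarrow> real \<Rightarrow> real \<Rightarrow> real \<Rightarrow> real \<Rightarrow> real \<Rightarrow> real \<Rightarrow> real \<Rightarrow>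
    real \<Rightarrow> real \<Rightarrow> real \<Rightarrow> real \<Rightarrow> real" where
  "packing_form a b c d x y z u x' y' z' u' =
     edge_weight a b c d * ((x - y) * (x' - y')) + edge_weight a c b d * ((x - z) * (x' - z'))
   + edge_weight a d b c * ((x - u) * (x' - u')) + edge_weight b c a d * ((y - z) * (y' - z'))
   + edge_weight b d a c * ((y - u) * (y' - u')) + edge_weight c d a b * ((z - u) * (z' - u'))"

lemma edge_weight_alt:
  assumes "a > 0" "b > 0" "c > 0" "d > 0"
  shows "edge_weight a b c d =
    a * b * (2 * a * b + (a + b) * (c + d) - (c - d)\<^sup>2) / (sig3 a b c * sig3 a b d)"
proof -
  have s: "sig3 a b c > 0" "sig3 a b d > 0" using assms by (auto simp: sig3_def add_pos_pos)
  have "(a + b + c - d) * sig3 a b d + (a + b + d - c) * sig3 a b c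
    = (a + b) * (2 * a * b + (a + b) * (c + d) - (c - d)\<^sup>2)"
    by (simp add: sig3_def algebra_simps power2_eq_square)
  then have "(a + b + c - d) / sig3 a b c + (a + b + d - c) / sig3 a b d
     = (a + b) * (2 * a * b + (a + b) * (c + d) - (c - d)\<^sup>2) / (sig3 a b c * sig3 a b d)"
    using s by (simp add: add_frac_eq)
  then show ?thesis unfolding edge_weight_def using assms by simp
qed

text \<open>Let \<open>\<phi>\<close> be the angle between the face \<open>a b c\<close> and the plane through one of its edges and the center; it is
the same for the three edges, and \<open>tan \<phi> = (a + b + c - d) / sqrt D\<close> with \<open>D = descartes a b c d\<close>. Then
\<open>tilt\<close> is \<open>4 sqrt D\<close> times the derivative of \<open>\<phi>\<close> when the curvatures change by \<open>- a x, - b y, - c z, - d u\<close>. In the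
definition, \<open>h\<close> is half of the derivative of \<open>D\<close>.\<close>

definition tilt :: "real \<Rightarrow> real \<Rightarrow> real \<Rightarrow> real \<Rightarrow> real \<Rightarrow> real \<Rightarrow> real \<Rightarrow> real \<Rightarrow> real" where
  "tilt a b c d x y z u =
     (let \<delta>y = - (a * x) - b * y - c * z + d * u;
          h = (a + b + c + d) * (- (a * x) - b * y - c * z - d * u)
               + 2 * (a\<^sup>2 * x + b\<^sup>2 * y + c\<^sup>2 * z + d\<^sup>2 * u)
      in (descartes a b c d * \<delta>y - (a + b + c - d) * h) / sig3 a b c)"

text \<open>Varying the radius of \<open>a\<close> changes the lengths of the three edges at \<open>a\<close> by the same amount. The sum of their
dihedral angles counts twice the angle \<open>\<phi>\<close> of each of the three faces at \<open>a\<close>. Hence the row of the form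
that belongs to \<open>a\<close> is a combination of the three tilts with equal coefficients.\<close>

lemma laplacian_eq_tilts:
  assumes "a > 0" "b > 0" "c > 0" "d > 0"
  shows "2 * a * (edge_weight a b c d * (x - y) + edge_weight a c b d * (x - z) + edge_weight a d b c * (x - u))
    = - (tilt a b c d x y z u + tilt a b d c x y u z + tilt a c d b x z u y)"
proof -
  define e1 e2 e3 where "e1 = sig3 a b c" and "e2 = sig3 a b d" and "e3 = sig3 a c d"
  have e: "e1 > 0" "e2 > 0" "e3 > 0" using assms by (auto simp: e1_def e2_def e3_def sig3_def add_pos_pos)
  have s: "sig3 a c b = e1" "sig3 a d b = e2" "sig3 a d c = e3"
    by (auto simp: e1_def e2_def e3_def sig3_def algebra_simps)
  define D1 D2 D3 where "D1 = tilt a b c d x y z u * e1" and "D2 = tilt a b d c x y u z * e2"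
    and "D3 = tilt a c d b x z u y * e3"
  have t: "tilt a b c d x y z u = D1 / e1" "tilt a b d c x y u z = D2 / e2"
    "tilt a c d b x z u y = D3 / e3"
    using e by (auto simp: D1_def D2_def D3_def)
  \<comment> \<open>the numerators of the edge weights, as given by \<open>edge_weight_alt\<close>\<close>
  define m1 m2 m3 where
    "m1 = a * b * (2 * a * b + (a + b) * (c + d) - (c - d)\<^sup>2)" and
    "m2 = a * c * (2 * a * c + (a + c) * (b + d) - (b - d)\<^sup>2)" and
    "m3 = a * d * (2 * a * d + (a + d) * (b + c) - (b - c)\<^sup>2)"
  have w: "edge_weight a b c d = m1 / (e1 * e2)" "edge_weight a c b d = m2 / (e1 * e3)"
     "edge_weight a d b c = m3 / (e2 * e3)"
    using assms by (simp_all add: edge_weight_alt e1_def[symmetric] e2_def[symmetric] e3_def[symmetric]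
        s m1_def m2_def m3_def)
  have "2 * a * (m1 * (x - y) * e3 + m2 * (x - z) * e2 + m3 * (x - u) * e1)
     + (D1 * (e2 * e3) + D2 * (e1 * e3) + D3 * (e1 * e2)) = 0"
  proof -
    define h where "h = (a + b + c + d) * (- (a * x) - b * y - c * z - d * u)
               + 2 * (a\<^sup>2 * x + b\<^sup>2 * y + c\<^sup>2 * z + d\<^sup>2 * u)"
    have hs: "(a + b + d + c) * (- (a * x) - b * y - d * u - c * z)
               + 2 * (a\<^sup>2 * x + b\<^sup>2 * y + d\<^sup>2 * u + c\<^sup>2 * z) = h"
      "(a + c + d + b) * (- (a * x) - c * z - d * u - b * y)
               + 2 * (a\<^sup>2 * x + c\<^sup>2 * z + d\<^sup>2 * u + b\<^sup>2 * y) = h"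
      by (simp_all add: h_def algebra_simps)
    have D: "D1 = descartes a b c d * (- (a * x) - b * y - c * z + d * u) - (a + b + c - d) * h"
      "D2 = descartes a b d c * (- (a * x) - b * y - d * u + c * z) - (a + b + d - c) * h"
      "D3 = descartes a c d b * (- (a * x) - c * z - d * u + b * y) - (a + c + d - b) * h"
      using e unfolding D1_def D2_def D3_def tilt_def Let_def
        e1_def[symmetric] e2_def[symmetric] e3_def[symmetric] h_def[symmetric] hs by simp_all
    have P: "descartes a b d c = descartes a b c d" "descartes a c d b = descartes a b c d"
      by (simp_all add: descartes_def algebra_simps)
    \<comment> \<open>the identity is linear in \<open>x, y, z, u\<close>, and the four coefficients are compared separately\<close>
    define \<sigma> P yb yc yd where "\<sigma> = a + b + c + d" and "P = descartes a b c d"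
      and "yb = a + c + d - b" and "yc = a + b + d - c" and "yd = a + b + c - d"
    note defs = m1_def m2_def m3_def e1_def e2_def e3_def sig3_def descartes_def \<sigma>_def P_def
      yb_def yc_def yd_def
    have "2 * a * (m1 * e3 + m2 * e2 + m3 * e1)
       + (- (a * P) - yd * (2 * a\<^sup>2 - a * \<sigma>)) * (e2 * e3)
       + (- (a * P) - yc * (2 * a\<^sup>2 - a * \<sigma>)) * (e1 * e3)
       + (- (a * P) - yb * (2 * a\<^sup>2 - a * \<sigma>)) * (e1 * e2) = 0"
      unfolding defs by algebra
    moreover have "- (2 * a * m1 * e3)
       + (- (b * P) - yd * (2 * b\<^sup>2 - b * \<sigma>)) * (e2 * e3)
       + (- (b * P) - yc * (2 * b\<^sup>2 - b * \<sigma>)) * (e1 * e3)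
       + (b * P - yb * (2 * b\<^sup>2 - b * \<sigma>)) * (e1 * e2) = 0"
      unfolding defs by algebra
    moreover have "- (2 * a * m2 * e2)
       + (- (c * P) - yd * (2 * c\<^sup>2 - c * \<sigma>)) * (e2 * e3)
       + (c * P - yc * (2 * c\<^sup>2 - c * \<sigma>)) * (e1 * e3)
       + (- (c * P) - yb * (2 * c\<^sup>2 - c * \<sigma>)) * (e1 * e2) = 0"
      unfolding defs by algebra
    moreover have "- (2 * a * m3 * e1)
       + (d * P - yd * (2 * d\<^sup>2 - d * \<sigma>)) * (e2 * e3)
       + (- (d * P) - yc * (2 * d\<^sup>2 - d * \<sigma>)) * (e1 * e3)
       + (- (d * P) - yb * (2 * d\<^sup>2 - d * \<sigma>)) * (e1 * e2) = 0"
      unfolding defs by algebra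
    moreover have "2 * a * (m1 * (x - y) * e3 + m2 * (x - z) * e2 + m3 * (x - u) * e1)
         + (D1 * (e2 * e3) + D2 * (e1 * e3) + D3 * (e1 * e2))
      = (2 * a * (m1 * e3 + m2 * e2 + m3 * e1)
       + (- (a * P) - yd * (2 * a\<^sup>2 - a * \<sigma>)) * (e2 * e3)
       + (- (a * P) - yc * (2 * a\<^sup>2 - a * \<sigma>)) * (e1 * e3)
       + (- (a * P) - yb * (2 * a\<^sup>2 - a * \<sigma>)) * (e1 * e2)) * x
      + (- (2 * a * m1 * e3)
       + (- (b * P) - yd * (2 * b\<^sup>2 - b * \<sigma>)) * (e2 * e3)
       + (- (b * P) - yc * (2 * b\<^sup>2 - b * \<sigma>)) * (e1 * e3)
       + (b * P - yb * (2 * b\<^sup>2 - b * \<sigma>)) * (e1 * e2)) * y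
      + (- (2 * a * m2 * e2)
       + (- (c * P) - yd * (2 * c\<^sup>2 - c * \<sigma>)) * (e2 * e3)
       + (c * P - yc * (2 * c\<^sup>2 - c * \<sigma>)) * (e1 * e3)
       + (- (c * P) - yb * (2 * c\<^sup>2 - c * \<sigma>)) * (e1 * e2)) * z
      + (- (2 * a * m3 * e1)
       + (d * P - yd * (2 * d\<^sup>2 - d * \<sigma>)) * (e2 * e3)
       + (- (d * P) - yc * (2 * d\<^sup>2 - d * \<sigma>)) * (e1 * e3)
       + (- (d * P) - yb * (2 * d\<^sup>2 - d * \<sigma>)) * (e1 * e2)) * u"
      unfolding D P P_def[symmetric] yb_def[symmetric] yc_def[symmetric] yd_def[symmetric]
        h_def \<sigma>_def[symmetric]
      by (simp add: algebra_simps)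
    ultimately show ?thesis by simp
  qed
  then have "2 * a * (m1 * (x - y) * e3 + m2 * (x - z) * e2 + m3 * (x - u) * e1)
     = - (D1 * (e2 * e3) + D2 * (e1 * e3) + D3 * (e1 * e2))" by linarith
  moreover have "m1 / (e1 * e2) * p + m2 / (e1 * e3) * q + m3 / (e2 * e3) * r
      = (m1 * p * e3 + m2 * q * e2 + m3 * r * e1) / (e1 * e2 * e3)" for p q r
    using e by (simp add: field_simps)
  moreover have "D1 / e1 + D2 / e2 + D3 / e3
      = (D1 * (e2 * e3) + D2 * (e1 * e3) + D3 * (e1 * e2)) / (e1 * e2 * e3)"
    using e by (simp add: field_simps)
  ultimately show ?thesis unfolding t w by (simp only: times_divide_eq_right minus_divide_left)
qed


lemma edge_weight_swap: "edge_weight b a c d = edge_weight a b c d" "edge_weight a b d c = edge_weight a b c d"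
  by (simp_all add: edge_weight_def sig3_def add.commute mult.commute add.left_commute)

lemma descartes_cycle: "descartes b c d a = descartes a b c d"
  by (simp add: descartes_def algebra_simps)

lemma tilt_swap:
  "tilt b a c d y x z u = tilt a b c d x y z u" "tilt a c b d x z y u = tilt a b c d x y z u"
proof -
  have "descartes b a c d = descartes a b c d" "descartes a c b d = descartes a b c d"
    "sig3 b a c = sig3 a b c" "sig3 a c b = sig3 a b c"
    by (simp_all add: descartes_def sig3_def algebra_simps)
  then show "tilt b a c d y x z u = tilt a b c d x y z u" "tilt a c b d x z y u = tilt a b c d x y z u"
    by (simp_all add: tilt_def Let_def add.commute add.left_commute diff_diff_eq)
      (simp_all add: algebra_simps)?
qed

lemma packing_form_cycle:
  "packing_form b c d a y z u x y' z' u' x' = packing_form a b c d x y z u x' y' z' u'"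
proof -
  note e = edge_weight_swap(2)[of b c d a] edge_weight_swap(2)[of b d c a]
    edge_weight_swap(1)[of b a c d] edge_weight_swap(2)[of c d b a] edge_weight_swap(1)[of c a b d]
    edge_weight_swap(1)[of d a b c]
  show ?thesis unfolding packing_form_def e by (simp add: algebra_simps)
qed

lemma sig3_pos: "a > 0 \<Longrightarrow> b > 0 \<Longrightarrow> c > 0 \<Longrightarrow> sig3 a b c > 0"
  by (simp add: sig3_def add_pos_pos)

text \<open>If all angles \<open>\<phi>\<close> are stationary then so are the numbers \<open>(a + b + c - d) / sqrt D\<close>, hence the curvatures up to
scaling.\<close>

lemma tilts_zero_imp_equal:
  assumes pos: "a > 0" "b > 0" "c > 0" "d > 0" and D: "descartes a b c d > 0"
    and t: "tilt a b c d x y z u = 0" "tilt a b d c x y u z = 0"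
       "tilt a c d b x z u y = 0" "tilt b c d a y z u x = 0"
  shows "x = y \<and> y = z \<and> z = u"
proof -
  define D h where "D = descartes a b c d"
    and "h = (a + b + c + d) * (- (a * x) - b * y - c * z - d * u)
               + 2 * (a\<^sup>2 * x + b\<^sup>2 * y + c\<^sup>2 * z + d\<^sup>2 * u)"
  have Ds: "descartes a b d c = D" "descartes a c d b = D" "descartes b c d a = D"
    by (auto simp: D_def descartes_def algebra_simps)
  have s: "sig3 a b c > 0" "sig3 a b d > 0" "sig3 a c d > 0" "sig3 b c d > 0"
    using pos by (auto intro: sig3_pos)
  have hs: "(a + b + d + c) * (- (a * x) - b * y - d * u - c * z)
               + 2 * (a\<^sup>2 * x + b\<^sup>2 * y + d\<^sup>2 * u + c\<^sup>2 * z) = h"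
    "(a + c + d + b) * (- (a * x) - c * z - d * u - b * y)
               + 2 * (a\<^sup>2 * x + c\<^sup>2 * z + d\<^sup>2 * u + b\<^sup>2 * y) = h"
    "(b + c + d + a) * (- (b * y) - c * z - d * u - a * x)
               + 2 * (b\<^sup>2 * y + c\<^sup>2 * z + d\<^sup>2 * u + a\<^sup>2 * x) = h"
    by (simp_all add: h_def algebra_simps)
  define E1 E2 E3 E4 where "E1 = D * (- (a * x) - b * y - c * z + d * u) - (a + b + c - d) * h"
    and "E2 = D * (- (a * x) - b * y - d * u + c * z) - (a + b + d - c) * h"
    and "E3 = D * (- (a * x) - c * z - d * u + b * y) - (a + c + d - b) * h"
    and "E4 = D * (- (b * y) - c * z - d * u + a * x) - (b + c + d - a) * h"
  have E: "E1 = 0" "E2 = 0" "E3 = 0" "E4 = 0"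
    using t s unfolding tilt_def Let_def Ds D_def[symmetric] h_def[symmetric] hs
      E1_def E2_def E3_def E4_def by simp_all
  \<comment> \<open>\<open>4 a\<close> is the sum of the three numbers \<open>a + b + c - d\<close> etc. of the faces that
    contain \<open>a\<close>, minus that of the opposite face\<close>
  have "4 * (a * (D * x + h)) = E4 - E1 - E2 - E3" "4 * (b * (D * y + h)) = E3 - E1 - E2 - E4"
    "4 * (c * (D * z + h)) = E2 - E1 - E3 - E4" "4 * (d * (D * u + h)) = E1 - E2 - E3 - E4"
    unfolding E1_def E2_def E3_def E4_def by (simp_all add: algebra_simps)
  then have "D * x + h = 0" "D * y + h = 0" "D * z + h = 0" "D * u + h = 0"
    unfolding E using pos by simp_all
  then have "D * x = - h" "D * y = - h" "D * z = - h" "D * u = - h"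
    by linarith+
  moreover have "D \<noteq> 0" using D by (simp add: D_def)
  ultimately show ?thesis by (metis mult_left_cancel)
qed

text \<open>The form kills a vector iff all four combinations of tilts in \<open>laplacian_eq_tilts\<close> vanish. In each of
them one tilt is missing, so all tilts vanish.\<close>

lemma packing_form_nondegenerate:
  assumes pos: "a > 0" "b > 0" "c > 0" "d > 0" and D: "descartes a b c d > 0"
    and z: "\<And>x' y' z'. packing_form a b c d x y z u x' y' z' 0 = 0"
  shows "x = y \<and> y = z \<and> z = u"
proof -
  define A1 A2 A3 A4 where
    "A1 = edge_weight a b c d * (x - y) + edge_weight a c b d * (x - z) + edge_weight a d b c * (x - u)"
    and "A2 = edge_weight b a c d * (y - x) + edge_weight b c a d * (y - z) + edge_weight b d a c * (y - u)"
    and "A3 = edge_weight c a b d * (z - x) + edge_weight c b a d * (z - y) + edge_weight c d a b * (z - u)"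
    and "A4 = edge_weight d a b c * (u - x) + edge_weight d b a c * (u - y) + edge_weight d c a b * (u - z)"
  note sw = edge_weight_swap(1)[of b a] edge_weight_swap(1)[of c a] edge_weight_swap(1)[of d a]
    edge_weight_swap(1)[of c b] edge_weight_swap(1)[of d b] edge_weight_swap(1)[of d c]
  have A: "A1 = 0" "A2 = 0" "A3 = 0"
    using z[of 1 0 0] z[of 0 1 0] z[of 0 0 1]
    unfolding A1_def A2_def A3_def packing_form_def sw by (simp_all add: algebra_simps)
  have "A1 + A2 + A3 + A4 = 0"
    unfolding A1_def A2_def A3_def A4_def sw by (simp add: algebra_simps)
  with A have A4: "A4 = 0" by simp
  define Ta Tb Tc Td where "Ta = tilt b c d a y z u x" and "Tb = tilt a c d b x z u y"
    and "Tc = tilt a b d c x y u z" and "Td = tilt a b c d x y z u"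
  have "Td + Tc + Tb = 0"
    using laplacian_eq_tilts[OF pos(1,2,3,4), of x y z u] A(1)
    by (simp add: A1_def Ta_def Tb_def Tc_def Td_def)
  moreover have "Td + Tc + Ta = 0"
    using laplacian_eq_tilts[OF pos(2,1,3,4), of y x z u] A(2)
    by (simp add: A2_def Ta_def Tb_def Tc_def Td_def tilt_swap)
  moreover have "Td + Tb + Ta = 0"
    using laplacian_eq_tilts[OF pos(3,1,2,4), of z x y u] A(3)
    by (simp add: A3_def Ta_def Tb_def Tc_def Td_def tilt_swap)
  moreover have "Tc + Tb + Ta = 0"
    using laplacian_eq_tilts[OF pos(4,1,2,3), of u x y z] A4
    by (simp add: A4_def Ta_def Tb_def Tc_def Td_def tilt_swap)
  ultimately have "Td = 0" "Tc = 0" "Tb = 0" "Ta = 0" by linarith+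
  then show ?thesis
    unfolding Ta_def Tb_def Tc_def Td_def by (rule tilts_zero_imp_equal[OF pos D])
qed

lemma edge_weight_pos:
  assumes "a > 0" "b > 0" "c > 0" "d > 0" "d \<le> a + b + c" "c \<le> a + b + d"
  shows "edge_weight a b c d > 0"
proof -
  have s: "sig3 a b c > 0" "sig3 a b d > 0" using assms by (auto intro: sig3_pos)
  have "0 < (a + b + c - d) / sig3 a b c + (a + b + d - c) / sig3 a b d"
  proof (cases "d = a + b + c")
    case True
    then show ?thesis using s assms by simp
  next
    case False
    then show ?thesis using s assms by (intro add_pos_nonneg) auto
  qed
  then show ?thesis unfolding edge_weight_def using assms by simp
qed

text \<open>The inequalities say that the center is on the inner side of every face. At most one of them is an
equality, and every edge lies on two faces, so all weights are positive.\<close>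

lemma packing_form_pos_center_inside:
  assumes "a > 0" "b > 0" "c > 0" "d > 0"
    and "a \<le> b + c + d" "b \<le> a + c + d" "c \<le> a + b + d" "d \<le> a + b + c"
    and ne: "\<not> (x = y \<and> y = z \<and> z = u)"
  shows "packing_form a b c d x y z u x y z u > 0"
proof -
  have w: "edge_weight a b c d > 0" "edge_weight a c b d > 0" "edge_weight a d b c > 0"
    "edge_weight b c a d > 0" "edge_weight b d a c > 0" "edge_weight c d a b > 0"
    using assms(1-8) by (auto intro!: edge_weight_pos)
  then have nn: "0 \<le> edge_weight a b c d * ((x - y) * (x - y))" "0 \<le> edge_weight a c b d * ((x - z) * (x - z))"
    "0 \<le> edge_weight a d b c * ((x - u) * (x - u))" "0 \<le> edge_weight b c a d * ((y - z) * (y - z))"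
    "0 \<le> edge_weight b d a c * ((y - u) * (y - u))" "0 \<le> edge_weight c d a b * ((z - u) * (z - u))"
    by simp_all
  have sqp: "(p - q) * (p - q) > 0" if "p \<noteq> q" for p q :: real
    using that by (metis eq_iff_diff_eq_0 not_real_square_gt_zero)
  from ne consider "x \<noteq> y" | "y \<noteq> z" | "z \<noteq> u" by blast
  then show ?thesis
  proof cases
    case 1
    then have "0 < edge_weight a b c d * ((x - y) * (x - y))" using w sqp by simp
    then show ?thesis unfolding packing_form_def using nn by linarith
  next
    case 2
    then have "0 < edge_weight b c a d * ((y - z) * (y - z))" using w sqp by simp
    then show ?thesis unfolding packing_form_def using nn by linarith
  next
    case 3
    then have "0 < edge_weight c d a b * ((z - u) * (z - u))" using w sqp by simp
    then show ?thesis unfolding packing_form_def using nn by linarith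
  qed
qed

lemma continuous_on_edge_weight:
  fixes f g h k :: "'a::topological_space \<Rightarrow> real"
  assumes c: "continuous_on S f" "continuous_on S g" "continuous_on S h" "continuous_on S k"
    and p: "\<And>x. x \<in> S \<Longrightarrow> f x > 0" "\<And>x. x \<in> S \<Longrightarrow> g x > 0" "\<And>x. x \<in> S \<Longrightarrow> h x > 0"
      "\<And>x. x \<in> S \<Longrightarrow> k x > 0"
  shows "continuous_on S (\<lambda>x. edge_weight (f x) (g x) (h x) (k x))"
proof -
  have s: "continuous_on S (\<lambda>x. sig3 (f x) (g x) (h x))" "continuous_on S (\<lambda>x. sig3 (f x) (g x) (k x))"
    unfolding sig3_def by (intro continuous_intros c)+
  have "f x + g x \<noteq> 0" "sig3 (f x) (g x) (h x) \<noteq> 0" "sig3 (f x) (g x) (k x) \<noteq> 0" if "x \<in> S" for x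
    using sig3_pos[OF p(1-3)[OF that]] sig3_pos[OF p(1,2,4)[OF that]] p(1,2)[OF that] by auto
  then show ?thesis
    unfolding edge_weight_def by (intro continuous_intros c s ballI)
qed

text \<open>When the sphere \<open>d\<close> is so small that the center is beyond the opposite face, weights may be negative.
Enlarging this sphere until its curvature is \<open>a + b + c\<close> keeps the tetrahedron nondegenerate and moves
the center onto this face; along this path the form cannot lose its positivity. The last variable is
normalized to \<open>0\<close> to make the form nondegenerate.\<close>

lemma packing_form_pos_center_outside:
  assumes pos: "a > 0" "b > 0" "c > 0" and D: "descartes a b c d > 0" and d: "a + b + c \<le> d"
    and ne: "\<not> (x = y \<and> y = z \<and> z = u)"
  shows "packing_form a b c d x y z u x y z u > 0"
proof -
  define B :: "real \<Rightarrow> real \<times> real \<times> real \<Rightarrow> real \<times> real \<times> real \<Rightarrow> real" where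
    "B = (\<lambda>t w v. packing_form a b c t (fst w) (fst (snd w)) (snd (snd w)) 0
                     (fst v) (fst (snd v)) (snd (snd v)) 0)"
  let ?w = "(x - u, y - u, z - u)"
  have "B d ?w ?w > 0"
  proof (rule pos_def_along_path[where a = "a + b + c" and B = B and b = d and w = ?w])
    show "a + b + c \<le> d" by fact
    show "bilinear (B t)" for t
      unfolding bilinear_def linear_iff by (simp add: B_def packing_form_def algebra_simps)
    show "B t w v = B t v w" for t w v
      by (simp add: B_def packing_form_def mult_ac)
    have tpos: "t > 0" if "a + b + c \<le> t" for t using pos that by linarith
    show "continuous_on ({a + b + c..d} \<times> UNIV) (\<lambda>(t, w). B t w w)"
      unfolding B_def packing_form_def case_prod_unfold
      by (intro continuous_intros continuous_on_edge_weight) (use pos tpos in auto)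
    show "w = 0" if t: "a + b + c \<le> t" "t \<le> d" and k: "\<And>v. B t w v = 0" for t w
    proof -
      have "descartes a b c t - descartes a b c d = (d - t) * ((t - a - b - c) + (d - a - b - c))"
        by (simp add: descartes_def algebra_simps power2_eq_square)
      moreover have "\<dots> \<ge> 0" using t d by simp
      ultimately have Dt: "descartes a b c t > 0" using D by linarith
      have "packing_form a b c t (fst w) (fst (snd w)) (snd (snd w)) 0 x' y' z' 0 = 0" for x' y' z'
        using k[of "(x', y', z')"] by (simp add: B_def)
      from packing_form_nondegenerate[OF pos tpos[OF t(1)] Dt this]
      show "w = 0" by (simp add: prod_eq_iff)
    qed
    show "B (a + b + c) w w > 0" if "w \<noteq> 0" for w
      unfolding B_def using pos that by (intro packing_form_pos_center_inside) (auto simp: prod_eq_iff)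
    show "?w \<noteq> 0" using ne by (auto simp: prod_eq_iff)
  qed
  then show ?thesis by (simp add: B_def packing_form_def)
qed

text \<open>The sum of any two of the numbers \<open>a + b + c - d\<close> etc. is positive, so the center lies beyond at most one face.\<close>

lemma packing_form_pos:
  assumes pos: "a > 0" "b > 0" "c > 0" "d > 0" and D: "descartes a b c d > 0"
    and ne: "\<not> (x = y \<and> y = z \<and> z = u)"
  shows "packing_form a b c d x y z u x y z u > 0"
proof -
  consider "a + b + c \<le> d" | "b + c + d \<le> a" | "c + d + a \<le> b" | "d + a + b \<le> c"
    | "a \<le> b + c + d" "b \<le> a + c + d" "c \<le> a + b + d" "d \<le> a + b + c"
    by linarith
  then show ?thesis
  proof cases
    case 1
    then show ?thesis using packing_form_pos_center_outside[OF pos(1-3) D] ne by blast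
  next
    case 2
    have "packing_form b c d a y z u x y z u x > 0"
      using packing_form_pos_center_outside[OF pos(2-4), of a y z u x] 2 D ne by (auto simp: descartes_cycle)
    then show ?thesis by (simp add: packing_form_cycle)
  next
    case 3
    have "packing_form c d a b z u x y z u x y > 0"
      using packing_form_pos_center_outside[OF pos(3,4,1), of b z u x y] 3 D ne
      descartes_cycle[of a b c d] descartes_cycle[of d a b c] descartes_cycle[of c d a b] by auto
    then show ?thesis
      using packing_form_cycle[of c d a b z u x y z u x y] packing_form_cycle[of b c d a y z u x y z u x] by (simp add: packing_form_cycle)
  next
    case 4
    have "packing_form d a b c u x y z u x y z > 0"
      using packing_form_pos_center_outside[OF pos(4,1,2), of c u x y z] 4 D ne
      descartes_cycle[of a b c d] descartes_cycle[of d a b c] descartes_cycle[of c d a b] by auto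
    then show ?thesis
      using packing_form_cycle[of a b c d x y z u x y z u] packing_form_cycle[of d a b c u x y z u x y z] by simp
  next
    case 5
    then show ?thesis using packing_form_pos_center_inside[OF pos] ne by blast
  qed
qed

section \<open>Functions on the vertices of a connected triangulation\<close>

text \<open>Points of the realization whose support lies in the level set of \<open>w i\<close>, and those whose support avoids it,
form two disjoint closed sets. They cover the realization because \<open>w\<close> is constant on each simplex.\<close>

lemma connected_triangulation_const:
  fixes w :: "'v::finite \<Rightarrow> real"
  assumes "triangulates T M" "connected_space M"
    and w: "\<And>i j. (i, j) \<in> directed_edges T \<Longrightarrow> w i = w j"
  shows "w i = w j"
proof -
  have T: "abstract_complex T" and hom: "M homeomorphic_space top_of_set (geometric_realization T)"
    using assms(1) by (auto simp: triangulates_def)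
  let ?R = "geometric_realization T"
  have conn: "connected ?R"
    using homeomorphic_connected_space[OF hom] assms(2) by (simp add: connectedin_def flip: connectedin_iff_connected)
  have vertex: "axis v 1 \<in> ?R" for v
  proof -
    have "{u. (axis v 1 :: real^'v) $ u \<noteq> 0} = {v}" by (auto simp: axis_def)
    moreover have "(\<Sum>u\<in>UNIV. (axis v 1 :: real^'v) $ u) = 1" by (simp add: axis_def)
    moreover have "\<forall>u. 0 \<le> (axis v 1 :: real^'v) $ u" by (simp add: axis_def)
    ultimately show ?thesis using T by (auto simp: geometric_realization_def abstract_complex_def)
  qed
  have const: "w u = w v" if "\<sigma> \<in> T" "u \<in> \<sigma>" "v \<in> \<sigma>" for \<sigma> u v
  proof (cases "u = v")
    case False
    have "{u, v} \<subseteq> \<sigma> \<and> {u, v} \<noteq> {}" using that by auto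
    then have "{u, v} \<in> T" using T that(1) unfolding abstract_complex_def by (metis (no_types))
    then show ?thesis using False by (intro w) (auto simp: directed_edges_def edges_def)
  qed simp
  define A where "A = {x :: real^'v. \<forall>v. w v \<noteq> w i \<longrightarrow> x $ v = 0}"
  define B where "B = {x :: real^'v. \<forall>v. w v = w i \<longrightarrow> x $ v = 0}"
  have cl: "closed A" "closed B"
    unfolding A_def B_def by (intro closed_Collect_all closed_Collect_imp closed_Collect_eq
        continuous_intros open_Collect_const)+
  have disj: "A \<inter> B \<inter> ?R = {}"
  proof -
    have False if "x \<in> A" "x \<in> B" "x \<in> ?R" for x
    proof -
      have "x $ v = 0" for v using that by (auto simp: A_def B_def)
      then show False using that(3) by (simp add: geometric_realization_def)
    qed
    then show ?thesis by blast
  qed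
  have cover: "?R \<subseteq> A \<union> B"
  proof
    fix x assume x: "x \<in> ?R"
    then have \<sigma>: "{v. x $ v \<noteq> 0} \<in> T" by (simp add: geometric_realization_def)
    show "x \<in> A \<union> B"
    proof (cases "\<exists>u. x $ u \<noteq> 0 \<and> w u = w i")
      case True
      then obtain u where "x $ u \<noteq> 0" "w u = w i" by blast
      then have "x $ v = 0" if "w v \<noteq> w i" for v
        using const[OF \<sigma>, of u v] that by (cases "x $ v = 0") simp_all
      then have "x \<in> A" by (simp add: A_def)
      then show ?thesis ..
    next
      case False
      then have "x \<in> B" by (auto simp: B_def)
      then show ?thesis ..
    qed
  qed
  have "A \<inter> ?R = {} \<or> B \<inter> ?R = {}"
    by (rule connected_closedD[OF conn disj cover cl])
  moreover have "axis i 1 \<in> A \<inter> ?R" using vertex by (auto simp: A_def axis_def)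
  ultimately have "axis j 1 \<notin> B" using vertex by blast
  then show ?thesis by (auto simp: B_def axis_def split: if_splits)
qed

section \<open>The energy of a sphere packing tetrahedron\<close>

definition sphere_packing_simplex :: "('v \<Rightarrow> 'v \<Rightarrow> real) \<Rightarrow> ('v \<Rightarrow> real) \<Rightarrow> 'v set \<Rightarrow> bool" where
  "sphere_packing_simplex d r \<sigma> \<longleftrightarrow> (\<forall>x\<in>\<sigma>. r x > 0 \<and> (\<forall>y\<in>\<sigma>. x \<noteq> y \<longrightarrow> d x y = r x))"

lemma dual_weight_sphere_packing:
  fixes d :: "'v::finite \<Rightarrow> 'v \<Rightarrow> real"
  assumes m: "metric_simplex d {i, j, k, l}" and dist: "distinct [i, j, k, l]"
    and r: "sphere_packing_simplex d r {i, j, k, l}"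
  shows "dual_weight d i j k l =
    2 * r i * r j * r k * (r j * r k * r l + r i * r k * r l + r i * r j * r l - r i * r j * r k)
     / ((r i + r j) * (r i + r j + r k) * sqrt (gram3 (edge_len d) i j k l))"
proof -
  define a b c e where "a = r i" and "b = r j" and "c = r k" and "e = r l"
  have pos: "a > 0" "b > 0" "c > 0" "e > 0"
    using r by (auto simp: sphere_packing_simplex_def a_def b_def c_def e_def)
  have dv: "d i j = a" "d j i = b" "d i k = a" "d k i = c" "d i l = a" "d l i = e"
    "d j k = b" "d k j = c" "d j l = b" "d l j = e" "d k l = c" "d l k = e"
    using r dist by (auto simp: sphere_packing_simplex_def a_def b_def c_def e_def)
  have L: "edge_len d i j = a + b" "edge_len d i k = a + c" "edge_len d i l = a + e"
    "edge_len d j k = b + c" "edge_len d j l = b + e" "edge_len d k l = c + e"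
    unfolding edge_len_def dv by simp_all
  have ab: "corner_dot (edge_len d) i j k = a\<^sup>2 + a * b + a * c - b * c"
    and ac: "corner_dot (edge_len d) i j l = a\<^sup>2 + a * b + a * e - b * e"
    and bc: "corner_dot (edge_len d) i k l = a\<^sup>2 + a * c + a * e - c * e"
    unfolding corner_dot_def L by (simp_all add: power2_eq_square field_simps)
  have p: "center_dot d i j = (a + b) * a" "center_dot d i k = (a + c) * a" "center_dot d i l = (a + e) * a"
    unfolding center_dot_def L dv by simp_all
  have g2: "gram2 (edge_len d) i j k = 4 * a * b * c * (a + b + c)"
    unfolding gram2_def ab L by (simp add: algebra_simps power2_eq_square)
  have n: "center_dot d i k * (edge_len d i j)\<^sup>2 - center_dot d i j * corner_dot (edge_len d) i j k
      = 2 * a * b * c * (a + b)"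
    unfolding ab L p by (simp add: algebra_simps power2_eq_square)
  have cm: "center_minor d i j k l = 4 * a * b * c * (b * c * e + a * c * e + a * b * e - a * b * c)"
    unfolding center_minor_def mixed_gram_def g2 L corner_dot_edge_len_commute[of d i k j] ab ac bc p
    by (simp add: algebra_simps power2_eq_square)
  define S G where "S = sqrt (gram2 (edge_len d) i j k)" and "G = sqrt (gram3 (edge_len d) i j k l)"
  have ex: "\<exists>p. realizes (edge_len d) {i, j, k, l} p" using m by (auto simp: metric_simplex_def)
  have S: "S > 0" "S * S = 4 * a * b * c * (a + b + c)" "G > 0"
    using pos gram3_pos[OF ex, of i j k l] dist by (auto simp: S_def G_def g2)
  have "height2 d i j k = 2 * a * b * c * (a + b) / ((a + b) * S)"
    using height2_formula[OF m, of i j k] dist n by (auto simp: S_def L)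
  then have h: "height2 d i j k = 2 * a * b * c / S"
    "height3 d i j k l = 4 * a * b * c * (b * c * e + a * c * e + a * b * e - a * b * c) / (G * S)"
    using height3_formula[OF m, of i j k l] dist cm pos by (auto simp: S_def G_def)
  have "dual_weight d i j k l = 2 * a * b * c * (4 * a * b * c * (b * c * e + a * c * e + a * b * e - a * b * c))
      / ((a + b) * G * (S * S))"
    unfolding dual_weight_def h L by (simp add: mult_ac)
  also have "\<dots> = 2 * a * b * c * (b * c * e + a * c * e + a * b * e - a * b * c)
      / ((a + b) * (a + b + c) * G)"
  proof -
    have "2 * a * b * c * (4 * a * b * c * x) / (p * G * (4 * a * b * c * t)) = 2 * a * b * c * x / (p * t * G)"
      for x p t
      using pos by (simp add: mult_ac)
    then show ?thesis unfolding S(2) .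
  qed
  finally show ?thesis unfolding a_def b_def c_def e_def G_def .
qed

lemma gram3_sphere_packing:
  fixes d :: "'v::finite \<Rightarrow> 'v \<Rightarrow> real"
  assumes dist: "distinct [i, j, k, l]" and r: "sphere_packing_simplex d r {i, j, k, l}"
  shows "gram3 (edge_len d) i j k l
    = 4 * (r i * r j * r k * r l)\<^sup>2 * descartes (1 / r i) (1 / r j) (1 / r k) (1 / r l)"
proof -
  define a b c e where "a = r i" and "b = r j" and "c = r k" and "e = r l"
  have pos: "a > 0" "b > 0" "c > 0" "e > 0"
    using r by (auto simp: sphere_packing_simplex_def a_def b_def c_def e_def)
  have dv: "d i j = a" "d j i = b" "d i k = a" "d k i = c" "d i l = a" "d l i = e"
    "d j k = b" "d k j = c" "d j l = b" "d l j = e" "d k l = c" "d l k = e"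
    using r dist by (auto simp: sphere_packing_simplex_def a_def b_def c_def e_def)
  have L: "edge_len d i j = a + b" "edge_len d i k = a + c" "edge_len d i l = a + e"
    "edge_len d j k = b + c" "edge_len d j l = b + e" "edge_len d k l = c + e"
    unfolding edge_len_def dv by simp_all
  have ab: "corner_dot (edge_len d) i j k = a\<^sup>2 + a * b + a * c - b * c"
    and ac: "corner_dot (edge_len d) i j l = a\<^sup>2 + a * b + a * e - b * e"
    and bc: "corner_dot (edge_len d) i k l = a\<^sup>2 + a * c + a * e - c * e"
    unfolding corner_dot_def L by (simp_all add: power2_eq_square field_simps)
  define q where "q = a * b * c * e"
  have q: "q * (1 / a) = b * c * e" "q * (1 / b) = a * c * e" "q * (1 / c) = a * b * e" "q * (1 / e) = a * b * c"
    using pos by (simp_all add: q_def)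
  have "q\<^sup>2 * descartes (1 / a) (1 / b) (1 / c) (1 / e)
     = (q * (1 / a) + q * (1 / b) + q * (1 / c) + q * (1 / e))\<^sup>2
       - 2 * ((q * (1 / a))\<^sup>2 + (q * (1 / b))\<^sup>2 + (q * (1 / c))\<^sup>2 + (q * (1 / e))\<^sup>2)"
    unfolding descartes_def by (simp only: power_mult_distrib distrib_left[symmetric] right_diff_distrib mult.left_commute)
  moreover have "gram3 (edge_len d) i j k l = 4 * ((b * c * e + a * c * e + a * b * e + a * b * c)\<^sup>2
       - 2 * ((b * c * e)\<^sup>2 + (a * c * e)\<^sup>2 + (a * b * e)\<^sup>2 + (a * b * c)\<^sup>2))"
    unfolding gram3_def L ab ac bc by (simp add: algebra_simps power2_eq_square)
  ultimately have "gram3 (edge_len d) i j k l = 4 * (q\<^sup>2 * descartes (1 / a) (1 / b) (1 / c) (1 / e))"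
    unfolding q by (simp only:)
  then show ?thesis
    by (simp only: q_def a_def b_def c_def e_def mult.assoc)
qed

lemma dual_weight_sphere_packing_curvatures:
  fixes d :: "'v::finite \<Rightarrow> 'v \<Rightarrow> real"
  assumes m: "metric_simplex d {i, j, k, l}" and dist: "distinct [i, j, k, l]"
    and r: "sphere_packing_simplex d r {i, j, k, l}"
  shows "dual_weight d i j k l = 2 * (r i * r j * r k * r l) / sqrt (gram3 (edge_len d) i j k l)
    * (1 / r i * (1 / r j) / (1 / r i + 1 / r j)
       * ((1 / r i + 1 / r j + 1 / r k - 1 / r l) / sig3 (1 / r i) (1 / r j) (1 / r k)))"
proof -
  define a b c e where "a = r i" and "b = r j" and "c = r k" and "e = r l"
  have pos: "a > 0" "b > 0" "c > 0" "e > 0"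
    using r by (auto simp: sphere_packing_simplex_def a_def b_def c_def e_def)
  have 1: "1 / a * (1 / b) / (1 / a + 1 / b) = 1 / (a + b)" using pos by (simp add: field_simps)
  have 2: "sig3 (1 / a) (1 / b) (1 / c) = (a + b + c) / (a * b * c)"
    using pos by (simp add: sig3_def field_simps)
  have 3: "1 / a + 1 / b + 1 / c - 1 / e = (b * c * e + a * c * e + a * b * e - a * b * c) / (a * b * c * e)"
    using pos by (simp add: field_simps)
  have "a + b \<noteq> 0" "a + b + c \<noteq> 0" using pos by auto
  then show ?thesis
    unfolding dual_weight_sphere_packing[OF assms] a_def[symmetric] b_def[symmetric] c_def[symmetric] e_def[symmetric]
      1 2 3 using pos by (simp add: mult_ac)
qed

text \<open>The permutations that occur represent the symmetric group modulo exchanging the first two entries: the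
ordered pairs of the remaining two entries are grouped by edge, as in \<open>packing_form\<close>.\<close>

lemma sum_tet_tuples_symmetrize:
  fixes F :: "'v::finite \<Rightarrow> 'v \<Rightarrow> 'v \<Rightarrow> 'v \<Rightarrow> real"
  shows "12 * (\<Sum>(i, j, k, l)\<in>tet_tuples T. F i j k l)
    = (\<Sum>(i, j, k, l)\<in>tet_tuples T.
         (F i j k l + F i j l k) + (F i k j l + F i k l j) + (F i l j k + F i l k j)
       + (F j k i l + F j k l i) + (F j l i k + F j l k i) + (F k l i j + F k l j i))"
proof -
  let ?S = "\<lambda>F. (\<Sum>(i, j, k, l)\<in>tet_tuples T. F i j k l) :: real"
  note r = sum_tet_tuples_rotate[of _ T] and c = sum_tet_tuples_cycle[of _ T]
    and s12 = sum_tet_tuples_swap12[of _ T] and s34 = sum_tet_tuples_swap34[of _ T]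
  have 2: "?S (\<lambda>i j k l. G i j l k) = ?S G" for G by (rule s34)
  have 3: "?S (\<lambda>i j k l. G i k j l) = ?S G" for G
    using s12[of "\<lambda>i j k l. G j k i l"] r[of G] by simp
  have 4: "?S (\<lambda>i j k l. G i k l j) = ?S G" for G
    using 3[of "\<lambda>i j k l. G i j l k"] 2[of G] by simp
  have 5: "?S (\<lambda>i j k l. G i l j k) = ?S G" for G
    using 2[of "\<lambda>i j k l. G i k j l"] 3[of G] by simp
  have 6: "?S (\<lambda>i j k l. G i l k j) = ?S G" for G
    using 2[of "\<lambda>i j k l. G i k l j"] 4[of G] by simp
  have 7: "?S (\<lambda>i j k l. G j k i l) = ?S G" for G by (rule r)
  have 8: "?S (\<lambda>i j k l. G j k l i) = ?S G" for G by (rule c)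
  have 9: "?S (\<lambda>i j k l. G j l i k) = ?S G" for G
    using 2[of "\<lambda>i j k l. G j k i l"] 7[of G] by simp
  have 10: "?S (\<lambda>i j k l. G j l k i) = ?S G" for G
    using 2[of "\<lambda>i j k l. G j k l i"] 8[of G] by simp
  have 11: "?S (\<lambda>i j k l. G k l i j) = ?S G" for G
    using 8[of "\<lambda>i j k l. G j k l i"] 8[of G] by simp
  have 12: "?S (\<lambda>i j k l. G k l j i) = ?S G" for G
    using 11[of "\<lambda>i j k l. G i j l k"] 2[of G] by simp
  have add: "?S (\<lambda>i j k l. G i j k l + H i j k l) = ?S G + ?S H" for G H
    by (simp add: case_prod_unfold sum.distrib)
  show ?thesis
    by (simp only: add 2[of F] 3[of F] 4[of F] 5[of F] 6[of F] 7[of F] 8[of F] 9[of F] 10[of F]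
        11[of F] 12[of F])
qed

text \<open>The sum over the edges is a positive multiple of \<open>packing_form\<close> in the curvatures \<open>1 / r\<close>.\<close>

lemma tet_energy_sphere_packing:
  fixes d :: "'v::finite \<Rightarrow> 'v \<Rightarrow> real" and w :: "'v \<Rightarrow> real"
  assumes m: "metric_simplex d {i, j, k, l}" and dist: "distinct [i, j, k, l]"
    and r: "sphere_packing_simplex d r {i, j, k, l}"
  defines "F \<equiv> \<lambda>i j k l. dual_weight d i j k l * (w i - w j)\<^sup>2"
  defines "E \<equiv> (F i j k l + F i j l k) + (F i k j l + F i k l j) + (F i l j k + F i l k j)
       + (F j k i l + F j k l i) + (F j l i k + F j l k i) + (F k l i j + F k l j i)"
  shows "E \<ge> 0" and "\<not> (w i = w j \<and> w j = w k \<and> w k = w l) \<Longrightarrow> E > 0"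
proof -
  have ex: "\<exists>p. realizes (edge_len d) {i, j, k, l} p" using m by (auto simp: metric_simplex_def)
  define G where "G = gram3 (edge_len d) i j k l"
  have G: "G > 0" using gram3_pos[OF ex, of i j k l] dist by (auto simp: G_def)
  define q where "q = 2 * (r i * r j * r k * r l) / sqrt G"
  have rp: "r i > 0" "r j > 0" "r k > 0" "r l > 0" using r by (auto simp: sphere_packing_simplex_def)
  then have q: "q > 0" using G by (simp add: q_def)
  have face: "F x y z t = q * (1 / r x * (1 / r y) / (1 / r x + 1 / r y)
       * ((1 / r x + 1 / r y + 1 / r z - 1 / r t) / sig3 (1 / r x) (1 / r y) (1 / r z))) * (w x - w y)\<^sup>2"
    if "{x, y, z, t} = {i, j, k, l}" "distinct [x, y, z, t]"
      "gram3 (edge_len d) x y z t = G" "r x * r y * r z * r t = r i * r j * r k * r l" for x y z t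
    using dual_weight_sphere_packing_curvatures[of d x y z t r] that m r
    by (simp add: F_def q_def)
  have edge: "F x y z t + F x y t z = q * (edge_weight (1 / r x) (1 / r y) (1 / r z) (1 / r t)
      * ((w x - w y) * (w x - w y)))"
    if p: "{x, y, z, t} = {i, j, k, l}" "distinct [x, y, z, t]"
      "gram3 (edge_len d) x y z t = G" "r x * r y * r z * r t = r i * r j * r k * r l" for x y z t
  proof -
    have "{x, y, t, z} = {x, y, z, t}" "distinct [x, y, t, z]" using p(2) by auto
    then have 2: "{x, y, t, z} = {i, j, k, l}" "distinct [x, y, t, z]"
      "gram3 (edge_len d) x y t z = G" "r x * r y * r t * r z = r i * r j * r k * r l"
      using p(1) p(2) p(3) p(4)[symmetric] by (simp_all add: gram3_swap34[of d x y t z])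
    show ?thesis
      unfolding face[OF p] face[OF 2] edge_weight_def by (simp add: power2_eq_square algebra_simps)
  qed
  have g: "gram3 (edge_len d) i k j l = G" "gram3 (edge_len d) i l j k = G"
    "gram3 (edge_len d) j k i l = G" "gram3 (edge_len d) j l i k = G" "gram3 (edge_len d) k l i j = G"
  proof -
    show 1: "gram3 (edge_len d) i k j l = G" by (simp add: G_def gram3_swap23[of d i k j l])
    have a: "gram3 (edge_len d) i j l k = G" by (simp add: G_def gram3_swap34[of d i j l k])
    then show 2: "gram3 (edge_len d) i l j k = G" by (simp add: gram3_swap23[of d i l j k])
    have b: "gram3 (edge_len d) j i k l = G" by (simp add: G_def gram3_swap12[of d j i k l])
    then show "gram3 (edge_len d) j k i l = G" by (simp add: gram3_swap23[of d j k i l])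
    have "gram3 (edge_len d) j i l k = G" using a by (simp add: gram3_swap12[of d j i l k])
    then show "gram3 (edge_len d) j l i k = G" by (simp add: gram3_swap23[of d j l i k])
    have "gram3 (edge_len d) i k l j = G" using 1 by (simp add: gram3_swap34[of d i k l j])
    then have "gram3 (edge_len d) k i l j = G" by (simp add: gram3_swap12[of d k i l j])
    then show "gram3 (edge_len d) k l i j = G" by (simp add: gram3_swap23[of d k l i j])
  qed
  have "E = q * packing_form (1 / r i) (1 / r j) (1 / r k) (1 / r l) (w i) (w j) (w k) (w l)
      (w i) (w j) (w k) (w l)"
  proof -
    have d: "distinct [i, k, j, l]" "distinct [i, l, j, k]" "distinct [j, k, i, l]"
      "distinct [j, l, i, k]" "distinct [k, l, i, j]" using dist by auto
    have s: "{i, k, j, l} = {i, j, k, l}" "{i, l, j, k} = {i, j, k, l}" "{j, k, i, l} = {i, j, k, l}"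
      "{j, l, i, k} = {i, j, k, l}" "{k, l, i, j} = {i, j, k, l}" by blast+
    note e = edge[OF refl dist G_def[symmetric] refl] edge[OF s(1) d(1) g(1)] edge[OF s(2) d(2) g(2)]
      edge[OF s(3) d(3) g(3)] edge[OF s(4) d(4) g(4)] edge[OF s(5) d(5) g(5)]
    show ?thesis unfolding E_def packing_form_def
      using e by (simp add: distrib_left mult.commute mult.left_commute)
  qed
  moreover have "descartes (1 / r i) (1 / r j) (1 / r k) (1 / r l) > 0"
    using G gram3_sphere_packing[OF dist r] rp unfolding G_def
    by (simp add: zero_less_mult_iff)
  ultimately have pos: "\<not> (w i = w j \<and> w j = w k \<and> w k = w l) \<Longrightarrow> E > 0"
    using packing_form_pos[of "1 / r i" "1 / r j" "1 / r k" "1 / r l" "w i" "w j" "w k" "w l"] rp q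
    by simp
  then show "\<not> (w i = w j \<and> w j = w k \<and> w k = w l) \<Longrightarrow> E > 0" .
  show "E \<ge> 0"
  proof (cases "w i = w j \<and> w j = w k \<and> w k = w l")
    case True
    then show ?thesis unfolding E_def F_def by simp
  next
    case False
    then show ?thesis using pos by simp
  qed
qed

section \<open>Continuously differentiable functions\<close>

abbreviation C1_on :: "'a::euclidean_space set \<Rightarrow> ('a \<Rightarrow> real) \<Rightarrow> bool" where
  "C1_on S g \<equiv> Ck_on (Suc 0) S g"

lemma C1_onI:
  assumes "\<And>x. x \<in> S \<Longrightarrow> (g has_derivative g' x) (at x)" "\<And>v. continuous_on S (\<lambda>x. g' x v)"
  shows "C1_on S g"
proof -
  have "frechet_derivative g (at x) = g' x" if "x \<in> S" for x
    using frechet_derivative_at[OF assms(1)[OF that]] by simp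
  then have "continuous_on S (\<lambda>x. frechet_derivative g (at x) v)" for v
    using assms(2)[of v] by (simp cong: continuous_on_cong)
  then show ?thesis using assms(1) by (auto simp: differentiable_def)
qed

lemma C1_on_has_derivative:
  assumes "C1_on S g" "x \<in> S"
  shows "(g has_derivative frechet_derivative g (at x)) (at x)"
  using assms frechet_derivative_works by fastforce

lemma C1_on_continuous_derivative:
  "C1_on S g \<Longrightarrow> continuous_on S (\<lambda>x. frechet_derivative g (at x) v)"
  by simp

lemma C1_on_continuous: "C1_on S g \<Longrightarrow> continuous_on S g"
  by (meson C1_on_has_derivative continuous_at_imp_continuous_on has_derivative_continuous)

lemma C1_on_const: "C1_on S (\<lambda>x. c)"
  by (rule C1_onI[where g' = "\<lambda>x v. 0"]) (auto intro: continuous_intros)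

lemma C1_on_add:
  assumes "C1_on S g" "C1_on S h" shows "C1_on S (\<lambda>x. g x + h x)"
  by (rule C1_onI[OF has_derivative_add[OF C1_on_has_derivative[OF assms(1)] C1_on_has_derivative[OF assms(2)]]])
    (auto intro!: continuous_intros C1_on_continuous_derivative assms simp del: Ck_on.simps)

lemma C1_on_diff:
  assumes "C1_on S g" "C1_on S h" shows "C1_on S (\<lambda>x. g x - h x)"
  by (rule C1_onI[OF has_derivative_diff[OF C1_on_has_derivative[OF assms(1)] C1_on_has_derivative[OF assms(2)]]])
    (auto intro!: continuous_intros C1_on_continuous_derivative assms simp del: Ck_on.simps)

lemma C1_on_mult:
  assumes "C1_on S g" "C1_on S h" shows "C1_on S (\<lambda>x. g x * h x)"
  by (rule C1_onI[OF has_derivative_mult[OF C1_on_has_derivative[OF assms(1)] C1_on_has_derivative[OF assms(2)]]])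
    (auto intro!: continuous_intros C1_on_continuous_derivative C1_on_continuous[OF assms(1)]
       C1_on_continuous[OF assms(2)] assms simp del: Ck_on.simps)

lemma C1_on_power2: "C1_on S g \<Longrightarrow> C1_on S (\<lambda>x. (g x)\<^sup>2)"
  unfolding power2_eq_square by (rule C1_on_mult)

lemma C1_on_sum:
  "(\<And>a. a \<in> A \<Longrightarrow> C1_on S (g a)) \<Longrightarrow> C1_on S (\<lambda>x. \<Sum>a\<in>A. g a x)"
proof (induction A rule: infinite_finite_induct)
  case (insert a A)
  then show ?case by (simp add: C1_on_add del: Ck_on.simps)
qed (simp_all add: C1_on_const del: Ck_on.simps)

lemma C1_on_compose:
  assumes g: "C1_on S g" and h: "\<And>x. x \<in> S \<Longrightarrow> (h has_real_derivative h' (g x)) (at (g x))"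
    and c: "continuous_on S (\<lambda>x. h' (g x))"
  shows "C1_on S (\<lambda>x. h (g x))"
proof (rule C1_onI)
  fix x assume x: "x \<in> S"
  show "((\<lambda>x. h (g x)) has_derivative (\<lambda>v. h' (g x) * frechet_derivative g (at x) v)) (at x)"
    using has_derivative_compose[OF C1_on_has_derivative[OF g x], of h "(*) (h' (g x))"] h[OF x]
    by (simp add: has_field_derivative_def)
next
  fix v show "continuous_on S (\<lambda>x. h' (g x) * frechet_derivative g (at x) v)"
    by (intro continuous_on_mult c C1_on_continuous_derivative g)
qed

lemma C1_on_sqrt:
  assumes "C1_on S g" "\<And>x. x \<in> S \<Longrightarrow> g x > 0" shows "C1_on S (\<lambda>x. sqrt (g x))"
proof (rule C1_on_compose[OF assms(1), where h' = "\<lambda>y. inverse (sqrt y) / 2"])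
  show "(sqrt has_real_derivative inverse (sqrt (g x)) / 2) (at (g x))" if "x \<in> S" for x
    using assms(2)[OF that] by (rule DERIV_real_sqrt)
  show "continuous_on S (\<lambda>x. inverse (sqrt (g x)) / 2)"
    using assms(2) by (force intro!: continuous_intros C1_on_continuous[OF assms(1)])
qed

lemma C1_on_divide:
  assumes "C1_on S g" "C1_on S h" "\<And>x. x \<in> S \<Longrightarrow> h x \<noteq> 0"
  shows "C1_on S (\<lambda>x. g x / h x)"
proof -
  have "C1_on S (\<lambda>x. inverse (h x))"
  proof (rule C1_on_compose[OF assms(2), where h' = "\<lambda>y. - inverse (y\<^sup>2)"])
    show "(inverse has_real_derivative - inverse ((h x)\<^sup>2)) (at (h x))" if "x \<in> S" for x
      using DERIV_inverse[OF assms(3)[OF that]] by (simp add: numeral_2_eq_2)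
    show "continuous_on S (\<lambda>x. - inverse ((h x)\<^sup>2))"
      using assms(3) by (auto intro!: continuous_intros C1_on_continuous[OF assms(2)])
  qed
  then show ?thesis using C1_on_mult[OF assms(1)] by (simp only: divide_inverse)
qed

lemma C1_on_arccos:
  assumes "C1_on S g" "\<And>x. x \<in> S \<Longrightarrow> -1 < g x \<and> g x < 1" shows "C1_on S (\<lambda>x. arccos (g x))"
proof (rule C1_on_compose[OF assms(1), where h' = "\<lambda>y. inverse (- sqrt (1 - y\<^sup>2))"])
  show "(arccos has_real_derivative inverse (- sqrt (1 - (g x)\<^sup>2))) (at (g x))" if "x \<in> S" for x
    using assms(2)[OF that] by (intro DERIV_arccos) auto
  have "sqrt (1 - (g x)\<^sup>2) \<noteq> 0" if "x \<in> S" for x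
    using assms(2)[OF that] by (auto simp: power2_eq_1_iff)
  then show "continuous_on S (\<lambda>x. inverse (- sqrt (1 - (g x)\<^sup>2)))"
    by (intro continuous_intros C1_on_continuous[OF assms(1)]) auto
qed

lemma C1_on_line_derivative:
  assumes "C1_on S g" "y + t *\<^sub>R w \<in> S"
  shows "((\<lambda>t. g (y + t *\<^sub>R w)) has_real_derivative frechet_derivative g (at (y + t *\<^sub>R w)) w) (at t)"
proof -
  have d: "(g has_derivative frechet_derivative g (at (y + t *\<^sub>R w))) (at (y + t *\<^sub>R w))"
    by (rule C1_on_has_derivative[OF assms])
  have l: "((\<lambda>t. y + t *\<^sub>R w) has_derivative (\<lambda>s. s *\<^sub>R w)) (at t)"
    by (auto intro!: derivative_eq_intros)
  have "((\<lambda>t. g (y + t *\<^sub>R w)) has_derivative (\<lambda>s. frechet_derivative g (at (y + t *\<^sub>R w)) (s *\<^sub>R w))) (at t)"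
    by (rule has_derivative_compose[OF l d])
  moreover have "frechet_derivative g (at (y + t *\<^sub>R w)) (s *\<^sub>R w)
      = frechet_derivative g (at (y + t *\<^sub>R w)) w * s" for s
    using linear_cmul[OF has_derivative_linear[OF d]] by simp
  ultimately show ?thesis by (simp add: has_field_derivative_def)
qed

section \<open>Maps with positive definite Jacobian\<close>

lemma frechet_derivative_axis_expansion:
  fixes g :: "real^'v::finite \<Rightarrow> real"
  assumes "C1_on S g" "x \<in> S"
  shows "frechet_derivative g (at x) w = (\<Sum>j\<in>UNIV. w $ j * frechet_derivative g (at x) (axis j 1))"
proof -
  have lin: "linear (frechet_derivative g (at x))"
    using C1_on_has_derivative[OF assms] by (rule has_derivative_linear)
  have "frechet_derivative g (at x) w = frechet_derivative g (at x) (\<Sum>j\<in>UNIV. w $ j *\<^sub>R axis j 1)"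
    by (simp add: basis_expansion flip: scalar_mult_eq_scaleR)
  then show ?thesis by (simp add: linear_sum[OF lin] linear_cmul[OF lin])
qed

text \<open>The Jacobian form stays positive on nonzero sums-to-zero vectors near \<open>x0\<close>, by compactness of the unit
sphere. Along a segment with direction \<open>v\<close>, the derivative of \<open>\<Sum>i. v\<^sub>i K\<^sub>i\<close> is this form at \<open>v\<close>; it would be positive,
contradicting equal values of \<open>K\<close> at the ends.\<close>

lemma locally_injective_of_pos_def_jacobian:
  fixes K :: "'v::finite \<Rightarrow> real^'v \<Rightarrow> real"
  assumes U: "open U" "x0 \<in> U" and K: "\<And>i. C1_on U (K i)"
    and pos: "\<And>w. \<exists>i j. w $ i \<noteq> w $ j \<Longrightarrow>
       (\<Sum>i\<in>UNIV. w $ i * frechet_derivative (K i) (at x0) w) > 0"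
  obtains \<rho> where "\<rho> > 0" "ball x0 \<rho> \<subseteq> U"
    "\<And>y z. y \<in> ball x0 \<rho> \<Longrightarrow> z \<in> ball x0 \<rho> \<Longrightarrow> (\<Sum>i\<in>UNIV. (z - y) $ i) = 0 \<Longrightarrow>
       (\<And>i. K i y = K i z) \<Longrightarrow> y = z"
proof -
  define a where "a = (\<lambda>i j x. frechet_derivative (K i) (at x) (axis j 1))"
  define q where "q = (\<lambda>x w. \<Sum>i\<in>UNIV. \<Sum>j\<in>UNIV. a i j x * (w $ i * w $ j))"
  have q: "(\<Sum>i\<in>UNIV. w $ i * frechet_derivative (K i) (at x) w) = q x w" if "x \<in> U" for x w
    unfolding q_def a_def frechet_derivative_axis_expansion[OF K that, of _ w]
    by (simp add: sum_distrib_left mult_ac)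
  define W where "W = sphere (0::real^'v) 1 \<inter> {w. (\<Sum>i\<in>UNIV. w $ i) = 0}"
  have W: "compact W"
    unfolding W_def by (intro compact_Int_closed closed_Collect_eq continuous_intros) auto
  have contq: "continuous_on W (q x0)" unfolding q_def by (intro continuous_intros)
  have qpos: "q x0 w > 0" if "w \<in> W" for w
  proof -
    have "\<exists>i j. w $ i \<noteq> w $ j"
    proof (rule ccontr)
      assume "\<nexists>i j. w $ i \<noteq> w $ j"
      then obtain c where c: "\<And>i. w $ i = c" by metis
      have "real CARD('v) * c = 0" using that c by (simp add: W_def)
      then have "w = 0" using c by (simp add: vec_eq_iff)
      then show False using that by (simp add: W_def)
    qed
    then show ?thesis using pos q[OF U(2)] by simp
  qed
  obtain m where m: "m > 0" "\<And>w. w \<in> W \<Longrightarrow> m \<le> q x0 w"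
  proof (cases "W = {}")
    case True
    then show ?thesis using that[of 1] by simp
  next
    case False
    then obtain u where "u \<in> W" "\<And>w. w \<in> W \<Longrightarrow> q x0 u \<le> q x0 w"
      using continuous_attains_inf[OF W _ contq] by metis
    then show ?thesis using that qpos by blast
  qed
  \<comment> \<open>bounds the change of the form on the unit sphere, where all coordinates are at most \<open>1\<close>\<close>
  define D where "D = (\<lambda>x. \<Sum>i\<in>UNIV. \<Sum>j\<in>UNIV. \<bar>a i j x - a i j x0\<bar>)"
  have "continuous_on U D"
    unfolding D_def a_def by (intro continuous_intros C1_on_continuous_derivative K)
  then have "isCont D x0" using U by (simp add: continuous_on_eq_continuous_at)
  moreover have "D x0 = 0" by (simp add: D_def)
  ultimately obtain r where r: "r > 0" "\<And>x. dist x x0 < r \<Longrightarrow> \<bar>D x\<bar> < m"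
    using m(1) unfolding continuous_at_eps_delta by (metis diff_zero dist_real_def)
  obtain r' where r': "r' > 0" "ball x0 r' \<subseteq> U" using U open_contains_ball by blast
  define \<rho> where "\<rho> = min r r'"
  have ball: "\<rho> > 0" "ball x0 \<rho> \<subseteq> U" using r r' by (auto simp: \<rho>_def)
  have qW: "q x w > 0" if x: "x \<in> ball x0 \<rho>" and w: "w \<in> W" for x w
  proof -
    have le1: "\<bar>w $ i\<bar> \<le> 1" for i
      using component_le_norm_cart[of w i] w by (simp add: W_def)
    have "\<bar>q x w - q x0 w\<bar> = \<bar>\<Sum>i\<in>UNIV. \<Sum>j\<in>UNIV. (a i j x - a i j x0) * (w $ i * w $ j)\<bar>"
      by (simp add: q_def sum_subtractf left_diff_distrib)
    also have "\<dots> \<le> (\<Sum>i\<in>UNIV. \<Sum>j\<in>UNIV. \<bar>(a i j x - a i j x0) * (w $ i * w $ j)\<bar>)"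
      by (intro order_trans[OF sum_abs] sum_mono sum_abs)
    also have "\<dots> \<le> D x" unfolding D_def
    proof (intro sum_mono)
      fix i j :: 'v
      have "\<bar>w $ i\<bar> * \<bar>w $ j\<bar> \<le> 1" using le1[of i] le1[of j] by (simp add: mult_le_one)
      then show "\<bar>(a i j x - a i j x0) * (w $ i * w $ j)\<bar> \<le> \<bar>a i j x - a i j x0\<bar>"
        by (simp add: abs_mult mult_left_le)
    qed
    also have "D x < m" using r(2)[of x] x by (simp add: \<rho>_def dist_commute)
    finally show ?thesis using m(2)[OF w] by linarith
  qed
  show thesis
  proof (rule that[OF ball])
    fix y z :: "real^'v"
    assume y: "y \<in> ball x0 \<rho>" and z: "z \<in> ball x0 \<rho>" and s: "(\<Sum>i\<in>UNIV. (z - y) $ i) = 0"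
      and eq: "\<And>i. K i y = K i z"
    show "y = z"
    proof (rule ccontr)
      assume "y \<noteq> z"
      define v where "v = z - y"
      have v: "v \<noteq> 0" using \<open>y \<noteq> z\<close> by (simp add: v_def)
      have "(\<Sum>i\<in>UNIV. sgn v $ i) = (\<Sum>i\<in>UNIV. v $ i) / norm v"
        by (simp add: sgn_div_norm sum_distrib_left divide_inverse mult.commute)
      then have sW: "sgn v \<in> W" using s v by (simp add: W_def v_def norm_sgn)
      define g where "g = (\<lambda>\<tau>. \<Sum>i\<in>UNIV. v $ i * K i (y + \<tau> *\<^sub>R v))"
      have "g 0 < g 1"
      proof (rule DERIV_pos_imp_increasing[of 0 1])
        fix \<tau> :: real assume \<tau>: "0 \<le> \<tau>" "\<tau> \<le> 1"
        have "y + \<tau> *\<^sub>R v = (1 - \<tau>) *\<^sub>R y + \<tau> *\<^sub>R z" by (simp add: v_def algebra_simps)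
        also have "\<dots> \<in> ball x0 \<rho>" using \<tau> y z by (intro convexD[OF convex_ball]) auto
        finally have b: "y + \<tau> *\<^sub>R v \<in> ball x0 \<rho>" .
        then have bU: "y + \<tau> *\<^sub>R v \<in> U" using ball by blast
        have "(g has_real_derivative (\<Sum>i\<in>UNIV. v $ i * frechet_derivative (K i) (at (y + \<tau> *\<^sub>R v)) v)) (at \<tau>)"
          unfolding g_def by (intro DERIV_sum DERIV_cmult C1_on_line_derivative[OF K bU])
        moreover have "(\<Sum>i\<in>UNIV. v $ i * frechet_derivative (K i) (at (y + \<tau> *\<^sub>R v)) v)
            = q (y + \<tau> *\<^sub>R v) (norm v *\<^sub>R sgn v)"
          unfolding q[OF bU] by (simp add: sgn_div_norm v)
        moreover have "\<dots> = (norm v)\<^sup>2 * q (y + \<tau> *\<^sub>R v) (sgn v)"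
          unfolding q_def by (simp add: sum_distrib_left power2_eq_square mult_ac)
        moreover have "\<dots> > 0" using qW[OF b sW] v by simp
        ultimately show "\<exists>d. (g has_real_derivative d) (at \<tau>) \<and> 0 < d" by metis
      qed simp
      moreover have "g 0 = g 1" using eq by (simp add: g_def v_def)
      ultimately show False by simp
    qed
  qed
qed

section \<open>Angles and dual lengths depend only on the directed edges\<close>

lemma realization_cong:
  assumes "\<And>x y. x \<in> \<sigma> \<Longrightarrow> y \<in> \<sigma> \<Longrightarrow> x \<noteq> y \<Longrightarrow> L x y = L' x y"
  shows "realization L \<sigma> = realization L' \<sigma>"
proof -
  have "realizes L \<sigma> = realizes L' \<sigma>"
    using assms by (auto simp: realizes_def fun_eq_iff)
  then show ?thesis by (simp add: realization_def)
qed

lemma dual_area_cong: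
  assumes d: "\<And>x y. x \<in> {i, j, k, l} \<Longrightarrow> y \<in> {i, j, k, l} \<Longrightarrow> x \<noteq> y \<Longrightarrow> d x y = d' x y"
    and dist: "distinct [i, j, k, l]"
  shows "dual_area d i j k l = dual_area d' i j k l"
proof -
  have L: "edge_len d x y = edge_len d' x y"
    if "x \<in> {i, j, k, l}" "y \<in> {i, j, k, l}" "x \<noteq> y" for x y
    using d[OF that] d[OF that(2,1)] that(3) by (simp add: edge_len_def)
  have h2: "height2 d i j x = height2 d' i j x" if "x \<in> {k, l}" for x
  proof -
    have "realization (edge_len d) {i, j, x} = realization (edge_len d') {i, j, x}"
      by (rule realization_cong, rule L) (use that in auto)
    then have "tri_angle (edge_len d) i j x = tri_angle (edge_len d') i j x"
      by (simp add: tri_angle_def)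
    moreover have "d i j = d' i j" "d i x = d' i x" using d that dist by auto
    ultimately show ?thesis by (simp add: height2_def)
  qed
  have "realization (edge_len d) {i, j, k, l} = realization (edge_len d') {i, j, k, l}"
    by (rule realization_cong, rule L)
  then have a: "dihedral_angle (edge_len d) i j k l = dihedral_angle (edge_len d') i j k l"
    by (simp add: dihedral_angle_def)
  then have "height3 d i j k l = height3 d' i j k l" "height3 d i j l k = height3 d' i j l k"
    using h2 by (simp_all add: height3_def dihedral_angle_commute[of _ i j l k])
  then show ?thesis using h2 by (simp add: dual_area_def)
qed

lemma edge_in_complex:
  assumes "abstract_complex T" "\<sigma> \<in> T" "x \<in> \<sigma>" "y \<in> \<sigma>" "x \<noteq> y"
  shows "(x, y) \<in> directed_edges T"
proof -
  have "{x, y} \<subseteq> \<sigma>" "{x, y} \<noteq> {}" using assms by auto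
  then have "{x, y} \<in> T" using assms(1,2) unfolding abstract_complex_def by (metis (no_types))
  then show ?thesis using assms(5) by (simp add: directed_edges_def edges_def)
qed

lemma dual_length_cong:
  assumes T: "abstract_complex T" and d: "eq_on_directed_edges T d d'"
  shows "dual_length T d i j = dual_length T d' i j"
proof -
  have "dual_area d i j k l = dual_area d' i j k l" if t: "{i, j, k, l} \<in> T" "card {i, j, k, l} = 4" for k l
  proof (rule dual_area_cong)
    show "d x y = d' x y" if "x \<in> {i, j, k, l}" "y \<in> {i, j, k, l}" "x \<noteq> y" for x y
      using edge_in_complex[OF T t(1) that] d by (auto simp: eq_on_directed_edges_def)
    show "distinct [i, j, k, l]" using t(2) by (simp only: card4_iff)
  qed
  then show ?thesis
    unfolding dual_length_def tetrahedra_sum_def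
    by (intro arg_cong2[where f = "(/)"] sum.cong refl) auto
qed

section \<open>Energy of a Ricci flat metric\<close>

lemma metric_simplex_of_pf_metric:
  assumes T: "abstract_complex T" and d: "pf_metric T d" and \<sigma>: "\<sigma> \<in> T"
  shows "metric_simplex d \<sigma>"
  unfolding metric_simplex_def
proof (intro conjI ballI)
  show "\<exists>p. realizes (edge_len d) \<sigma> p"
    using d \<sigma> by (simp add: pf_metric_def piecewise_flat_def)
  fix i j k assume ijk: "i \<in> \<sigma>" "j \<in> \<sigma>" "k \<in> \<sigma>"
  show "(d i j)\<^sup>2 + (d j k)\<^sup>2 + (d k i)\<^sup>2 = (d j i)\<^sup>2 + (d i k)\<^sup>2 + (d k j)\<^sup>2"
  proof (cases "distinct [i, j, k]")
    case True
    have "{i, j, k} \<subseteq> \<sigma>" "{i, j, k} \<noteq> {}" using ijk by auto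
    then have "{i, j, k} \<in> T" using T \<sigma> unfolding abstract_complex_def by (metis (no_types))
    moreover have "card {i, j, k} = 3" using True by simp
    ultimately show ?thesis using d unfolding pf_metric_def by blast
  next
    case False
    then show ?thesis by auto
  qed
qed

lemma edge_len_pos:
  assumes "abstract_complex T" "pf_metric T d" "(i, j) \<in> directed_edges T"
  shows "edge_len d i j > 0"
proof -
  have e: "{i, j} \<in> T" "i \<noteq> j"
    using assms(3) by (auto simp: directed_edges_def edges_def card_2_iff doubleton_eq_iff)
  obtain p where p: "realizes (edge_len d) {i, j} p"
    using metric_simplex_of_pf_metric[OF assms(1,2) e(1)] by (auto simp: metric_simplex_def)
  then have "p i \<noteq> p j" "dist (p i) (p j) = edge_len d i j" using e(2)
    by (auto simp: realizes_def)
  then show ?thesis by (metis dist_pos_lt)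
qed

text \<open>The cone defect with the dihedral angles expressed through the lengths; in contrast to a chosen
realization, this is manifestly a differentiable function of the lengths of nondegenerate tetrahedra.\<close>

definition angle_defect :: "'v::finite set set \<Rightarrow> ('v \<Rightarrow> 'v \<Rightarrow> real) \<Rightarrow> 'v \<Rightarrow> 'v \<Rightarrow> real" where
  "angle_defect T L i j = 2 * pi - tetrahedra_sum T i j (\<lambda>k l. arccos (dihedral_cos L i j k l))"

lemma cone_defect_eq_angle_defect:
  assumes "piecewise_flat T L"
  shows "cone_defect T L i j = angle_defect T L i j"
proof -
  have "dihedral_angle L i j k l = arccos (dihedral_cos L i j k l)"
    if "{i, j, k, l} \<in> T" "card {i, j, k, l} = 4" for k l
  proof -
    have "distinct [i, j, k, l]" using that(2) by (simp only: card4_iff)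
    moreover have "\<exists>p. realizes L {i, j, k, l} p" using assms that(1) by (simp add: piecewise_flat_def)
    ultimately show ?thesis unfolding dihedral_cos_def by (intro dihedral_angle_realizable)
  qed
  then show ?thesis
    unfolding cone_defect_def angle_defect_def tetrahedra_sum_def
    by (intro arg_cong2[where f = "(-)"] arg_cong2[where f = "(/)"] sum.cong refl) auto
qed

lemma dihedral_cos_scale:
  assumes c: "c > 0" and dist: "distinct [i, j, k, l]"
    and L: "\<And>x y. x \<in> {i, j, k, l} \<Longrightarrow> y \<in> {i, j, k, l} \<Longrightarrow> x \<noteq> y \<Longrightarrow> L' x y = c * L x y"
  shows "dihedral_cos L' i j k l = dihedral_cos L i j k l"
proof -
  have e: "L' i j = c * L i j" "L' i k = c * L i k" "L' i l = c * L i l" "L' j k = c * L j k"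
    "L' j l = c * L j l" "L' k l = c * L k l" using L dist by auto
  have d: "corner_dot L' i j k = c\<^sup>2 * corner_dot L i j k" "corner_dot L' i j l = c\<^sup>2 * corner_dot L i j l"
    "corner_dot L' i k l = c\<^sup>2 * corner_dot L i k l"
    unfolding corner_dot_def e by (simp_all add: power_mult_distrib algebra_simps)
  have g: "gram2 L' i j k = (c\<^sup>2)\<^sup>2 * gram2 L i j k" "gram2 L' i j l = (c\<^sup>2)\<^sup>2 * gram2 L i j l"
    "mixed_gram L' i j k l = (c\<^sup>2 * c\<^sup>2) * mixed_gram L i j k l"
    unfolding gram2_def mixed_gram_def d e by (simp_all add: power_mult_distrib algebra_simps power2_eq_square)
  have s: "sqrt ((c\<^sup>2)\<^sup>2 * x) = c\<^sup>2 * sqrt x" for x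
    by (simp only: real_sqrt_mult real_sqrt_abs) simp
  have "(p * p * m) / ((p * x) * (p * y)) = m / (x * y)" if "p \<noteq> 0" for p m x y :: real
    using that by simp
  from this[of "c\<^sup>2"] show ?thesis unfolding dihedral_cos_def g s using c by simp
qed

lemma angle_defect_scale:
  assumes T: "abstract_complex T" and c: "c > 0"
    and L: "\<And>x y. (x, y) \<in> directed_edges T \<Longrightarrow> L' x y = c * L x y"
  shows "angle_defect T L' i j = angle_defect T L i j"
proof -
  have "dihedral_cos L' i j k l = dihedral_cos L i j k l"
    if t: "{i, j, k, l} \<in> T" "card {i, j, k, l} = 4" for k l
  proof (rule dihedral_cos_scale[OF c])
    show "distinct [i, j, k, l]" using t(2) by (simp only: card4_iff)
  qed (rule L[OF edge_in_complex[OF T t(1)]])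
  then show ?thesis
    unfolding angle_defect_def tetrahedra_sum_def
    by (intro arg_cong2[where f = "(-)"] arg_cong2[where f = "(/)"] sum.cong refl) auto
qed

text \<open>By connectedness some edge has different values of \<open>w\<close> at its ends, and it suffices that this edge
contributes. If the dual lengths are positive, all terms are nonnegative
once they are grouped by edges. For a sphere packing the sum is
over tetrahedra, and the edge lies in one of them: otherwise its cone defect would be \<open>2 * pi\<close>, not \<open>0\<close>.\<close>

lemma dual_weight_energy_pos:
  fixes w :: "'v::finite \<Rightarrow> real"
  assumes T: "triangulates T M" and conn: "connected_space M" and d: "pf_metric T d"
    and flat: "\<And>i j. (i, j) \<in> directed_edges T \<Longrightarrow> angle_defect T (edge_len d) i j = 0"
    and alt: "(\<forall>(i, j) \<in> directed_edges T. dual_length T d i j > 0) \<or> in_sphere_packing_image T d"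
    and nc: "w u \<noteq> w v"
  shows "(\<Sum>(i, j, k, l)\<in>tet_tuples T. dual_weight d i j k l * (w i - w j)\<^sup>2) > 0"
proof -
  have cx: "abstract_complex T" using T by (simp add: triangulates_def)
  obtain a b where ab: "(a, b) \<in> directed_edges T" "w a \<noteq> w b"
    using connected_triangulation_const[OF T conn, of w u v] nc by blast
  from alt show ?thesis
  proof
    assume dl: "\<forall>(i, j) \<in> directed_edges T. dual_length T d i j > 0"
    let ?f = "\<lambda>(i, j). 2 * dual_length T d i j / edge_len d i j * (w i - w j)\<^sup>2"
    have "0 \<le> ?f p" if p: "p \<in> directed_edges T" for p
    proof -
      obtain i j where ij: "p = (i, j)" by (cases p)
      then have "dual_length T d i j > 0" "edge_len d i j > 0"
        using p dl edge_len_pos[OF cx d] by auto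
      then show ?thesis by (simp add: ij)
    qed
    moreover have "0 < ?f (a, b)"
      using dl edge_len_pos[OF cx d ab(1)] ab by auto
    ultimately have "0 < sum ?f (directed_edges T)"
      by (intro sum_pos2[OF _ ab(1)]) auto
    then show ?thesis unfolding dual_weight_sum_eq_dual_length[OF cx] .
  next
    assume "in_sphere_packing_image T d"
    then obtain x where x: "eq_on_directed_edges T d (sphere_packing x)"
      by (auto simp: in_sphere_packing_image_def)
    define r where "r = (\<lambda>i. exp (x $ i))"
    have tet: "metric_simplex d {i, j, k, l}" "distinct [i, j, k, l]"
      "sphere_packing_simplex d r {i, j, k, l}" if "(i, j, k, l) \<in> tet_tuples T" for i j k l
    proof -
      have t: "{i, j, k, l} \<in> T" "card {i, j, k, l} = 4" using that by (auto simp: tet_tuples_def)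
      show "metric_simplex d {i, j, k, l}" by (rule metric_simplex_of_pf_metric[OF cx d t(1)])
      show "distinct [i, j, k, l]" using t(2) by (simp only: card4_iff)
      have "d y z = r y" if "y \<in> {i, j, k, l}" "z \<in> {i, j, k, l}" "y \<noteq> z" for y z
        using edge_in_complex[OF cx t(1) that] x
        by (auto simp: eq_on_directed_edges_def sphere_packing_def r_def)
      moreover have "r y > 0" for y by (simp add: r_def)
      ultimately show "sphere_packing_simplex d r {i, j, k, l}"
        unfolding sphere_packing_simplex_def by blast
    qed
    let ?F = "\<lambda>i j k l. dual_weight d i j k l * (w i - w j)\<^sup>2"
    let ?E = "\<lambda>(i, j, k, l). (?F i j k l + ?F i j l k) + (?F i k j l + ?F i k l j)
       + (?F i l j k + ?F i l k j) + (?F j k i l + ?F j k l i) + (?F j l i k + ?F j l k i)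
       + (?F k l i j + ?F k l j i)"
    obtain k l where kl: "(a, b, k, l) \<in> tet_tuples T"
    proof -
      have "tetrahedra_sum T a b (\<lambda>k l. arccos (dihedral_cos (edge_len d) a b k l)) \<noteq> 0"
        using flat[OF ab(1)] by (auto simp: angle_defect_def)
      then have "{(k, l). {a, b, k, l} \<in> T \<and> card {a, b, k, l} = 4} \<noteq> {}"
        unfolding tetrahedra_sum_def by (metis (no_types, lifting) div_0 sum.empty)
      then show ?thesis using that by (auto simp: tet_tuples_def)
    qed
    have "0 \<le> ?E p" if "p \<in> tet_tuples T" for p
    proof -
      obtain i j k l where p: "p = (i, j, k, l)" by (cases p) auto
      show ?thesis
        unfolding p prod.case using tet_energy_sphere_packing(1)[OF tet] that p by blast
    qed
    moreover have "0 < ?E (a, b, k, l)"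
      unfolding prod.case using ab(2) by (intro tet_energy_sphere_packing(2)[OF tet] kl) auto
    ultimately have "0 < sum ?E (tet_tuples T)"
      by (intro sum_pos2[OF _ kl]) auto
    then show ?thesis
      using sum_tet_tuples_symmetrize[of ?F T] by linarith
  qed
qed

section \<open>The curvature map of a conformal structure\<close>

definition vertex_curvature :: "'v::finite set set \<Rightarrow> (real^'v \<Rightarrow> 'v \<Rightarrow> 'v \<Rightarrow> real) \<Rightarrow> 'v \<Rightarrow> real^'v \<Rightarrow> real" where
  "vertex_curvature T C i x = (\<Sum>j\<in>{j. (i, j) \<in> directed_edges T}. angle_defect T (edge_len (C x)) i j * C x i j)"

lemma scalar_curvature_eq_vertex_curvature:
  "pf_metric T (C x) \<Longrightarrow> scalar_curvature T (C x) i = vertex_curvature T C i x"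
  unfolding scalar_curvature_def vertex_curvature_def
  by (simp add: pf_metric_def cone_defect_eq_angle_defect)

lemma directed_edges_sym: "(i, j) \<in> directed_edges T \<Longrightarrow> (j, i) \<in> directed_edges T"
  by (simp add: directed_edges_def insert_commute)

locale conformal =
  fixes T :: "'v::finite set set" and U :: "(real^'v) set" and C :: "real^'v \<Rightarrow> 'v \<Rightarrow> 'v \<Rightarrow> real"
  assumes complex: "abstract_complex T" and conf: "conformal_structure T U C"
begin

lemma open_U: "open U" and pf: "x \<in> U \<Longrightarrow> pf_metric T (C x)"
  using conf by (auto simp: conformal_structure_def)

lemma C1_metric: "(i, j) \<in> directed_edges T \<Longrightarrow> C1_on U (\<lambda>x. C x i j)"
proof -
  assume e: "(i, j) \<in> directed_edges T"
  have "\<forall>(i, j) \<in> directed_edges T. smooth_on U (\<lambda>x. C x i j)"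
    using conf by (simp add: conformal_structure_def)
  from bspec[OF this e] show ?thesis unfolding smooth_on_def prod.case by (rule spec)
qed

lemma C1_edge_len: "(i, j) \<in> directed_edges T \<Longrightarrow> C1_on U (\<lambda>x. edge_len (C x) i j)"
  unfolding edge_len_def by (rule C1_on_add[OF C1_metric C1_metric[OF directed_edges_sym]])

text \<open>The partial derivatives in the directions of other vertices than \<open>i\<close> and \<open>j\<close> vanish, and the one in the direction of
\<open>j\<close> is obtained from the reversed edge.\<close>

lemma edge_len_derivative:
  assumes x: "x \<in> U" and e: "(i, j) \<in> directed_edges T"
  shows "frechet_derivative (\<lambda>x. edge_len (C x) i j) (at x) w = C x i j * w $ i + C x j i * w $ j"
proof -
  let ?D = "frechet_derivative (\<lambda>x. edge_len (C x) i j) (at x)"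
  have ax: "?D (axis k 1) = D" if "has_partial (\<lambda>y. edge_len (C y) i j) k x D" for k D
  proof -
    have "((\<lambda>t. edge_len (C (x + t *\<^sub>R axis k 1)) i j) has_real_derivative ?D (axis k 1)) (at 0)"
      using C1_on_line_derivative[OF C1_edge_len[OF e], of x 0 "axis k 1"] x by simp
    then show ?thesis using that DERIV_unique unfolding has_partial_def by blast
  qed
  have p: "has_partial (\<lambda>y. edge_len (C y) i j) i x (C x i j)"
    "\<And>k. k \<noteq> i \<Longrightarrow> k \<noteq> j \<Longrightarrow> has_partial (\<lambda>y. C y i j) k x 0"
    if e: "(i, j) \<in> directed_edges T" for i j
  proof -
    have "\<forall>(i, j) \<in> directed_edges T. has_partial (\<lambda>y. edge_len (C y) i j) i x (C x i j) \<and>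
        (\<forall>k. k \<noteq> i \<and> k \<noteq> j \<longrightarrow> has_partial (\<lambda>y. C y i j) k x 0)"
      using conf x by (simp add: conformal_structure_def)
    from bspec[OF this e]
    show "has_partial (\<lambda>y. edge_len (C y) i j) i x (C x i j)"
      "\<And>k. k \<noteq> i \<Longrightarrow> k \<noteq> j \<Longrightarrow> has_partial (\<lambda>y. C y i j) k x 0"
      by simp_all
  qed
  have ij: "i \<noteq> j" using e by (auto simp: directed_edges_def edges_def)
  have 1: "?D (axis i 1) = C x i j" by (rule ax[OF p(1)[OF e]])
  have "has_partial (\<lambda>y. edge_len (C y) i j) j x (C x j i)"
    using p(1)[OF directed_edges_sym[OF e]] by (simp add: edge_len_commute[of _ j i])
  then have 2: "?D (axis j 1) = C x j i" by (rule ax)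
  have 3: "?D (axis k 1) = 0" if "k \<noteq> i" "k \<noteq> j" for k
  proof (rule ax)
    show "has_partial (\<lambda>y. edge_len (C y) i j) k x 0"
      using DERIV_add[OF p(2)[OF e that, unfolded has_partial_def]
          p(2)[OF directed_edges_sym[OF e] that(2,1), unfolded has_partial_def]]
      by (simp add: has_partial_def edge_len_def)
  qed
  have "?D w = (\<Sum>k\<in>UNIV. w $ k * ?D (axis k 1))"
    by (rule frechet_derivative_axis_expansion[OF C1_edge_len[OF e] x])
  also have "\<dots> = (\<Sum>k\<in>{i, j}. w $ k * ?D (axis k 1))"
    by (rule sum.mono_neutral_right) (auto simp: 3)
  also have "\<dots> = C x i j * w $ i + C x j i * w $ j" using ij by (simp add: 1 2)
  finally show ?thesis .
qed

lemma C1_dihedral: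
  assumes t: "{i, j, k, l} \<in> T" "distinct [i, j, k, l]"
  shows "C1_on U (\<lambda>x. arccos (dihedral_cos (edge_len (C x)) i j k l))"
proof -
  have e: "C1_on U (\<lambda>x. edge_len (C x) a b)" if "a \<in> {i, j, k, l}" "b \<in> {i, j, k, l}" "a \<noteq> b" for a b
    by (rule C1_edge_len[OF edge_in_complex[OF complex t(1) that]])
  have dot: "C1_on U (\<lambda>x. corner_dot (edge_len (C x)) i a b)"
    if "a \<in> {j, k, l}" "b \<in> {j, k, l}" "a \<noteq> b" for a b
    unfolding corner_dot_def
    using that t(2) by (intro C1_on_divide C1_on_add C1_on_diff C1_on_power2 C1_on_const e) auto
  have g: "C1_on U (\<lambda>x. gram2 (edge_len (C x)) i j a)" if "a \<in> {k, l}" for a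
    unfolding gram2_def
    using that t(2) by (intro C1_on_diff C1_on_mult C1_on_power2 e dot) auto
  have m: "C1_on U (\<lambda>x. mixed_gram (edge_len (C x)) i j k l)"
    unfolding mixed_gram_def
    using t(2) by (intro C1_on_diff C1_on_mult C1_on_power2 e dot) auto
  have ex: "\<exists>p. realizes (edge_len (C x)) {i, j, k, l} p" if "x \<in> U" for x
    using pf[OF that] t(1) by (simp add: pf_metric_def piecewise_flat_def)
  have pos: "gram2 (edge_len (C x)) i j k > 0" "gram2 (edge_len (C x)) i j l > 0" if "x \<in> U" for x
    using gram2_pos[OF ex[OF that], of i j k] gram2_pos[OF ex[OF that], of i j l] t(2) by auto
  show ?thesis
  proof (rule C1_on_arccos)
    show "C1_on U (\<lambda>x. dihedral_cos (edge_len (C x)) i j k l)"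
      unfolding dihedral_cos_def
      by (intro C1_on_divide C1_on_mult C1_on_sqrt m g) (use pos in \<open>force+\<close>)
    show "-1 < dihedral_cos (edge_len (C x)) i j k l \<and> dihedral_cos (edge_len (C x)) i j k l < 1"
      if "x \<in> U" for x
      using dihedral_angle_realizable(2,3)[OF ex[OF that] t(2)] by (simp add: dihedral_cos_def)
  qed
qed

lemma C1_angle_defect: "C1_on U (\<lambda>x. angle_defect T (edge_len (C x)) i j)"
proof -
  have "C1_on U (\<lambda>x. \<Sum>p\<in>{(k, l). {i, j, k, l} \<in> T \<and> card {i, j, k, l} = 4}.
      arccos (dihedral_cos (edge_len (C x)) i j (fst p) (snd p)))"
  proof (rule C1_on_sum)
    fix p assume "p \<in> {(k, l). {i, j, k, l} \<in> T \<and> card {i, j, k, l} = 4}"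
    then have "{i, j, fst p, snd p} \<in> T" "card {i, j, fst p, snd p} = 4"
      by (simp_all add: case_prod_unfold)
    then show "C1_on U (\<lambda>x. arccos (dihedral_cos (edge_len (C x)) i j (fst p) (snd p)))"
      by (intro C1_dihedral) (simp_all only: card4_iff)
  qed
  then show ?thesis
    unfolding angle_defect_def tetrahedra_sum_def case_prod_unfold
    by (intro C1_on_diff C1_on_divide C1_on_const) auto
qed

lemma C1_vertex_curvature: "C1_on U (vertex_curvature T C i)"
  unfolding vertex_curvature_def[abs_def]
  by (intro C1_on_sum C1_on_mult C1_angle_defect C1_metric) simp

lemma dihedral_line_derivative:
  assumes x: "x \<in> U" and t: "{i, j, k, l} \<in> T" "distinct [i, j, k, l]"
  shows "((\<lambda>s. arccos (dihedral_cos (edge_len (C (x + s *\<^sub>R w))) i j k l)) has_real_derivative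
     face_turn (C x) (($) w) i j k l + face_turn (C x) (($) w) i j l k) (at 0)"
proof (rule dihedral_variation)
  show "metric_simplex (C x) {i, j, k, l}" by (rule metric_simplex_of_pf_metric[OF complex pf[OF x] t(1)])
  show "distinct [i, j, k, l]" by fact
  fix a b assume ab: "a \<in> {i, j, k, l}" "b \<in> {i, j, k, l}" "a \<noteq> b"
  have e: "(a, b) \<in> directed_edges T" by (rule edge_in_complex[OF complex t(1) ab])
  show "edge_len (C (x + 0 *\<^sub>R w)) a b = edge_len (C x) a b" by simp
  show "((\<lambda>s. edge_len (C (x + s *\<^sub>R w)) a b) has_real_derivative C x a b * w $ a + C x b a * w $ b) (at 0)"
    using C1_on_line_derivative[OF C1_edge_len[OF e], of x 0 w] x
    by (simp add: edge_len_derivative[OF x e])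
qed

text \<open>As the cone defects vanish at \<open>x\<close>, the product rule leaves only their variations, and these are the angle
variations of \<open>energy_identity\<close>. The factor \<open>1 / 2\<close> comes from the two orders of \<open>k\<close> and \<open>l\<close> in the sums over
tetrahedra.\<close>

lemma curvature_jacobian_flat:
  assumes x: "x \<in> U" and flat: "\<And>i j. (i, j) \<in> directed_edges T \<Longrightarrow> angle_defect T (edge_len (C x)) i j = 0"
  shows "(\<Sum>i\<in>UNIV. w $ i * frechet_derivative (vertex_curvature T C i) (at x) w)
    = (\<Sum>(i, j, k, l)\<in>tet_tuples T. dual_weight (C x) i j k l * (w $ i - w $ j)\<^sup>2) / 2"
proof -
  define turn where "turn = (\<lambda>i j k l. face_turn (C x) (($) w) i j k l + face_turn (C x) (($) w) i j l k)"
  let ?K = "\<lambda>i j. {(k, l). {i, j, k, l} \<in> T \<and> card {i, j, k, l} = 4}"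
  let ?N = "\<lambda>i. {j. (i, j) \<in> directed_edges T}"
  have defect: "((\<lambda>s. angle_defect T (edge_len (C (x + s *\<^sub>R w))) i j) has_real_derivative
      - (\<Sum>(k, l)\<in>?K i j. turn i j k l) / 2) (at 0)" for i j
  proof -
    have "((\<lambda>s. \<Sum>p\<in>?K i j. arccos (dihedral_cos (edge_len (C (x + s *\<^sub>R w))) i j (fst p) (snd p)))
       has_real_derivative (\<Sum>p\<in>?K i j. turn i j (fst p) (snd p))) (at 0)"
    proof (rule DERIV_sum)
      fix p assume "p \<in> ?K i j"
      then have "{i, j, fst p, snd p} \<in> T" "card {i, j, fst p, snd p} = 4"
        by (simp_all add: case_prod_unfold)
      then show "((\<lambda>s. arccos (dihedral_cos (edge_len (C (x + s *\<^sub>R w))) i j (fst p) (snd p)))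
         has_real_derivative turn i j (fst p) (snd p)) (at 0)"
        unfolding turn_def by (intro dihedral_line_derivative[OF x]) (simp_all only: card4_iff)
    qed
    from DERIV_diff[OF DERIV_const[of "2 * pi"] DERIV_cdivide[OF this, of 2]]
    show ?thesis unfolding angle_defect_def tetrahedra_sum_def case_prod_unfold by simp
  qed
  have "frechet_derivative (vertex_curvature T C i) (at x) w
      = (\<Sum>j\<in>?N i. - (\<Sum>(k, l)\<in>?K i j. turn i j k l) / 2 * C x i j)" for i
  proof -
    have "((\<lambda>s. vertex_curvature T C i (x + s *\<^sub>R w)) has_real_derivative
       (\<Sum>j\<in>?N i. - (\<Sum>(k, l)\<in>?K i j. turn i j k l) / 2 * C x i j)) (at 0)"
      unfolding vertex_curvature_def
    proof (rule DERIV_sum)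
      fix j assume "j \<in> ?N i"
      then have e: "(i, j) \<in> directed_edges T" by simp
      have "((\<lambda>s. C (x + s *\<^sub>R w) i j) has_real_derivative
          frechet_derivative (\<lambda>x. C x i j) (at x) w) (at 0)"
        using C1_on_line_derivative[OF C1_metric[OF e], of x 0 w] x by simp
      from DERIV_mult[OF defect[of i j] this]
      show "((\<lambda>s. angle_defect T (edge_len (C (x + s *\<^sub>R w))) i j * C (x + s *\<^sub>R w) i j)
         has_real_derivative - (\<Sum>(k, l)\<in>?K i j. turn i j k l) / 2 * C x i j) (at 0)"
        by (simp add: flat[OF e] mult.commute)
    qed
    moreover have "((\<lambda>s. vertex_curvature T C i (x + s *\<^sub>R w)) has_real_derivative
        frechet_derivative (vertex_curvature T C i) (at x) w) (at 0)"
      using C1_on_line_derivative[OF C1_vertex_curvature, of x 0 w] x by simp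
    ultimately show ?thesis by (rule DERIV_unique[symmetric])
  qed
  then have "(\<Sum>i\<in>UNIV. w $ i * frechet_derivative (vertex_curvature T C i) (at x) w)
     = (\<Sum>i\<in>UNIV. \<Sum>j\<in>?N i. \<Sum>(k, l)\<in>?K i j. - (w $ i * C x i j * turn i j k l) / 2)"
    by (simp add: sum_distrib_left sum_distrib_right sum_divide_distrib sum_negf case_prod_unfold mult_ac)
  also have "\<dots> = (\<Sum>(i, j)\<in>Sigma UNIV ?N. \<Sum>(k, l)\<in>?K i j. - (w $ i * C x i j * turn i j k l) / 2)"
    by (rule sum.Sigma) auto
  also have "Sigma UNIV ?N = directed_edges T" by auto
  also have "(\<Sum>(i, j)\<in>directed_edges T. \<Sum>(k, l)\<in>?K i j. - (w $ i * C x i j * turn i j k l) / 2)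
     = (\<Sum>(i, j, k, l)\<in>tet_tuples T. - (w $ i * C x i j * turn i j k l) / 2)"
    by (rule sum_tet_tuples_by_edge[OF complex])
  also have "\<dots> = - (\<Sum>(i, j, k, l)\<in>tet_tuples T. w $ i * C x i j * turn i j k l) / 2"
    by (simp add: case_prod_unfold sum_negf sum_divide_distrib)
  also have "\<dots> = (\<Sum>(i, j, k, l)\<in>tet_tuples T. dual_weight (C x) i j k l * (w $ i - w $ j)\<^sup>2) / 2"
    unfolding turn_def
    by (subst energy_identity[where w = "($) w"]) (auto intro: metric_simplex_of_pf_metric[OF complex pf[OF x]])
  finally show ?thesis .
qed

text \<open>In the direction \<open>(1, \<dots>, 1)\<close> the derivative of \<open>\<ell>\<^sub>i\<^sub>j\<close> is \<open>d\<^sub>i\<^sub>j + d\<^sub>j\<^sub>i = \<ell>\<^sub>i\<^sub>j\<close>, an equation solved by the exponential function.\<close>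

lemma edge_len_uniform_scaling:
  assumes seg: "\<And>t. t \<in> closed_segment 0 s \<Longrightarrow> x + t *\<^sub>R (\<chi> i. 1) \<in> U" and e: "(i, j) \<in> directed_edges T"
  shows "edge_len (C (x + s *\<^sub>R (\<chi> i. 1))) i j = exp s * edge_len (C x) i j"
proof -
  let ?u = "(\<chi> i. 1) :: real^'v"
  define h where "h = (\<lambda>t. exp (- t) * edge_len (C (x + t *\<^sub>R ?u)) i j)"
  have "(h has_real_derivative 0) (at t within closed_segment 0 s)" if "t \<in> closed_segment 0 s" for t
  proof -
    have "((\<lambda>t. edge_len (C (x + t *\<^sub>R ?u)) i j) has_real_derivative edge_len (C (x + t *\<^sub>R ?u)) i j) (at t)"
    proof -
      have "C z i j * ?u $ i + C z j i * ?u $ j = edge_len (C z) i j" for z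
        by (simp add: edge_len_def)
      with C1_on_line_derivative[OF C1_edge_len[OF e] seg[OF that]] edge_len_derivative[OF seg[OF that] e]
      show ?thesis by simp
    qed
    then have "(h has_real_derivative 0) (at t)"
      unfolding h_def by (auto intro!: derivative_eq_intros)
    then show ?thesis by (rule has_field_derivative_at_within)
  qed
  then obtain c where "\<And>t. t \<in> closed_segment 0 s \<Longrightarrow> h t = c"
    using has_field_derivative_zero_constant[of "closed_segment 0 s" h] by auto
  then have "h s = h 0" by simp
  then show ?thesis by (simp add: h_def exp_minus field_simps)
qed

end

section \<open>Rigidity of Ricci flat metrics\<close>

theorem theorem44:
  fixes M :: "'m topology"
    and T :: "'v::finite set set"
    and d :: "'v \<Rightarrow> 'v \<Rightarrow> real"
    and f :: "real \<Rightarrow> real^'v"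
    and U :: "(real^'v) set"
    and C :: "real^'v \<Rightarrow> 'v \<Rightarrow> 'v \<Rightarrow> real"
    and \<epsilon> :: real
  assumes "closed_manifold 3 M" and "connected_space M"
    and "triangulates T M"
    and "pf_metric T d"
    and "\<forall>(i, j) \<in> directed_edges T. edge_curvature T d i j = 0"
    and "(\<forall>(i, j) \<in> directed_edges T. dual_length T d i j > 0) \<or> in_sphere_packing_image T d"
    and "conformal_variation T d \<epsilon> f U C"
    and "\<forall>t \<in> {-\<epsilon><..<\<epsilon>}. \<forall>i. scalar_curvature T (C (f t)) i = 0"
  shows "\<exists>\<delta>>0. \<delta> \<le> \<epsilon> \<and>
    (\<exists>s :: real \<Rightarrow> real. \<forall>t \<in> {-\<delta><..<\<delta>}. s t > 0 \<and>
       (\<forall>(i, j) \<in> directed_edges T. edge_len (C (f t)) i j = s t * edge_len (C (f 0)) i j))"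
proof -
  have T: "abstract_complex T" using assms(3) by (simp add: triangulates_def)
  have eps: "0 < \<epsilon>" and f: "smooth_on {-\<epsilon><..<\<epsilon>} f" and conf: "conformal_structure T U C"
    and fU: "f ` {-\<epsilon><..<\<epsilon>} \<subseteq> U" and eq0: "eq_on_directed_edges T (C (f 0)) d"
    using assms(7) by (auto simp: conformal_variation_def)
  interpret conformal T U C by unfold_locales (fact T conf)+
  define x0 where "x0 = f 0"
  have x0: "x0 \<in> U" using fU eps by (auto simp: x0_def)
  let ?d = "C x0"
  have dd: "?d i j = d i j" if "(i, j) \<in> directed_edges T" for i j
    using bspec[OF eq0[unfolded eq_on_directed_edges_def] that] by (simp add: x0_def)
  have LL: "edge_len ?d i j = edge_len d i j" if "(i, j) \<in> directed_edges T" for i j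
    using dd[OF that] dd[OF directed_edges_sym[OF that]] by (simp add: edge_len_def)
  have flat: "angle_defect T (edge_len ?d) i j = 0" if e: "(i, j) \<in> directed_edges T" for i j
  proof -
    have "edge_curvature T d i j = 0" using bspec[OF assms(5) e] by simp
    then have "cone_defect T (edge_len d) i j = 0"
      using edge_len_pos[OF T assms(4) e] by (simp add: edge_curvature_def)
    then have "angle_defect T (edge_len d) i j = 0"
      using cone_defect_eq_angle_defect[of T "edge_len d"] assms(4) by (simp add: pf_metric_def)
    moreover have "angle_defect T (edge_len ?d) i j = angle_defect T (edge_len d) i j"
      using LL by (intro angle_defect_scale[OF T, of 1]) simp_all
    ultimately show ?thesis by simp
  qed
  have alt: "(\<forall>(i, j) \<in> directed_edges T. dual_length T ?d i j > 0) \<or> in_sphere_packing_image T ?d"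
  proof -
    have "dual_length T ?d i j = dual_length T d i j" for i j
      by (rule dual_length_cong[OF T]) (use eq0 in \<open>simp add: x0_def\<close>)
    moreover have "eq_on_directed_edges T d g \<Longrightarrow> eq_on_directed_edges T ?d g" for g
      using dd by (fastforce simp: eq_on_directed_edges_def)
    ultimately show ?thesis using assms(6) by (auto simp: in_sphere_packing_image_def)
  qed
  have pos: "(\<Sum>i\<in>UNIV. w $ i * frechet_derivative (vertex_curvature T C i) (at x0) w) > 0"
    if "\<exists>u v. w $ u \<noteq> w $ v" for w
  proof -
    obtain u v where "w $ u \<noteq> w $ v" using \<open>\<exists>u v. w $ u \<noteq> w $ v\<close> by blast
    then show ?thesis
      using curvature_jacobian_flat[OF x0 flat, of w] dual_weight_energy_pos[OF assms(3,2) pf[OF x0] flat alt, of "($) w" u v] by simp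
  qed
  obtain \<rho> where \<rho>: "\<rho> > 0" "ball x0 \<rho> \<subseteq> U"
    and inj: "\<And>y z. y \<in> ball x0 \<rho> \<Longrightarrow> z \<in> ball x0 \<rho> \<Longrightarrow> (\<Sum>i\<in>UNIV. (z - y) $ i) = 0 \<Longrightarrow>
       (\<And>i. vertex_curvature T C i y = vertex_curvature T C i z) \<Longrightarrow> y = z"
    using locally_injective_of_pos_def_jacobian[OF open_U x0 C1_vertex_curvature pos] by metis
  let ?u = "(\<chi> i. 1) :: real^'v"
  \<comment> \<open>the multiple of \<open>(1, \<dots>, 1)\<close> that leaves a sums-to-zero vector when subtracted from
    \<open>f t - x0\<close>\<close>
  define mean where "mean = (\<lambda>t. (\<Sum>i\<in>UNIV. (f t - x0) $ i) / real CARD('v))"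
  have contf: "continuous_on {-\<epsilon><..<\<epsilon>} f" using f unfolding smooth_on_def by (metis Ck_on.simps(1))
  then have "continuous_on {-\<epsilon><..<\<epsilon>} mean" unfolding mean_def by (intro continuous_intros) auto
  then have "isCont (\<lambda>t. norm (mean t *\<^sub>R ?u)) 0" "isCont (\<lambda>t. dist (f t) x0) 0"
    using contf eps by (auto intro!: continuous_intros simp: continuous_on_eq_continuous_at)
  moreover have "norm (mean 0 *\<^sub>R ?u) = 0" "dist (f 0) x0 = 0" by (simp_all add: mean_def x0_def)
  ultimately have "\<forall>\<^sub>F t in at 0. norm (mean t *\<^sub>R ?u) < \<rho>" "\<forall>\<^sub>F t in at 0. dist (f t) x0 < \<rho>"
    using \<rho>(1) by (auto simp: isCont_def dest!: order_tendstoD(2))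
  then have "\<forall>\<^sub>F t in at 0. norm (mean t *\<^sub>R ?u) < \<rho> \<and> dist (f t) x0 < \<rho>" by (rule eventually_conj)
  then obtain \<delta>0 where \<delta>0: "\<delta>0 > 0"
    "\<And>t. t \<noteq> 0 \<Longrightarrow> \<bar>t\<bar> < \<delta>0 \<Longrightarrow> norm (mean t *\<^sub>R ?u) < \<rho> \<and> dist (f t) x0 < \<rho>"
    unfolding eventually_at by (auto simp: dist_real_def)
  \<comment> \<open>the point on the line has to be near \<open>x0\<close> as well, for the local injectivity to apply\<close>
  have near: "norm (mean t *\<^sub>R ?u) < \<rho> \<and> dist (f t) x0 < \<rho>" if "\<bar>t\<bar> < \<delta>0" for t
    using \<delta>0(2)[of t] that \<rho>(1) by (cases "t = 0") (simp_all add: mean_def x0_def)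
  define \<delta> where "\<delta> = min \<epsilon> \<delta>0"
  have scaled: "edge_len (C (f t)) i j = exp (mean t) * edge_len ?d i j"
    if t: "t \<in> {-\<delta><..<\<delta>}" and e: "(i, j) \<in> directed_edges T" for t i j
  proof -
    have t\<delta>: "\<bar>t\<bar> < \<delta>0" "t \<in> {-\<epsilon><..<\<epsilon>}" using t by (auto simp: \<delta>_def)
    define y where "y = x0 + mean t *\<^sub>R ?u"
    have seg: "x0 + \<tau> *\<^sub>R ?u \<in> ball x0 \<rho>" if "\<tau> \<in> closed_segment 0 (mean t)" for \<tau>
    proof -
      have "\<bar>\<tau>\<bar> \<le> \<bar>mean t\<bar>" using that by (auto simp: closed_segment_eq_real_ivl split: if_splits)
      then have "norm (\<tau> *\<^sub>R ?u) \<le> norm (mean t *\<^sub>R ?u)" by (simp add: mult_right_mono)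
      then show ?thesis using near[OF t\<delta>(1)] by (simp add: dist_norm)
    qed
    have yb: "y \<in> ball x0 \<rho>" unfolding y_def by (rule seg) simp
    have scale: "edge_len (C y) i j = exp (mean t) * edge_len ?d i j" if "(i, j) \<in> directed_edges T" for i j
      unfolding y_def using seg \<rho>(2) by (intro edge_len_uniform_scaling[OF _ that]) blast
    have "angle_defect T (edge_len (C y)) i j = angle_defect T (edge_len ?d) i j" for i j
      by (rule angle_defect_scale[OF T exp_gt_zero scale])
    then have Ky: "vertex_curvature T C i y = 0" for i
      using flat by (simp add: vertex_curvature_def)
    have fb: "f t \<in> ball x0 \<rho>" using near[OF t\<delta>(1)] by (simp add: dist_commute)
    have "scalar_curvature T (C (f t)) i = 0" for i using assms(8) t\<delta>(2) by blast
    then have Kf: "vertex_curvature T C i (f t) = 0" for i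
      using scalar_curvature_eq_vertex_curvature[of T C "f t" i] pf[of "f t"] fb \<rho>(2) by auto
    have "(\<Sum>i\<in>UNIV. (f t - y) $ i) = (\<Sum>i\<in>UNIV. (f t - x0) $ i - mean t)"
      by (simp add: y_def algebra_simps)
    also have "\<dots> = 0" by (simp add: sum_subtractf mean_def)
    finally have "y = f t" by (intro inj yb fb) (simp_all add: Ky Kf)
    then show ?thesis using scale[OF e] by simp
  qed
  have \<delta>: "\<delta> > 0" "\<delta> \<le> \<epsilon>" using eps \<delta>0(1) by (auto simp: \<delta>_def)
  have uniform: "\<forall>t \<in> {-\<delta><..<\<delta>}. exp (mean t) > 0 \<and>
       (\<forall>(i, j) \<in> directed_edges T. edge_len (C (f t)) i j = exp (mean t) * edge_len (C (f 0)) i j)"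
  proof (intro ballI conjI)
    fix t p assume t: "t \<in> {-\<delta><..<\<delta>}" and p: "p \<in> directed_edges T"
    obtain i j where "p = (i, j)" by (cases p)
    with scaled[OF t, of i j] p
    show "case p of (i, j) \<Rightarrow> edge_len (C (f t)) i j = exp (mean t) * edge_len (C (f 0)) i j"
      by (simp add: x0_def)
  qed simp
  show ?thesis
    by (rule exI[of _ \<delta>]) (intro conjI \<delta> exI[of _ "\<lambda>t. exp (mean t)"] uniform)
qed

end
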